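(* The problem At-Most-$k$-Sum with Repetitions and Target 1 is $\mathsf{W}[1]$-hard when parameterized by $k$.
   Context: At-Most-$k$-Sum with Repetitions and Target 1: given a set $A$ of integers and a parameter $k$, decide whether one can choose at most $k$ integers from $A$ (possibly with repetition) whose sum equals $1$. *)

theory Defs
  imports Complex_Main "HOL-Library.Multiset" "HOL-Library.Log_Nat"
begin

section \<open>Parameterized problems\<close>

text \<open>
  An instance is a finite sequence of integers, written in binary, together with a natural
  number as parameter.  Combinatorial inputs such as circuits are serialized to integer
  sequences; finite strings over a fixed alphabet are the special case of bounded entries.
\<close>

type_synonym instance_t = "int list \<times> nat"
type_synonym problem = "instance_t set"

definition bits :: "int \<Rightarrow> nat"
  where "bits i = floorlog 2 (nat \<bar>i\<bar>) + 1"

definition input_size :: "int list \<Rightarrow> nat"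
  where "input_size xs = (\<Sum>x\<leftarrow>xs. bits x)"


section \<open>Random access machines with logarithmic cost\<close>

text \<open>
  The machine model is a structured random access machine: registers and arrays of integers,
  of which a given program mentions only finitely many.  Every evaluation of a subexpression is
  charged the bit length of its value (and hence, for an array access, of the address and of the
  contents), so running times agree with those of Turing machines up to a polynomial.
\<close>

datatype aexp =
    Const int
  | Var nat
  | Arr nat aexp
  | Plus aexp aexp
  | Minus aexp aexp
  | Times aexp aexp
  | Div aexp aexp

datatype com =
    Skip
  | Assign nat aexp
  | Store nat aexp aexp
  | Seq com com
  | If aexp com com
  | While aexp com

record state =
  regs :: "nat \<Rightarrow> int"
  arrs :: "nat \<Rightarrow> int \<Rightarrow> int"

fun aval :: "aexp \<Rightarrow> state \<Rightarrow> int" where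
  "aval (Const i) s = i"
| "aval (Var x) s = regs s x"
| "aval (Arr a e) s = arrs s a (aval e s)"
| "aval (Plus e1 e2) s = aval e1 s + aval e2 s"
| "aval (Minus e1 e2) s = aval e1 s - aval e2 s"
| "aval (Times e1 e2) s = aval e1 s * aval e2 s"
| "aval (Div e1 e2) s = aval e1 s div aval e2 s"

fun acost :: "aexp \<Rightarrow> state \<Rightarrow> nat" where
  "acost (Const i) s = bits i"
| "acost (Var x) s = bits (regs s x)"
| "acost (Arr a e) s = acost e s + bits (aval (Arr a e) s)"
| "acost (Plus e1 e2) s = acost e1 s + acost e2 s + bits (aval (Plus e1 e2) s)"
| "acost (Minus e1 e2) s = acost e1 s + acost e2 s + bits (aval (Minus e1 e2) s)"
| "acost (Times e1 e2) s = acost e1 s + acost e2 s + bits (aval (Times e1 e2) s)"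
| "acost (Div e1 e2) s = acost e1 s + acost e2 s + bits (aval (Div e1 e2) s)"

text \<open>
  \<open>exec c s t s'\<close>: started in state \<open>s\<close>, program \<open>c\<close> halts in state \<open>s'\<close> at total cost \<open>t\<close>.
  A test succeeds iff the value of its expression is positive.
\<close>

inductive exec :: "com \<Rightarrow> state \<Rightarrow> nat \<Rightarrow> state \<Rightarrow> bool" where
  Skip: "exec Skip s 1 s"
| Assign: "exec (Assign x e) s (1 + acost e s) (s\<lparr>regs := (regs s)(x := aval e s)\<rparr>)"
| Store: "exec (Store a e1 e2) s (1 + acost e1 s + acost e2 s)
    (s\<lparr>arrs := (arrs s)(a := (arrs s a)(aval e1 s := aval e2 s))\<rparr>)"
| Seq: "\<lbrakk>exec c1 s t1 s'; exec c2 s' t2 s''\<rbrakk> \<Longrightarrow> exec (Seq c1 c2) s (t1 + t2) s''"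
| IfTrue: "\<lbrakk>aval e s > 0; exec c1 s t s'\<rbrakk> \<Longrightarrow> exec (If e c1 c2) s (1 + acost e s + t) s'"
| IfFalse: "\<lbrakk>\<not> aval e s > 0; exec c2 s t s'\<rbrakk> \<Longrightarrow> exec (If e c1 c2) s (1 + acost e s + t) s'"
| WhileTrue: "\<lbrakk>aval e s > 0; exec c s t1 s'; exec (While e c) s' t2 s''\<rbrakk>
    \<Longrightarrow> exec (While e c) s (1 + acost e s + t1 + t2) s''"
| WhileFalse: "\<not> aval e s > 0 \<Longrightarrow> exec (While e c) s (1 + acost e s) s"

text \<open>
  The sequence of an instance is held in array 0, its length in register 0, and the parameter
  in register 1.  All other registers and array cells are initially 0.
\<close>

definition init_state :: "instance_t \<Rightarrow> state"
  where "init_state = (\<lambda>(xs, k).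
    \<lparr>regs = (\<lambda>_. 0)(0 := int (length xs), 1 := int k),
     arrs = (\<lambda>a i. if a = 0 \<and> 0 \<le> i \<and> i < int (length xs) then xs ! nat i else 0)\<rparr>)"

definition holds_output :: "state \<Rightarrow> instance_t \<Rightarrow> bool"
  where "holds_output s = (\<lambda>(xs, k).
    regs s 0 = int (length xs) \<and> regs s 1 = int k \<and>
    (\<forall>i<length xs. arrs s 0 (int i) = xs ! i))"

text \<open>
  Reading off the output is charged as well.  Without this, a short run could set register 0 to a
  huge number and thereby output an exponentially long sequence of untouched cells.
\<close>

definition computes :: "com \<Rightarrow> instance_t \<Rightarrow> nat \<Rightarrow> instance_t \<Rightarrow> bool"
  where "computes c inst t inst' \<longleftrightarrow>
    (\<exists>t' s. exec c (init_state inst) t' s \<and> holds_output s inst' \<and> t = t' + input_size (fst inst'))"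

definition computable :: "(nat \<Rightarrow> nat) \<Rightarrow> bool"
  where "computable f \<longleftrightarrow> (\<exists>c. \<forall>k. \<exists>t. computes c ([], k) t ([], f k))"


section \<open>Parameterized reductions\<close>

definition fpt_reducible :: "problem \<Rightarrow> problem \<Rightarrow> bool"  (infix \<open>\<le>\<^sub>f\<^sub>p\<^sub>t\<close> 50)
  where "P \<le>\<^sub>f\<^sub>p\<^sub>t Q \<longleftrightarrow>
    (\<exists>c f g e. computable f \<and> computable g \<and>
      (\<forall>xs k. \<exists>xs' k' t.
        computes c (xs, k) t (xs', k') \<and>
        t \<le> f k * (input_size xs + 1) ^ e \<and>
        k' \<le> g k \<and>
        ((xs, k) \<in> P \<longleftrightarrow> (xs', k') \<in> Q)))"


section \<open>Boolean circuits, weft and depth\<close>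

text \<open>
  A circuit is a directed acyclic graph whose nodes are listed in topological order and are
  referred to by their position; the arguments of a gate are its in-neighbours, and the last node
  is the output.
\<close>

datatype gate = Input | Not nat | And "nat list" | Or "nat list"

type_synonym circuit = "gate list"

fun preds :: "gate \<Rightarrow> nat list" where
  "preds Input = []"
| "preds (Not j) = [j]"
| "preds (And js) = js"
| "preds (Or js) = js"

definition wf_circuit :: "circuit \<Rightarrow> bool"
  where "wf_circuit C \<longleftrightarrow> C \<noteq> [] \<and>
    (\<forall>i<length C. distinct (preds (C ! i)) \<and> (\<forall>j\<in>set (preds (C ! i)). j < i) \<and>
       (C ! i \<noteq> Input \<longrightarrow> preds (C ! i) \<noteq> []))"

definition inputs :: "circuit \<Rightarrow> nat set"
  where "inputs C = {i. i < length C \<and> C ! i = Input}"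

text \<open>An assignment is given by the set \<open>S\<close> of input nodes that are set to true.\<close>

fun gate_val :: "nat set \<Rightarrow> bool list \<Rightarrow> gate \<Rightarrow> bool" where
  "gate_val S vs Input \<longleftrightarrow> length vs \<in> S"
| "gate_val S vs (Not j) \<longleftrightarrow> \<not> vs ! j"
| "gate_val S vs (And js) \<longleftrightarrow> (\<forall>j\<in>set js. vs ! j)"
| "gate_val S vs (Or js) \<longleftrightarrow> (\<exists>j\<in>set js. vs ! j)"

definition node_vals :: "circuit \<Rightarrow> nat set \<Rightarrow> bool list"
  where "node_vals C S = foldl (\<lambda>vs g. vs @ [gate_val S vs g]) [] C"

definition satisfies :: "nat set \<Rightarrow> circuit \<Rightarrow> bool"
  where "satisfies S C \<longleftrightarrow> last (node_vals C S)"

text \<open>Directed paths from an input node to the output node, as lists of nodes.\<close>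

definition io_path :: "circuit \<Rightarrow> nat list \<Rightarrow> bool"
  where "io_path C p \<longleftrightarrow> p \<noteq> [] \<and> hd p \<in> inputs C \<and> last p = length C - 1 \<and>
    (\<forall>i. Suc i < length p \<longrightarrow> p ! Suc i < length C \<and> p ! i \<in> set (preds (C ! (p ! Suc i))))"

definition large :: "gate \<Rightarrow> bool"
  where "large g \<longleftrightarrow> length (preds g) > 2"

definition depth_le :: "circuit \<Rightarrow> nat \<Rightarrow> bool"
  where "depth_le C d \<longleftrightarrow> (\<forall>p. io_path C p \<longrightarrow> length p - 1 \<le> d)"

definition weft_le :: "circuit \<Rightarrow> nat \<Rightarrow> bool"
  where "weft_le C t \<longleftrightarrow> (\<forall>p. io_path C p \<longrightarrow> length (filter (\<lambda>i. large (C ! i)) p) \<le> t)"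

fun encode_gate :: "gate \<Rightarrow> int list" where
  "encode_gate Input = [0]"
| "encode_gate (Not j) = [1, int j]"
| "encode_gate (And js) = 2 # int (length js) # map int js"
| "encode_gate (Or js) = 3 # int (length js) # map int js"

definition encode :: "circuit \<Rightarrow> int list"
  where "encode C = concat (map encode_gate C)"

lemma encode_gate_prefix_free:
  "encode_gate g @ xs = encode_gate h @ ys \<Longrightarrow> g = h \<and> xs = ys"
  by (cases g; cases h) (auto simp: append_eq_append_conv inj_map_eq_map[OF inj_of_nat])

lemma inj_encode: "inj encode"
proof (rule injI)
  fix C D :: circuit
  have ne: "encode_gate g \<noteq> []" for g by (cases g) auto
  show "encode C = encode D \<Longrightarrow> C = D"
  proof (induction C arbitrary: D)
    case Nil
    then show ?case using ne by (cases D) (auto simp: encode_def)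
  next
    case (Cons g C)
    from Cons.prems ne obtain h D' where D: "D = h # D'"
      by (cases D) (auto simp: encode_def)
    with Cons.prems have "g = h \<and> encode C = encode D'"
      by (intro encode_gate_prefix_free) (simp add: encode_def)
    with Cons.IH D show ?case by simp
  qed
qed


section \<open>Weighted circuit satisfiability and W[1]\<close>

text \<open>
  Weighted satisfiability of circuits of weft at most \<open>t\<close> and depth at most \<open>d\<close>: is there a
  satisfying assignment of weight exactly \<open>k\<close>?  The class W[1] is the closure of these problems
  for \<open>t = 1\<close> and all constants \<open>d\<close> under parameterized reductions.
\<close>

definition WCS :: "nat \<Rightarrow> nat \<Rightarrow> problem"
  where "WCS t d = {(encode C, k) | C k.
    wf_circuit C \<and> weft_le C t \<and> depth_le C d \<and>
    (\<exists>S \<subseteq> inputs C. card S = k \<and> satisfies S C)}"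

definition W :: "nat \<Rightarrow> problem set"
  where "W t = {P. \<exists>d\<ge>1. P \<le>\<^sub>f\<^sub>p\<^sub>t WCS t d}"

definition hard_for :: "problem set \<Rightarrow> problem \<Rightarrow> bool"
  where "hard_for \<C> Q \<longleftrightarrow> (\<forall>P\<in>\<C>. P \<le>\<^sub>f\<^sub>p\<^sub>t Q)"


section \<open>At-Most-k-Sum with Repetitions and Target 1\<close>

text \<open>
  The set of integers is presented by a list; a choice with repetitions is a multiset.
\<close>

definition At_Most_k_Sum_Rep_Target_1 :: problem
  where "At_Most_k_Sum_Rep_Target_1 = {(xs, k).
    \<exists>M. set_mset M \<subseteq> set xs \<and> size M \<le> k \<and> \<Sum>\<^sub># M = 1}"

end

theory Submission
  imports Defs
begin

text \<open>
  A circuit of weft 1 and depth \<open>d\<close> is a bounded Boolean combination of large gates and inputs.  The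
  number of false (or true) arguments of a large gate is a sum of functions of at most \<open>2 ^ d\<close>
  inputs, so collecting these numbers as digits of one integer \<open>N S\<close>, where \<open>S\<close> is the set of true
  inputs, gives a function of degree at most \<open>r = 2 ^ d\<close>.  By Moebius inversion,
  \<open>N S = (\<Sum>X \<subseteq> S, card X \<le> r. mob N X)\<close>, and \<open>S\<close> is satisfying iff \<open>N S\<close> lies in a set \<open>Good\<close> of
  polynomial size.

  This is a summation problem.  One number is chosen for each \<open>i \<le> k\<close>, naming the \<open>i\<close>-th element of
  \<open>S\<close>; one for each set \<open>U\<close> of at most \<open>r\<close> indices, naming the subset \<open>X\<close> of \<open>S\<close> with these indices and
  carrying the weight \<open>mob N X\<close>; and one number \<open>1 - v - T\<close> with \<open>v \<in> Good\<close>.  Here \<open>T\<close> has a digit 1 for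
  every other number to be chosen, and further digits in a large base check the consistency of the
  choices.  Since \<open>T\<close> forces all kinds of numbers to occur equally often, the bound on the number of
  summands and the target 1 leave exactly one of each.

  To see that this is computable in polynomial time on the given machine, the numbers are written
  in a language of expressions with bounded sums, products and iterations, which is compiled once
  and for all with a polynomial time bound.
\<close>

section \<open>Random access machines\<close>

text \<open>The number of summands is the new parameter and may not grow with the circuit, although
  a large gate reads unboundedly many inputs. Bounded degree resolves this: only subsets of
  \<open>S\<close> with at most \<open>r\<close> elements carry weight, at most
  \<open>(k + 1) ^ r\<close> many. As \<open>S\<close> is not known in advance, they are addressed
  by sets of indices. Consistency is checked entry by entry: for an index set \<open>U\<close> and a
  place \<open>a\<close> in its sorted list, one digit receives the \<open>a\<close>-th element of
  the chosen subset and minus the element named for the \<open>a\<close>-th index, so it vanishes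
  iff the two agree. Since subsets are listed in increasing order, the index sets
  \<open>{i, j}\<close> force the named elements to increase strictly, which excludes repetitions;
  this needs \<open>r \<ge> 2\<close>, hence \<open>d \<ge> 1\<close>. Singletons force the elements
  to be inputs. Target 1 instead of 0 rules out the empty choice. Exponents of the base are of order
  \<open>Z ^ r\<close>, so for fixed depth the numbers have polynomial length, and
  \<open>Good\<close> is enumerated by testing all values below \<open>Z ^ r\<close>. Weft and depth
  are tested by the reduction itself; it outputs the empty list when the test fails.\<close>

fun aexp_bound :: "aexp \<Rightarrow> nat" where
  "aexp_bound (Const i) = 0"
| "aexp_bound (Var x) = Suc x"
| "aexp_bound (Arr a e) = max (Suc a) (aexp_bound e)"
| "aexp_bound (Plus e1 e2) = max (aexp_bound e1) (aexp_bound e2)"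
| "aexp_bound (Minus e1 e2) = max (aexp_bound e1) (aexp_bound e2)"
| "aexp_bound (Times e1 e2) = max (aexp_bound e1) (aexp_bound e2)"
| "aexp_bound (Div e1 e2) = max (aexp_bound e1) (aexp_bound e2)"

fun com_bound :: "com \<Rightarrow> nat" where
  "com_bound Skip = 0"
| "com_bound (Assign x e) = max (Suc x) (aexp_bound e)"
| "com_bound (Store a e1 e2) = max (Suc a) (max (aexp_bound e1) (aexp_bound e2))"
| "com_bound (Seq c1 c2) = max (com_bound c1) (com_bound c2)"
| "com_bound (If e c1 c2) = max (aexp_bound e) (max (com_bound c1) (com_bound c2))"
| "com_bound (While e c) = max (aexp_bound e) (com_bound c)"

text \<open>Provides fresh memory: after a run from an initial state, every register and array from
  \<open>max 2 (com_bound c)\<close> on is still 0, so a relocated program can start there.\<close>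

lemma exec_frame:
  assumes "exec c s t s'" "com_bound c \<le> b" "b \<le> r"
  shows "regs s' r = regs s r" "arrs s' r = arrs s r"
  using assms by (induction rule: exec.induct) auto

section \<open>Relocation of programs to higher registers and arrays\<close>

fun ashift :: "nat \<Rightarrow> aexp \<Rightarrow> aexp" where
  "ashift m (Const i) = Const i"
| "ashift m (Var x) = Var (m + x)"
| "ashift m (Arr a e) = Arr (m + a) (ashift m e)"
| "ashift m (Plus e1 e2) = Plus (ashift m e1) (ashift m e2)"
| "ashift m (Minus e1 e2) = Minus (ashift m e1) (ashift m e2)"
| "ashift m (Times e1 e2) = Times (ashift m e1) (ashift m e2)"
| "ashift m (Div e1 e2) = Div (ashift m e1) (ashift m e2)"

fun shift :: "nat \<Rightarrow> com \<Rightarrow> com" where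
  "shift m Skip = Skip"
| "shift m (Assign x e) = Assign (m + x) (ashift m e)"
| "shift m (Store a e1 e2) = Store (m + a) (ashift m e1) (ashift m e2)"
| "shift m (Seq c1 c2) = Seq (shift m c1) (shift m c2)"
| "shift m (If e c1 c2) = If (ashift m e) (shift m c1) (shift m c2)"
| "shift m (While e c) = While (ashift m e) (shift m c)"

definition unshift :: "nat \<Rightarrow> state \<Rightarrow> state" where
  "unshift m s = \<lparr>regs = \<lambda>r. regs s (m + r), arrs = \<lambda>a. arrs s (m + a)\<rparr>"

lemma unshift_simps [simp]:
  "regs (unshift m s) r = regs s (m + r)" "arrs (unshift m s) a = arrs s (m + a)"
  by (auto simp: unshift_def)

lemma aval_ashift [simp]: "aval (ashift m e) s = aval e (unshift m s)"
  by (induction e) auto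

lemma acost_ashift [simp]: "acost (ashift m e) s = acost e (unshift m s)"
  by (induction e) auto

lemma aexp_bound_ashift: "aexp_bound (ashift m e) \<le> m + aexp_bound e"
  by (induction e) auto

lemma com_bound_shift: "com_bound (shift m c) \<le> m + com_bound c"
proof (induction c)
  case (Assign x e) then show ?case using aexp_bound_ashift[of m e] by auto
next
  case (Store a e1 e2) then show ?case
    using aexp_bound_ashift[of m e1] aexp_bound_ashift[of m e2] by auto
next
  case (If e c1 c2) then show ?case using aexp_bound_ashift[of m e] by auto
next
  case (While e c) then show ?case using aexp_bound_ashift[of m e] by auto
qed auto

text \<open>Costs are charged on the values that occur, never on register names, so the relocated
  run takes exactly the same time. The clause for \<open>r < m\<close> allows data to be parked
  below the relocated block.\<close>

lemma exec_shift:
  assumes "exec c u t u'" "unshift m s = u"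
  shows "\<exists>s'. exec (shift m c) s t s' \<and> unshift m s' = u' \<and>
    (\<forall>r<m. regs s' r = regs s r \<and> arrs s' r = arrs s r)"
  using assms
proof (induction arbitrary: s rule: exec.induct)
  case (Skip u)
  then show ?case using exec.Skip[of s] by (intro exI[of _ s]) simp
next
  case (Assign x e u)
  have "exec (Assign (m + x) (ashift m e)) s (1 + acost (ashift m e) s)
    (s\<lparr>regs := (regs s)(m + x := aval (ashift m e) s)\<rparr>)" by (rule exec.Assign)
  with Assign show ?case by (auto simp: unshift_def fun_eq_iff intro!: exI)
next
  case (Store a e1 e2 u)
  have "exec (Store (m + a) (ashift m e1) (ashift m e2)) s
    (1 + acost (ashift m e1) s + acost (ashift m e2) s)
    (s\<lparr>arrs := (arrs s)(m + a := (arrs s (m + a))(aval (ashift m e1) s := aval (ashift m e2) s))\<rparr>)"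
    by (rule exec.Store)
  with Store show ?case by (auto simp: unshift_def fun_eq_iff intro!: exI)
next
  case (Seq c1 u t1 u1 c2 t2 u2)
  then obtain s1 where 1: "exec (shift m c1) s t1 s1" "unshift m s1 = u1"
    "\<forall>r<m. regs s1 r = regs s r \<and> arrs s1 r = arrs s r" by blast
  with Seq obtain s2 where "exec (shift m c2) s1 t2 s2" "unshift m s2 = u2"
    "\<forall>r<m. regs s2 r = regs s1 r \<and> arrs s2 r = arrs s1 r" by blast
  with 1 show ?case by (auto intro!: exI exec.Seq)
next
  case (IfTrue e u c1 t u' c2)
  then obtain s1 where 1: "exec (shift m c1) s t s1" "unshift m s1 = u'"
    "\<forall>r<m. regs s1 r = regs s r \<and> arrs s1 r = arrs s r" by blast
  from IfTrue have "exec (If (ashift m e) (shift m c1) (shift m c2)) s (1 + acost (ashift m e) s + t) s1"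
    by (intro exec.IfTrue 1) simp
  with 1 IfTrue show ?case by auto
next
  case (IfFalse e u c2 t u' c1)
  then obtain s1 where 1: "exec (shift m c2) s t s1" "unshift m s1 = u'"
    "\<forall>r<m. regs s1 r = regs s r \<and> arrs s1 r = arrs s r" by blast
  from IfFalse have "exec (If (ashift m e) (shift m c1) (shift m c2)) s (1 + acost (ashift m e) s + t) s1"
    by (intro exec.IfFalse 1) simp
  with 1 IfFalse show ?case by auto
next
  case (WhileTrue e u c t1 u1 t2 u2)
  then obtain s1 where 1: "exec (shift m c) s t1 s1" "unshift m s1 = u1"
    "\<forall>r<m. regs s1 r = regs s r \<and> arrs s1 r = arrs s r" by blast
  with WhileTrue obtain s2 where 2: "exec (While (ashift m e) (shift m c)) s1 t2 s2"
    "unshift m s2 = u2" "\<forall>r<m. regs s2 r = regs s1 r \<and> arrs s2 r = arrs s1 r"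
    by (metis shift.simps(6))
  from WhileTrue have "exec (While (ashift m e) (shift m c)) s (1 + acost (ashift m e) s + t1 + t2) s2"
    by (intro exec.WhileTrue[OF _ 1(1) 2(1)]) simp
  with 1 2 WhileTrue show ?case by auto
next
  case (WhileFalse e u c)
  then have "exec (While (ashift m e) (shift m c)) s (1 + acost (ashift m e) s) s"
    by (intro exec.WhileFalse) simp
  with WhileFalse show ?case by auto
qed

text \<open>The rule for all counting loops below. The test has the value \<open>n - i\<close> after
  \<open>i\<close> rounds, so there are \<open>n\<close> rounds and one failing test, whence the
  factor \<open>n + 1\<close>. The induction runs over the rounds that are left.\<close>

lemma exec_while_count:
  assumes test: "\<And>i s. P i s \<Longrightarrow> i \<le> n \<Longrightarrow> aval e s = int n - int i \<and> acost e s \<le> A"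
    and body: "\<And>i s. P i s \<Longrightarrow> i < n \<Longrightarrow> \<exists>t s'. exec c s t s' \<and> t \<le> T \<and> P (Suc i) s'"
    and start: "P 0 s"
  shows "\<exists>t s'. exec (While e c) s t s' \<and> t \<le> (n + 1) * (A + T + 1) \<and> P n s'"
proof -
  have "\<exists>t s'. exec (While e c) s t s' \<and> t \<le> (j + 1) * (A + T + 1) \<and> P n s'"
    if "P i s" "i + j = n" for i j s
    using that
  proof (induction j arbitrary: i s)
    case 0
    then have "aval e s = 0" "acost e s \<le> A" using test[of i s] by auto
    with 0 exec.WhileFalse[of e s c] show ?case
      by (intro exI[of _ "1 + acost e s"] exI[of _ s]) auto
  next
    case (Suc j)
    then have a: "aval e s > 0" "acost e s \<le> A" using test[of i s] by auto
    from Suc body[of i s] obtain t1 s1 where 1: "exec c s t1 s1" "t1 \<le> T" "P (Suc i) s1" by auto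
    with Suc obtain t2 s2 where 2: "exec (While e c) s1 t2 s2" "t2 \<le> (j + 1) * (A + T + 1)" "P n s2"
      by (metis add_Suc_shift)
    have "exec (While e c) s (1 + acost e s + t1 + t2) s2"
      by (rule exec.WhileTrue[OF a(1) 1(1) 2(1)])
    moreover have "1 + acost e s + t1 + t2 \<le> (Suc j + 1) * (A + T + 1)"
      using a 1 2 by simp
    ultimately show ?case using 2 by blast
  qed
  from this[of 0 s n] start show ?thesis by simp
qed

subsection \<open>Bit lengths\<close>

text \<open>\<open>bits\<close> is one more than the length of the binary expansion, so that 0 still
  costs 1; hence the shift between \<open>Suc b\<close> and the exponent \<open>b\<close>. The
  estimates for sums, products and quotients are reduced to this comparison with powers of
  two.\<close>

lemma bits_le_iff: "bits i \<le> Suc b \<longleftrightarrow> \<bar>i\<bar> < 2 ^ b"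
proof -
  have "bits i \<le> Suc b \<longleftrightarrow> nat \<bar>i\<bar> < 2 ^ b"
    unfolding bits_def by (simp add: floorlog_le_iff)
  also have "\<dots> \<longleftrightarrow> \<bar>i\<bar> < 2 ^ b"
    by (simp add: nat_less_iff)
  finally show ?thesis .
qed

lemma bits_pos: "1 \<le> bits i" by (simp add: bits_def)

lemma abs_less_bits: "\<bar>i\<bar> < 2 ^ (bits i - 1)"
  using bits_le_iff[of i "bits i - 1"] bits_pos[of i] by simp

lemma bits_mono: "\<bar>i\<bar> \<le> \<bar>j\<bar> \<Longrightarrow> bits i \<le> bits j"
  using bits_le_iff[of i "bits j - 1"] abs_less_bits[of j] bits_pos[of j] by simp

lemma bits_add: "bits (i + j) \<le> bits i + bits j"
proof -
  have "\<bar>i\<bar> < 2 ^ (bits i - 1)" "\<bar>j\<bar> < 2 ^ (bits j - 1)" by (rule abs_less_bits)+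
  moreover have "(2::int) ^ (bits i - 1) \<le> 2 ^ (bits i - 1 + (bits j - 1))"
    "(2::int) ^ (bits j - 1) \<le> 2 ^ (bits i - 1 + (bits j - 1))" by (intro power_increasing; simp)+
  moreover have "(2::int) ^ Suc (bits i - 1 + (bits j - 1)) = 2 * 2 ^ (bits i - 1 + (bits j - 1))" by simp
  ultimately have "\<bar>i + j\<bar> < 2 ^ Suc (bits i - 1 + (bits j - 1))" by linarith
  then show ?thesis using bits_le_iff[of "i + j" "Suc (bits i - 1 + (bits j - 1))"]
    bits_pos[of i] bits_pos[of j] by simp
qed

lemma bits_uminus [simp]: "bits (- i) = bits i" by (simp add: bits_def)

lemma bits_diff: "bits (i - j) \<le> bits i + bits j"
  using bits_add[of i "- j"] by simp

lemma bits_mult: "bits (i * j) \<le> bits i + bits j"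
proof -
  have "\<bar>i\<bar> * \<bar>j\<bar> < 2 ^ (bits i - 1) * 2 ^ (bits j - 1)"
    by (intro mult_strict_mono' abs_less_bits) auto
  then have "\<bar>i * j\<bar> < 2 ^ (bits i - 1 + (bits j - 1))" by (simp add: abs_mult power_add)
  then show ?thesis using bits_le_iff[of "i * j" "bits i - 1 + (bits j - 1)"]
    bits_pos[of i] bits_pos[of j] by simp
qed

text \<open>Division rounds down, so for a positive divisor a negative quotient \<open>q\<close> is
  treated separately: there \<open>i < (q + 1) * j \<le> q + 1\<close> because
  \<open>q + 1 \<le> 0\<close>. A negative divisor becomes positive by negating both arguments, and
  division by 0 yields 0.\<close>

lemma abs_div_le: "\<bar>i div j\<bar> \<le> \<bar>i :: int\<bar>"
proof -
  have pos: "\<bar>i div j\<bar> \<le> \<bar>i\<bar>" if "j > 0" for i j :: int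
  proof (cases "i div j \<ge> 0")
    case True
    have "i div j * 1 \<le> i div j * j" using that True by (intro mult_left_mono) auto
    also have "\<dots> \<le> i" using div_mult_mod_eq[of i j] pos_mod_sign[OF that, of i] by linarith
    finally show ?thesis using True by simp
  next
    case False
    have "i < i div j * j + j" using div_mult_mod_eq[of i j] pos_mod_bound[OF that, of i] by linarith
    also have "\<dots> = (i div j + 1) * j" by (simp add: algebra_simps)
    also have "\<dots> \<le> (i div j + 1) * 1" using that False by (intro mult_left_mono_neg) auto
    finally show ?thesis using False by simp
  qed
  consider "j > 0" | "j = 0" | "- j > 0" by linarith
  then show ?thesis
  proof cases
    case 3
    from pos[OF this, of "- i"] show ?thesis by simp
  qed (use pos in auto)
qed

lemma bits_div: "bits (i div j) \<le> bits i" by (intro bits_mono abs_div_le)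

text \<open>Applied to counters, lengths and parameters. There the value itself is polynomially
  bounded, so a linear estimate suffices.\<close>

lemma bits_of_nat: "bits (int n) \<le> Suc n"
  using bits_le_iff[of "int n" n] by (metis abs_of_nat less_exp of_nat_less_iff of_nat_numeral of_nat_power)

lemma bits_le_input_size: "x \<in> set xs \<Longrightarrow> bits x \<le> input_size xs"
  unfolding input_size_def by (induction xs) auto

lemma length_le_input_size: "length xs \<le> input_size xs"
  unfolding input_size_def by (induction xs) (auto simp: bits_def)

lemma input_size_le:
  assumes "\<And>x. x \<in> set xs \<Longrightarrow> bits x \<le> b"
  shows "input_size xs \<le> length xs * b"
  unfolding input_size_def using assms
  by (induction xs) (auto simp: add_mono)

subsection \<open>Composition of programs\<close>

definition copy_loop :: "nat \<Rightarrow> nat \<Rightarrow> nat \<Rightarrow> nat \<Rightarrow> com" where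
  "copy_loop i n a b = Seq (Assign i (Const 0))
    (While (Minus (Var n) (Var i))
      (Seq (Store b (Var i) (Arr a (Var i))) (Assign i (Plus (Var i) (Const 1)))))"

lemma bits_0 [simp]: "bits 0 = 1" and bits_1 [simp]: "bits 1 = 2"
  by (simp_all add: bits_def floorlog_def)

text \<open>Cells of \<open>b\<close> beyond the first \<open>l\<close> keep their contents. This
  yields a proper initial array if \<open>b\<close> was all 0 before, and it does no harm at the
  end, where an output is read off only up to its length.\<close>

lemma exec_copy_loop:
  assumes "i \<noteq> n" "a \<noteq> b" "regs s n = int l" "\<And>j. j < l \<Longrightarrow> bits (arrs s a (int j)) \<le> L"
  shows "\<exists>t s'. exec (copy_loop i n a b) s t s' \<and> t \<le> (l + 1) * (7 * l + L + 20) + 2 \<and>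
    (\<forall>r. r \<noteq> i \<longrightarrow> regs s' r = regs s r) \<and> (\<forall>c. c \<noteq> b \<longrightarrow> arrs s' c = arrs s c) \<and>
    arrs s' b = (\<lambda>j. if 0 \<le> j \<and> j < int l then arrs s a j else arrs s b j)"
proof -
  define P where "P j s' \<longleftrightarrow> regs s' i = int j \<and> (\<forall>r. r \<noteq> i \<longrightarrow> regs s' r = regs s r) \<and>
    (\<forall>c. c \<noteq> b \<longrightarrow> arrs s' c = arrs s c) \<and>
    arrs s' b = (\<lambda>x. if 0 \<le> x \<and> x < int j then arrs s a x else arrs s b x)" for j and s' :: state
  have b: "bits (int j) \<le> Suc l" if "j \<le> l" for j
    using bits_of_nat[of j] that by linarith
  let ?body = "Seq (Store b (Var i) (Arr a (Var i))) (Assign i (Plus (Var i) (Const 1)))"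
  let ?s0 = "s\<lparr>regs := (regs s)(i := 0)\<rparr>"
  have "\<exists>t s'. exec (While (Minus (Var n) (Var i)) ?body) ?s0 t s' \<and>
      t \<le> (l + 1) * (3 * (l + 1) + (4 * l + L + 15) + 1) \<and> P l s'"
  proof (rule exec_while_count)
    fix j s' assume P: "P j s'" and j: "j \<le> l"
    have "regs s' n = int l" "regs s' i = int j" using P assms by (auto simp: P_def)
    then show "aval (Minus (Var n) (Var i)) s' = int l - int j \<and> acost (Minus (Var n) (Var i)) s' \<le> 3 * (l + 1)"
      using b[of l] b[of j] b[of "l - j"] j by (simp add: of_nat_diff)
  next
    fix j s' assume P: "P j s'" and j: "j < l"
    let ?s1 = "s'\<lparr>arrs := (arrs s')(b := (arrs s' b)(int j := arrs s a (int j)))\<rparr>"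
    let ?s2 = "?s1\<lparr>regs := (regs s')(i := int (Suc j))\<rparr>"
    have i: "regs s' i = int j" "arrs s' a = arrs s a" using P assms by (auto simp: P_def)
    have 1: "exec (Store b (Var i) (Arr a (Var i))) s'
      (1 + bits (int j) + (bits (int j) + bits (arrs s a (int j)))) ?s1"
      using exec.Store[of b "Var i" "Arr a (Var i)" s'] i by simp
    have 2: "exec (Assign i (Plus (Var i) (Const 1))) ?s1 (1 + (bits (int j) + 2 + bits (int (Suc j)))) ?s2"
      using exec.Assign[of i "Plus (Var i) (Const 1)" ?s1] i by (simp add: add.commute)
    have "P (Suc j) ?s2" using P assms by (auto simp: P_def fun_eq_iff)
    then show "\<exists>t s''. exec ?body s' t s'' \<and> t \<le> 4 * l + L + 15 \<and> P (Suc j) s''"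
      using exec.Seq[OF 1 2] b[of j] b[of "Suc j"] assms(4)[OF j] j
      by (intro exI conjI) (assumption, auto)
  next
    show "P 0 ?s0" by (auto simp: P_def fun_eq_iff)
  qed
  then obtain t s' where 1: "exec (While (Minus (Var n) (Var i)) ?body) ?s0 t s'"
    "t \<le> (l + 1) * (3 * (l + 1) + (4 * l + L + 15) + 1)" "P l s'" by blast
  have 2: "exec (Assign i (Const 0)) s 2 ?s0" using exec.Assign[of i "Const 0" s] by (simp add: numeral_2_eq_2)
  have "3 * (l + 1) + (4 * l + L + 15) + 1 \<le> 7 * l + L + 20" by simp
  then have "t \<le> (l + 1) * (7 * l + L + 20)" using 1(2) by (meson le_trans mult_le_mono2)
  then show ?thesis using exec.Seq[OF 2 1(1)] 1(3) unfolding copy_loop_def P_def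
    by (intro exI[of _ "2 + t"] exI[of _ s']) auto
qed

text \<open>
  The second program runs on registers and arrays which the first one leaves at 0, so that it
  finds a proper initial state; one register below them is used as a loop counter.
\<close>

definition compose :: "com \<Rightarrow> com \<Rightarrow> com" where
  "compose c1 c2 = (let i = com_bound c1 + 2; m = com_bound c1 + 3 in
    Seq c1 (Seq (Assign m (Var 0)) (Seq (Assign (m + 1) (Var 1)) (Seq (copy_loop i 0 0 m)
      (Seq (shift m c2) (Seq (Assign 0 (Var m)) (Seq (Assign 1 (Var (m + 1))) (copy_loop i 0 m 0))))))))"

lemma computesE:
  assumes "computes c (xs, k) t (ys, l)"
  obtains t' s where "exec c (init_state (xs, k)) t' s" "regs s 0 = int (length ys)" "regs s 1 = int l"
    "\<And>i. i < length ys \<Longrightarrow> arrs s 0 (int i) = ys ! i" "t = t' + input_size ys"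
  using assms unfolding computes_def holds_output_def by auto

text \<open>\<open>computes\<close> charges the size of the output, so \<open>t1\<close> and
  \<open>t2\<close> also bound the lengths and entries that the two copy loops move; these loops
  cause the square. Parameters are not charged, hence \<open>l\<close> and \<open>p\<close> enter
  the bound separately.\<close>

lemma computes_compose:
  assumes 1: "computes c1 (xs, k) t1 (ys, l)" and 2: "computes c2 (ys, l) t2 (zs, p)"
  shows "\<exists>t. computes (compose c1 c2) (xs, k) t (zs, p) \<and>
    t \<le> 60 * (t1 + t2 + l + p + 1) ^ 2"
proof -
  obtain t1' s1 where e1: "exec c1 (init_state (xs, k)) t1' s1" and s1: "regs s1 0 = int (length ys)"
    "regs s1 1 = int l" "\<And>i. i < length ys \<Longrightarrow> arrs s1 0 (int i) = ys ! i" and t1: "t1 = t1' + input_size ys"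
    using computesE[OF 1] by metis
  obtain t2' u where e2: "exec c2 (init_state (ys, l)) t2' u" and u: "regs u 0 = int (length zs)"
    "regs u 1 = int p" "\<And>i. i < length zs \<Longrightarrow> arrs u 0 (int i) = zs ! i" and t2: "t2 = t2' + input_size zs"
    using computesE[OF 2] by metis
  define i m where "i = com_bound c1 + 2" and "m = com_bound c1 + 3"
  have im: "i \<noteq> 0" "m \<noteq> 0" "i < m" "com_bound c1 \<le> m" "2 \<le> m" "i \<noteq> m" "i \<noteq> Suc 0" "i \<noteq> Suc m" by (auto simp: i_def m_def)
  have z: "regs s1 r = 0" "arrs s1 r = (\<lambda>_. 0)" if "m \<le> r" for r
    using exec_frame[OF e1 _ that] im that by (auto simp: init_state_def)
  let ?s2 = "s1\<lparr>regs := (regs s1)(m := int (length ys))\<rparr>"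
  have x2: "exec (Assign m (Var 0)) s1 (1 + bits (int (length ys))) ?s2"
    using exec.Assign[of m "Var 0" s1] s1 by simp
  let ?s3 = "s1\<lparr>regs := (regs s1)(m := int (length ys), m + 1 := int l)\<rparr>"
  have x3: "exec (Assign (m + 1) (Var 1)) ?s2 (1 + bits (int l)) ?s3"
    using exec.Assign[of "m + 1" "Var 1" ?s2] s1 im by simp
  have "\<exists>t s. exec (copy_loop i 0 0 m) ?s3 t s \<and> t \<le> (length ys + 1) * (7 * length ys + t1 + 20) + 2 \<and>
    (\<forall>r. r \<noteq> i \<longrightarrow> regs s r = regs ?s3 r) \<and> (\<forall>c. c \<noteq> m \<longrightarrow> arrs s c = arrs ?s3 c) \<and>
    arrs s m = (\<lambda>j. if 0 \<le> j \<and> j < int (length ys) then arrs ?s3 0 j else arrs ?s3 m j)"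
  proof (rule exec_copy_loop)
    fix j assume "j < length ys"
    then show "bits (arrs ?s3 0 (int j)) \<le> t1"
      using s1(3)[of j] bits_le_input_size[of "ys ! j" ys] t1 by simp
  qed (use im s1 in auto)
  then obtain t4 s4 where x4: "exec (copy_loop i 0 0 m) ?s3 t4 s4"
    "t4 \<le> (length ys + 1) * (7 * length ys + t1 + 20) + 2"
    and s4: "\<And>r. r \<noteq> i \<Longrightarrow> regs s4 r = regs ?s3 r" "\<And>c. c \<noteq> m \<Longrightarrow> arrs s4 c = arrs ?s3 c"
    "arrs s4 m = (\<lambda>j. if 0 \<le> j \<and> j < int (length ys) then arrs ?s3 0 j else arrs ?s3 m j)"
    by blast
  have a4: "arrs s4 m = (\<lambda>j. if 0 \<le> j \<and> j < int (length ys) then ys ! nat j else 0)"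
  proof
    fix j
    show "arrs s4 m j = (if 0 \<le> j \<and> j < int (length ys) then ys ! nat j else 0)"
      using s1(3)[of "nat j"] z(2)[of m] unfolding s4(3) by (auto simp: nat_less_iff)
  qed
  have "unshift m s4 = init_state (ys, l)"
  proof -
    have "regs s4 (m + r) = regs (init_state (ys, l)) r" for r
      using s4(1)[of "m + r"] z(1)[of "m + r"] im by (auto simp: init_state_def)
    moreover have "arrs s4 (m + a) = arrs (init_state (ys, l)) a" for a
      using s4(2)[of "m + a"] z(2)[of "m + a"] a4 by (cases "a = 0") (auto simp: init_state_def fun_eq_iff)
    ultimately show ?thesis by (simp add: unshift_def)
  qed
  from exec_shift[OF e2 this] obtain s5 where x5: "exec (shift m c2) s4 t2' s5" and s5: "unshift m s5 = u"
    by blast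
  have r5: "regs s5 m = int (length zs)" "regs s5 (m + 1) = int p" "arrs s5 m = arrs u 0"
    using u s5 unshift_simps[of m s5 0] unshift_simps[of m s5 1] by auto
  let ?s6 = "s5\<lparr>regs := (regs s5)(0 := int (length zs))\<rparr>"
  have x6: "exec (Assign 0 (Var m)) s5 (1 + bits (int (length zs))) ?s6"
    using exec.Assign[of 0 "Var m" s5] r5 by simp
  let ?s7 = "s5\<lparr>regs := (regs s5)(0 := int (length zs), 1 := int p)\<rparr>"
  have x7: "exec (Assign 1 (Var (m + 1))) ?s6 (1 + bits (int p)) ?s7"
    using exec.Assign[of 1 "Var (m + 1)" ?s6] r5 im by simp
  have "\<exists>t s. exec (copy_loop i 0 m 0) ?s7 t s \<and> t \<le> (length zs + 1) * (7 * length zs + t2 + 20) + 2 \<and>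
    (\<forall>r. r \<noteq> i \<longrightarrow> regs s r = regs ?s7 r) \<and> (\<forall>c. c \<noteq> 0 \<longrightarrow> arrs s c = arrs ?s7 c) \<and>
    arrs s 0 = (\<lambda>j. if 0 \<le> j \<and> j < int (length zs) then arrs ?s7 m j else arrs ?s7 0 j)"
  proof (rule exec_copy_loop)
    fix j assume "j < length zs"
    then show "bits (arrs ?s7 m (int j)) \<le> t2"
      using u(3)[of j] r5 bits_le_input_size[of "zs ! j" zs] t2 by simp
  qed (use im in auto)
  then obtain t8 s8 where x8: "exec (copy_loop i 0 m 0) ?s7 t8 s8"
    "t8 \<le> (length zs + 1) * (7 * length zs + t2 + 20) + 2"
    and s8: "\<And>r. r \<noteq> i \<Longrightarrow> regs s8 r = regs ?s7 r"
    "arrs s8 0 = (\<lambda>j. if 0 \<le> j \<and> j < int (length zs) then arrs ?s7 m j else arrs ?s7 0 j)" by blast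
  have out: "holds_output s8 (zs, p)"
    unfolding holds_output_def using s8(1)[of 0] s8(1)[of 1] s8(2) im r5 u(3) by auto
  define T where "T = t1 + t2 + l + p + 1"
  have b: "bits (int (length ys)) \<le> T" "bits (int l) \<le> T" "bits (int (length zs)) \<le> T" "bits (int p) \<le> T"
    "length ys \<le> T - 1" "length zs \<le> T - 1" "t1 \<le> T" "t2 \<le> T"
    using bits_of_nat[of "length ys"] bits_of_nat[of l] bits_of_nat[of "length zs"] bits_of_nat[of p]
      length_le_input_size[of ys] length_le_input_size[of zs] t1 t2 by (auto simp: T_def)
  have "1 \<le> T" by (simp add: T_def)
  let ?t = "t1' + (1 + bits (int (length ys)) + (1 + bits (int l) + (t4 + (t2' +
    (1 + bits (int (length zs)) + (1 + bits (int p) + t8))))))"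
  have *: "T * (8 * T + 13) + 2 = 8 * (T * T) + 13 * T + 2" by (simp add: algebra_simps)
  have "t4 \<le> T * (8 * T + 13) + 2"
    using b \<open>1 \<le> T\<close> by (intro order_trans[OF x4(2)] add_right_mono mult_le_mono) auto
  moreover have "t8 \<le> T * (8 * T + 13) + 2"
    using b \<open>1 \<le> T\<close> by (intro order_trans[OF x8(2)] add_right_mono mult_le_mono) auto
  moreover have "1 * T \<le> T * T" "1 \<le> T * T" using \<open>1 \<le> T\<close> by (auto intro: mult_le_mono)
  ultimately have "?t + input_size zs \<le> 60 * T ^ 2"
    using b t1 t2 \<open>1 \<le> T\<close> unfolding * power2_eq_square by linarith
  moreover have "exec (compose c1 c2) (init_state (xs, k)) ?t s8"
    unfolding compose_def Let_def i_def[symmetric] m_def[symmetric]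
    by (intro exec.Seq[OF e1] exec.Seq[OF x2] exec.Seq[OF x3] exec.Seq[OF x4(1)] exec.Seq[OF x5]
        exec.Seq[OF x6] exec.Seq[OF x7] x8(1))
  ultimately show ?thesis using out unfolding computes_def T_def fst_conv by blast
qed

subsection \<open>Computable functions\<close>

lemma computableI:
  assumes "\<And>k. \<exists>t s. exec c (init_state ([], k)) t s \<and> regs s 0 = 0 \<and> regs s 1 = int (f k)"
  shows "computable f"
  unfolding computable_def computes_def holds_output_def using assms by fastforce

lemma computable_const: "computable (\<lambda>k. n)"
proof (rule computableI[of "Assign 1 (Const (int n))"])
  fix k
  show "\<exists>t s. exec (Assign 1 (Const (int n))) (init_state ([], k)) t s \<and> regs s 0 = 0 \<and> regs s 1 = int n"
    using exec.Assign[of 1 "Const (int n)" "init_state ([], k)"]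
    by (intro exI conjI) (assumption, auto simp: init_state_def)
qed

text \<open>The two programs run on disjoint blocks. The first is relocated by 2, so its parameter
  is register 3 and \<open>k\<close> survives in register 1 for the second, whose block lies beyond
  everything the first one uses. The expression \<open>e\<close> then combines the two
  results.\<close>

lemma computable_binop:
  assumes f: "computable f" and g: "computable g"
    and h: "\<And>x y s m n. regs s x = int m \<Longrightarrow> regs s y = int n \<Longrightarrow> aval (e x y) s = int (h m n)"
  shows "computable (\<lambda>k. h (f k) (g k))"
proof -
  from f obtain cf where cf: "\<And>k. \<exists>t. computes cf ([], k) t ([], f k)" unfolding computable_def by blast
  from g obtain cg where cg: "\<And>k. \<exists>t. computes cg ([], k) t ([], g k)" unfolding computable_def by blast
  define m where "m = 4 + com_bound cf"
  have m: "com_bound (shift 2 cf) \<le> m" using com_bound_shift[of 2 cf] by (simp add: m_def)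
  have m4: "4 \<le> m" by (simp add: m_def)
  show ?thesis
  proof (rule computableI)
    fix k
    obtain t1 u1 where e1: "exec cf (init_state ([], k)) t1 u1" and u1: "regs u1 1 = int (f k)"
      using cf[of k] by (auto elim: computesE)
    obtain t2 u2 where e2: "exec cg (init_state ([], k)) t2 u2" and u2: "regs u2 1 = int (g k)"
      using cg[of k] by (auto elim: computesE)
    let ?s0 = "init_state ([], k)"
    let ?s1 = "?s0\<lparr>regs := (regs ?s0)(3 := int k)\<rparr>"
    have x1: "exec (Assign 3 (Var 1)) ?s0 (1 + bits (int k)) ?s1"
      using exec.Assign[of 3 "Var 1" ?s0] by (simp add: init_state_def)
    have "unshift 2 ?s1 = ?s0" by (auto simp: unshift_def init_state_def fun_eq_iff)
    from exec_shift[OF e1 this] obtain s2 where x2: "exec (shift 2 cf) ?s1 t1 s2" and s2: "unshift 2 s2 = u1"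
      "\<And>r. r < 2 \<Longrightarrow> regs s2 r = regs ?s1 r" by blast
    have z: "regs s2 r = 0" "arrs s2 r = (\<lambda>_. 0)" if "m \<le> r" for r
      using exec_frame[OF x2 m that] that m4 by (auto simp: init_state_def)
    have r2: "regs s2 1 = int k" "regs s2 0 = 0" "regs s2 3 = int (f k)"
      using s2(2)[of 0] s2(2)[of 1] unshift_simps(1)[of 2 s2 1] s2(1) u1 by (auto simp: init_state_def)
    let ?s3 = "s2\<lparr>regs := (regs s2)(m + 1 := int k)\<rparr>"
    have x3: "exec (Assign (m + 1) (Var 1)) s2 (1 + bits (int k)) ?s3"
      using exec.Assign[of "m + 1" "Var 1" s2] r2 by simp
    have "unshift m ?s3 = ?s0" using z by (auto simp: unshift_def init_state_def fun_eq_iff)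
    from exec_shift[OF e2 this] obtain s4 where x4: "exec (shift m cg) ?s3 t2 s4" and s4: "unshift m s4 = u2"
      "\<And>r. r < m \<Longrightarrow> regs s4 r = regs ?s3 r" by blast
    have r4: "regs s4 0 = 0" "regs s4 3 = int (f k)" "regs s4 (m + 1) = int (g k)"
      using s4(2)[of 0] s4(2)[of 3] r2 m4 unshift_simps(1)[of m s4 1] s4(1) u2 by auto
    let ?s5 = "s4\<lparr>regs := (regs s4)(1 := int (h (f k) (g k)))\<rparr>"
    have x5: "exec (Assign 1 (e 3 (m + 1))) s4 (1 + acost (e 3 (m + 1)) s4) ?s5"
      using exec.Assign[of 1 "e 3 (m + 1)" s4] h[OF r4(2,3)] by simp
    have "regs ?s5 0 = 0" "regs ?s5 1 = int (h (f k) (g k))" using r4 by auto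
    then show "\<exists>t s. exec (Seq (Assign 3 (Var 1)) (Seq (shift 2 cf) (Seq (Assign (m + 1) (Var 1))
        (Seq (shift m cg) (Assign 1 (e 3 (m + 1))))))) ?s0 t s \<and> regs s 0 = 0 \<and> regs s 1 = int (h (f k) (g k))"
      using exec.Seq[OF x1 exec.Seq[OF x2 exec.Seq[OF x3 exec.Seq[OF x4 x5]]]] by blast
  qed
qed

lemma computable_add: "computable f \<Longrightarrow> computable g \<Longrightarrow> computable (\<lambda>k. f k + g k)"
  by (rule computable_binop[where e = "\<lambda>x y. Plus (Var x) (Var y)"]) auto

lemma computable_mult: "computable f \<Longrightarrow> computable g \<Longrightarrow> computable (\<lambda>k. f k * g k)"
  by (rule computable_binop[where e = "\<lambda>x y. Times (Var x) (Var y)"]) auto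

lemma computable_power: "computable f \<Longrightarrow> computable (\<lambda>k. f k ^ n)"
  by (induction n) (auto intro: computable_const computable_mult)

subsection \<open>Polynomial reductions\<close>

text \<open>Polynomial in \<open>k\<close> as well as in the size. Such bounds are monotone, so in a
  composition the intermediate parameter \<open>l \<le> g k\<close> may be replaced by
  \<open>g k\<close>; an arbitrary computable bound would first need a computable monotone
  majorant.\<close>

definition poly_reducible :: "problem \<Rightarrow> problem \<Rightarrow> bool" where
  "poly_reducible P Q \<longleftrightarrow> (\<exists>c C q. \<forall>xs k. \<exists>xs' k' t.
    computes c (xs, k) t (xs', k') \<and> t \<le> C * (k + 1) ^ q * (input_size xs + 1) ^ q \<and>
    k' \<le> C * (k + 1) ^ q \<and> ((xs, k) \<in> P \<longleftrightarrow> (xs', k') \<in> Q))"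

text \<open>The intermediate size is at most the time of the first run, so the second run is bounded
  by a function of \<open>k\<close> times \<open>N ^ (e * q)\<close>. The exponent
  \<open>e + e * q\<close> covers both runs and is doubled by the quadratic cost of
  \<open>compose\<close>. The new bounds are built from \<open>f\<close> and \<open>g\<close> by
  sums, products and powers and therefore stay computable.\<close>

lemma fpt_reducible_poly_trans:
  assumes "P \<le>\<^sub>f\<^sub>p\<^sub>t R" "poly_reducible R Q"
  shows "P \<le>\<^sub>f\<^sub>p\<^sub>t Q"
proof -
  from assms(1) obtain c1 f g e where f: "computable f" and g: "computable g" and
    1: "\<And>xs k. \<exists>ys l t. computes c1 (xs, k) t (ys, l) \<and> t \<le> f k * (input_size xs + 1) ^ e \<and>
      l \<le> g k \<and> ((xs, k) \<in> P \<longleftrightarrow> (ys, l) \<in> R)"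
    unfolding fpt_reducible_def by blast
  from assms(2) obtain c2 C q where
    2: "\<And>ys l. \<exists>zs p t. computes c2 (ys, l) t (zs, p) \<and>
      t \<le> C * (l + 1) ^ q * (input_size ys + 1) ^ q \<and> p \<le> C * (l + 1) ^ q \<and>
      ((ys, l) \<in> R \<longleftrightarrow> (zs, p) \<in> Q)"
    unfolding poly_reducible_def by blast
  define h where "h k = C * (g k + 1) ^ q" for k
  define F where "F k = 60 * ((f k + 1) + h k * (f k + 1) ^ q + (g k + 1) + h k) ^ 2" for k
  have "computable h" unfolding h_def
    by (intro computable_add computable_mult computable_power computable_const f g)
  moreover from this have "computable F" unfolding F_def
    by (intro computable_add computable_mult computable_power computable_const f g)
  moreover have "\<exists>zs p t. computes (compose c1 c2) (xs, k) t (zs, p) \<and>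
      t \<le> F k * (input_size xs + 1) ^ (2 * (e + e * q)) \<and> p \<le> h k \<and> ((xs, k) \<in> P \<longleftrightarrow> (zs, p) \<in> Q)" for xs k
  proof -
    define N where "N = input_size xs + 1"
    have N: "1 \<le> N" by (simp add: N_def)
    obtain ys l t1 where c1: "computes c1 (xs, k) t1 (ys, l)" and t1: "t1 \<le> f k * N ^ e"
      and l: "l \<le> g k" and iff1: "(xs, k) \<in> P \<longleftrightarrow> (ys, l) \<in> R" using 1[of xs k] N_def by blast
    obtain zs p t2 where c2: "computes c2 (ys, l) t2 (zs, p)"
      and t2: "t2 \<le> C * (l + 1) ^ q * (input_size ys + 1) ^ q" and p: "p \<le> C * (l + 1) ^ q"
      and iff2: "(ys, l) \<in> R \<longleftrightarrow> (zs, p) \<in> Q" using 2[of ys l] by blast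
    obtain t where t: "computes (compose c1 c2) (xs, k) t (zs, p)" "t \<le> 60 * (t1 + t2 + l + p + 1) ^ 2"
      using computes_compose[OF c1 c2] by blast
    have hl: "C * (l + 1) ^ q \<le> h k" unfolding h_def using l by (intro mult_le_mono power_mono) auto
    have Ne: "1 \<le> N ^ e" using N by simp
    have t1': "t1 + 1 \<le> (f k + 1) * N ^ e" using t1 Ne by (simp add: algebra_simps)
    have "input_size ys \<le> t1" using c1 by (auto elim: computesE)
    with t1' have "input_size ys + 1 \<le> (f k + 1) * N ^ e" by linarith
    then have "(input_size ys + 1) ^ q \<le> ((f k + 1) * N ^ e) ^ q" by (rule power_mono) simp
    then have "t2 \<le> h k * ((f k + 1) * N ^ e) ^ q"
      by (intro order_trans[OF t2] mult_le_mono hl)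
    also have "\<dots> = h k * (f k + 1) ^ q * N ^ (e * q)" by (simp only: power_mult_distrib power_mult mult.assoc)
    finally have t2': "t2 \<le> h k * (f k + 1) ^ q * N ^ (e * q)" .
    let ?M = "N ^ (e + e * q)"
    have M: "N ^ e \<le> ?M" "N ^ (e * q) \<le> ?M" "1 \<le> ?M" using N by (auto intro!: power_increasing)
    have "t1 + 1 \<le> (f k + 1) * ?M" using t1' M(1) by (meson le_trans mult_le_mono2)
    moreover have "t2 \<le> h k * (f k + 1) ^ q * ?M" using t2' M(2) by (meson le_trans mult_le_mono2)
    moreover have "l \<le> (g k + 1) * ?M" using order_trans[OF _ mult_le_mono2[OF M(3), of "g k + 1"], of l] l by simp
    moreover have "p \<le> h k * ?M" using p hl mult_le_mono2[OF M(3), of "h k"] by linarith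
    ultimately have "t1 + t2 + l + p + 1 \<le> ((f k + 1) + h k * (f k + 1) ^ q + (g k + 1) + h k) * ?M"
      by (simp only: distrib_right)
    then have "(t1 + t2 + l + p + 1) ^ 2 \<le> (((f k + 1) + h k * (f k + 1) ^ q + (g k + 1) + h k) * ?M) ^ 2"
      by (rule power_mono) simp
    with t(2) have "t \<le> 60 * (((f k + 1) + h k * (f k + 1) ^ q + (g k + 1) + h k) * ?M) ^ 2" by linarith
    also have "\<dots> = F k * N ^ (2 * (e + e * q))"
      unfolding F_def power_mult_distrib by (simp add: power_mult[symmetric] mult.commute mult.assoc)
    finally show ?thesis using t(1) iff1 iff2 p hl unfolding N_def by (intro exI conjI) (assumption, auto)
  qed
  ultimately show ?thesis unfolding fpt_reducible_def by blast
qed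

section \<open>Expressions with polynomially bounded evaluation\<close>

text \<open>Closed under sums and products by definition, so that bounds can be assembled along with
  the programs. Explicit constants are extracted only at the end, by
  \<open>poly_fun_bound\<close>.\<close>

inductive poly_fun :: "(nat \<Rightarrow> nat) \<Rightarrow> bool" where
  const: "poly_fun (\<lambda>_. c)"
| ident: "poly_fun (\<lambda>n. n)"
| add: "poly_fun f \<Longrightarrow> poly_fun g \<Longrightarrow> poly_fun (\<lambda>n. f n + g n)"
| mult: "poly_fun f \<Longrightarrow> poly_fun g \<Longrightarrow> poly_fun (\<lambda>n. f n * g n)"

lemma poly_fun_Suc: "poly_fun f \<Longrightarrow> poly_fun (\<lambda>n. Suc (f n))"
  using poly_fun.add[OF _ poly_fun.const[of 1], of f] by simp

lemmas poly_fun_intros = poly_fun.intros poly_fun_Suc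

lemma poly_fun_compose:
  assumes "poly_fun f" "poly_fun g" shows "poly_fun (\<lambda>n. f (g n))"
  using assms by (induction rule: poly_fun.induct) (auto intro: poly_fun.intros)

lemma poly_fun_bound:
  assumes "poly_fun f" shows "\<exists>C q. \<forall>n. f n \<le> C * (n + 1) ^ q"
  using assms
proof (induction rule: poly_fun.induct)
  case (const c)
  show ?case by (intro exI[of _ c] exI[of _ 0]) simp
next
  case ident
  show ?case by (intro exI[of _ 1] exI[of _ 1]) simp
next
  case (add f g)
  then obtain C q D r where fg: "\<And>n. f n \<le> C * (n + 1) ^ q" "\<And>n. g n \<le> D * (n + 1) ^ r" by metis
  have "f n + g n \<le> (C + D) * (n + 1) ^ (q + r)" for n
  proof -
    have "f n \<le> C * (n + 1) ^ (q + r)" "g n \<le> D * (n + 1) ^ (q + r)"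
      by (intro order_trans[OF fg(1)] order_trans[OF fg(2)] mult_le_mono2 power_increasing; simp)+
    then show ?thesis by (simp add: distrib_right)
  qed
  then show ?case by blast
next
  case (mult f g)
  then obtain C q D r where fg: "\<And>n. f n \<le> C * (n + 1) ^ q" "\<And>n. g n \<le> D * (n + 1) ^ r" by metis
  have "f n * g n \<le> (C * D) * (n + 1) ^ (q + r)" for n
    using mult_le_mono[OF fg(1)[of n] fg(2)[of n]] by (simp add: power_add ac_simps)
  then show ?case by blast
qed

text \<open>\<open>Bind\<close> is a let, \<open>Ite\<close> branches on positivity, and
  \<open>Itr y x a\<close> iterates \<open>a\<close> with counter \<open>y\<close> and state
  \<open>x\<close>, starting from 0.\<close>

datatype 'v exp =
    Cst int
  | Vr 'v
  | Inp "'v exp"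
  | Add "'v exp" "'v exp"
  | Sub "'v exp" "'v exp"
  | Mul "'v exp" "'v exp"
  | Quo "'v exp" "'v exp"
  | Ite "'v exp" "'v exp" "'v exp"
  | Bind 'v "'v exp" "'v exp"
  | Summ 'v "'v exp"
  | Prd 'v "'v exp"
  | Itr 'v 'v "'v exp"

definition lookup :: "int list \<Rightarrow> int \<Rightarrow> int" where
  "lookup xs i = (if 0 \<le> i \<and> i < int (length xs) then xs ! nat i else 0)"

definition clamp :: "nat \<Rightarrow> int \<Rightarrow> int" where
  "clamp Z v = (if 0 \<le> v \<and> v \<le> int Z then v else 0)"

primrec iter :: "nat \<Rightarrow> (nat \<Rightarrow> int \<Rightarrow> int) \<Rightarrow> nat \<Rightarrow> int" where
  "iter Z f 0 = 0"
| "iter Z f (Suc j) = clamp Z (f j (iter Z f j))"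

lemma iter_bounds: "0 \<le> iter Z f j" "iter Z f j \<le> int Z"
  by (cases j; simp add: clamp_def)+

text \<open>
  All loops run from 0 to \<open>Z - 1\<close>, and the iteration in \<open>Itr\<close> is confined to \<open>{0..Z}\<close>.  This is what
  keeps every expression of the language computable in time polynomial in \<open>Z\<close> and the bit lengths.
\<close>

primrec ev :: "int list \<Rightarrow> nat \<Rightarrow> 'v exp \<Rightarrow> ('v \<Rightarrow> int) \<Rightarrow> int" where
  "ev xs Z (Cst i) \<rho> = i"
| "ev xs Z (Vr x) \<rho> = \<rho> x"
| "ev xs Z (Inp e) \<rho> = lookup xs (ev xs Z e \<rho>)"
| "ev xs Z (Add a b) \<rho> = ev xs Z a \<rho> + ev xs Z b \<rho>"
| "ev xs Z (Sub a b) \<rho> = ev xs Z a \<rho> - ev xs Z b \<rho>"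
| "ev xs Z (Mul a b) \<rho> = ev xs Z a \<rho> * ev xs Z b \<rho>"
| "ev xs Z (Quo a b) \<rho> = ev xs Z a \<rho> div ev xs Z b \<rho>"
| "ev xs Z (Ite c a b) \<rho> = (if ev xs Z c \<rho> > 0 then ev xs Z a \<rho> else ev xs Z b \<rho>)"
| "ev xs Z (Bind x a b) \<rho> = ev xs Z b (\<rho>(x := ev xs Z a \<rho>))"
| "ev xs Z (Summ x a) \<rho> = (\<Sum>i<Z. ev xs Z a (\<rho>(x := int i)))"
| "ev xs Z (Prd x a) \<rho> = (\<Prod>i<Z. ev xs Z a (\<rho>(x := int i)))"
| "ev xs Z (Itr y x a) \<rho> = iter Z (\<lambda>j v. ev xs Z a (\<rho>(y := int j, x := v))) Z"

text \<open>One number \<open>M\<close> bounds the loop length and all bit lengths at once, so that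
  growth is described by polynomials in a single variable. The clause \<open>1 \<le> M\<close> pays
  for the value 0 of a lookup outside the input.\<close>

definition bounded :: "nat \<Rightarrow> int list \<Rightarrow> nat \<Rightarrow> ('v \<Rightarrow> int) \<Rightarrow> bool" where
  "bounded M xs Z \<rho> \<longleftrightarrow> Z \<le> M \<and> 1 \<le> M \<and> (\<forall>x. bits (\<rho> x) \<le> M) \<and> (\<forall>x\<in>set xs. bits x \<le> M)"

lemma bounded_mono: "bounded M xs Z \<rho> \<Longrightarrow> M \<le> N \<Longrightarrow> bounded N xs Z \<rho>"
  unfolding bounded_def by (meson le_trans)

lemma bounded_upd: "bounded M xs Z \<rho> \<Longrightarrow> bits v \<le> M \<Longrightarrow> bounded M xs Z (\<rho>(x := v))"
  unfolding bounded_def by auto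

lemma bounded_loop: "bounded M xs Z \<rho> \<Longrightarrow> i < Z \<Longrightarrow> bounded M xs Z (\<rho>(x := int i))"
  using bits_of_nat[of i] by (intro bounded_upd) (auto simp: bounded_def)

lemma bits_sum:
  assumes "\<And>i. i < n \<Longrightarrow> bits (f i) \<le> b" shows "bits (\<Sum>i<n. f i) \<le> 1 + n * b"
  using assms
proof (induction n)
  case (Suc n)
  then have "bits (\<Sum>i<n. f i) \<le> 1 + n * b" "bits (f n) \<le> b" by auto
  then show ?case using bits_add[of "\<Sum>i<n. f i" "f n"] by simp
qed simp

lemma bits_prod:
  assumes "\<And>i. i < n \<Longrightarrow> bits (f i) \<le> b" shows "bits (\<Prod>i<n. f i) \<le> 2 + n * b"
  using assms
proof (induction n)
  case (Suc n)
  then have "bits (\<Prod>i<n. f i) \<le> 2 + n * b" "bits (f n) \<le> b" by auto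
  then show ?case using bits_mult[of "\<Prod>i<n. f i" "f n"] by simp
qed simp

lemma bits_iter: "bits (iter Z f j) \<le> Suc Z"
proof -
  have "bits (iter Z f j) \<le> bits (int Z)" using iter_bounds[of Z f j] by (intro bits_mono) simp
  then show ?thesis using bits_of_nat[of Z] by simp
qed

lemma bits_lookup: "bounded M xs Z \<rho> \<Longrightarrow> bits (lookup xs i) \<le> M"
  unfolding lookup_def bounded_def by (auto simp: nat_less_iff)

definition value_bound :: "'v exp \<Rightarrow> (nat \<Rightarrow> nat) \<Rightarrow> bool" where
  "value_bound e p \<longleftrightarrow> poly_fun p \<and> (\<forall>xs Z \<rho> M. bounded M xs Z \<rho> \<longrightarrow> bits (ev xs Z e \<rho>) \<le> p M)"

lemma value_boundD: "value_bound e p \<Longrightarrow> bounded M xs Z \<rho> \<Longrightarrow> bits (ev xs Z e \<rho>) \<le> p M"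
  by (auto simp: value_bound_def)

text \<open>A sum or product of \<open>Z\<close> values has about \<open>Z\<close> times as many
  bits at most, and binding a value enlarges \<open>M\<close> by a polynomial, so nesting composes
  polynomials. Free iteration would break this, as repeated squaring shows; clamping gives
  \<open>Itr\<close> the bound \<open>M + 1\<close> whatever its body computes.\<close>

lemma ex_value_bound: "\<exists>p. value_bound e p"
proof (induction e)
  case (Cst i)
  have "value_bound (Cst i) (\<lambda>_. bits i)" by (auto simp: value_bound_def intro: poly_fun.intros)
  then show ?case by blast
next
  case (Vr x)
  have "value_bound (Vr x) (\<lambda>n. n)" by (auto simp: value_bound_def bounded_def intro: poly_fun.intros)
  then show ?case by blast
next
  case (Inp e)
  have "value_bound (Inp e) (\<lambda>n. n)" by (auto simp: value_bound_def intro: poly_fun.intros bits_lookup)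
  then show ?case by blast
next
  case (Add a b)
  then obtain p q where "value_bound a p" "value_bound b q" by blast
  then have "value_bound (Add a b) (\<lambda>n. p n + q n)" unfolding value_bound_def
    by (auto intro: poly_fun.intros intro!: order_trans[OF bits_add] add_mono)
  then show ?case by blast
next
  case (Sub a b)
  then obtain p q where "value_bound a p" "value_bound b q" by blast
  then have "value_bound (Sub a b) (\<lambda>n. p n + q n)" unfolding value_bound_def
    by (auto intro: poly_fun.intros intro!: order_trans[OF bits_diff] add_mono)
  then show ?case by blast
next
  case (Mul a b)
  then obtain p q where "value_bound a p" "value_bound b q" by blast
  then have "value_bound (Mul a b) (\<lambda>n. p n + q n)" unfolding value_bound_def
    by (auto intro: poly_fun.intros intro!: order_trans[OF bits_mult] add_mono)
  then show ?case by blast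
next
  case (Quo a b)
  then obtain p where "value_bound a p" by blast
  then have "value_bound (Quo a b) p" unfolding value_bound_def
    by (auto intro!: order_trans[OF bits_div])
  then show ?case by blast
next
  case (Ite c a b)
  then obtain p q where "value_bound a p" "value_bound b q" by blast
  then have "value_bound (Ite c a b) (\<lambda>n. p n + q n)" unfolding value_bound_def
    by (auto intro: poly_fun.intros trans_le_add1 trans_le_add2)
  then show ?case by blast
next
  case (Bind x a b)
  then obtain p q where p: "value_bound a p" and q: "value_bound b q" by blast
  have "bits (ev xs Z (Bind x a b) \<rho>) \<le> q (M + p M)" if b: "bounded M xs Z \<rho>" for xs Z \<rho> M
  proof -
    have "bounded (M + p M) xs Z (\<rho>(x := ev xs Z a \<rho>))"
      using bounded_mono[OF b] value_boundD[OF p b] by (intro bounded_upd) auto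
    then show ?thesis using value_boundD[OF q] by simp
  qed
  moreover have "poly_fun (\<lambda>M. q (M + p M))"
    using p q by (intro poly_fun_compose[of q "\<lambda>M. M + p M"] poly_fun_intros) (auto simp: value_bound_def)
  ultimately have "value_bound (Bind x a b) (\<lambda>M. q (M + p M))" unfolding value_bound_def by blast
  then show ?case by blast
next
  case (Summ x a)
  then obtain p where p: "value_bound a p" by blast
  have "bits (ev xs Z (Summ x a) \<rho>) \<le> 1 + M * p M" if b: "bounded M xs Z \<rho>" for xs Z \<rho> M
  proof -
    have "bits (\<Sum>i<Z. ev xs Z a (\<rho>(x := int i))) \<le> 1 + Z * p M"
      by (intro bits_sum value_boundD[OF p] bounded_loop[OF b])
    also have "\<dots> \<le> 1 + M * p M" using b by (simp add: bounded_def)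
    finally show ?thesis by simp
  qed
  moreover have "poly_fun (\<lambda>M. 1 + M * p M)" using p unfolding value_bound_def by (intro poly_fun_intros) auto
  ultimately have "value_bound (Summ x a) (\<lambda>M. 1 + M * p M)" unfolding value_bound_def by blast
  then show ?case by blast
next
  case (Prd x a)
  then obtain p where p: "value_bound a p" by blast
  have "bits (ev xs Z (Prd x a) \<rho>) \<le> 2 + M * p M" if b: "bounded M xs Z \<rho>" for xs Z \<rho> M
  proof -
    have "bits (\<Prod>i<Z. ev xs Z a (\<rho>(x := int i))) \<le> 2 + Z * p M"
      by (intro bits_prod value_boundD[OF p] bounded_loop[OF b])
    also have "\<dots> \<le> 2 + M * p M" using b by (simp add: bounded_def)
    finally show ?thesis by simp
  qed
  moreover have "poly_fun (\<lambda>M. 2 + M * p M)" using p unfolding value_bound_def by (intro poly_fun_intros) auto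
  ultimately have "value_bound (Prd x a) (\<lambda>M. 2 + M * p M)" unfolding value_bound_def by blast
  then show ?case by blast
next
  case (Itr y x a)
  have "value_bound (Itr y x a) Suc" using bits_iter
    by (auto simp: value_bound_def bounded_def intro: poly_fun_intros order_trans)
  then show ?case by blast
qed

subsection \<open>Compilation\<close>

text \<open>The common skeleton of the three loops: register \<open>t\<close> accumulates,
  \<open>Suc t\<close> counts, and the body may use everything from \<open>t + 2\<close> on.\<close>

definition accum :: "nat \<Rightarrow> int \<Rightarrow> com \<Rightarrow> com" where
  "accum t i c = Seq (Assign t (Const i)) (Seq (Assign (Suc t) (Const 0))
    (While (Minus (Var 2) (Var (Suc t))) (Seq c (Assign (Suc t) (Plus (Var (Suc t)) (Const 1))))))"

text \<open>
  Register 2 holds \<open>Z\<close>, the variable \<open>x\<close> is kept in register \<open>E x\<close>, the value is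
  delivered in register \<open>t\<close>, and the registers below \<open>t\<close> are left untouched.
\<close>

primrec compile :: "'v exp \<Rightarrow> ('v \<Rightarrow> nat) \<Rightarrow> nat \<Rightarrow> com" where
  "compile (Cst i) E t = Assign t (Const i)"
| "compile (Vr x) E t = Assign t (Var (E x))"
| "compile (Inp a) E t = Seq (compile a E t) (Assign t (Arr 0 (Var t)))"
| "compile (Add a b) E t = Seq (compile a E t) (Seq (compile b E (Suc t)) (Assign t (Plus (Var t) (Var (Suc t)))))"
| "compile (Sub a b) E t = Seq (compile a E t) (Seq (compile b E (Suc t)) (Assign t (Minus (Var t) (Var (Suc t)))))"
| "compile (Mul a b) E t = Seq (compile a E t) (Seq (compile b E (Suc t)) (Assign t (Times (Var t) (Var (Suc t)))))"
| "compile (Quo a b) E t = Seq (compile a E t) (Seq (compile b E (Suc t)) (Assign t (Div (Var t) (Var (Suc t)))))"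
| "compile (Ite c a b) E t = Seq (compile c E t) (If (Var t) (compile a E t) (compile b E t))"
| "compile (Bind x a b) E t = Seq (compile a E t) (Seq (compile b (E(x := t)) (Suc t)) (Assign t (Var (Suc t))))"
| "compile (Summ x a) E t = accum t 0 (Seq (compile a (E(x := Suc t)) (t + 2))
    (Assign t (Plus (Var t) (Var (t + 2)))))"
| "compile (Prd x a) E t = accum t 1 (Seq (compile a (E(x := Suc t)) (t + 2))
    (Assign t (Times (Var t) (Var (t + 2)))))"
| "compile (Itr y x a) E t = accum t 0 (Seq (compile a (E(y := Suc t, x := t)) (t + 2))
    (If (Minus (Const 0) (Var (t + 2))) (Assign t (Const 0))
      (If (Minus (Var (t + 2)) (Var 2)) (Assign t (Const 0)) (Assign t (Var (t + 2))))))"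

definition same :: "nat \<Rightarrow> state \<Rightarrow> state \<Rightarrow> bool" where
  "same t s s' \<longleftrightarrow> (\<forall>r<t. regs s' r = regs s r) \<and> arrs s' = arrs s"

lemma same_refl [simp]: "same t s s" by (simp add: same_def)

lemma same_trans: "same t s s' \<Longrightarrow> same t' s' s'' \<Longrightarrow> t \<le> t' \<Longrightarrow> same t s s''"
  by (auto simp: same_def)

lemma same_upd: "t \<le> r \<Longrightarrow> same t s (s'\<lparr>regs := (regs s')(r := v)\<rparr>) \<longleftrightarrow> same t s s'"
  by (auto simp: same_def)

definition ready :: "int list \<Rightarrow> nat \<Rightarrow> ('v \<Rightarrow> nat) \<Rightarrow> nat \<Rightarrow> ('v \<Rightarrow> int) \<Rightarrow> state \<Rightarrow> bool" where
  "ready xs Z E t \<rho> s \<longleftrightarrow> 2 < t \<and> regs s 2 = int Z \<and> arrs s 0 = lookup xs \<and>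
    (\<forall>x. E x < t \<and> regs s (E x) = \<rho> x)"

lemma ready_same: "ready xs Z E t \<rho> s \<Longrightarrow> same t s s' \<Longrightarrow> t \<le> t' \<Longrightarrow> ready xs Z E t' \<rho> s'"
  unfolding ready_def same_def by (metis order.strict_trans2)

lemma ready_upd: "ready xs Z E t \<rho> s \<Longrightarrow> r < t \<Longrightarrow> regs s r = v \<Longrightarrow> ready xs Z (E(x := r)) t (\<rho>(x := v)) s"
  unfolding ready_def by auto

lemma exec_accum:
  assumes t: "2 < t" and Z: "regs s 2 = int Z" and F0: "F 0 = i"
    and step: "\<And>j s'. j < Z \<Longrightarrow> same t s s' \<Longrightarrow> regs s' t = F j \<Longrightarrow> regs s' (Suc t) = int j \<Longrightarrow>
      \<exists>\<tau> s''. exec c s' \<tau> s'' \<and> \<tau> \<le> T \<and> same t s s'' \<and> regs s'' t = F (Suc j) \<and> regs s'' (Suc t) = int j"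
  shows "\<exists>\<tau> s'. exec (accum t i c) s \<tau> s' \<and> \<tau> \<le> (Z + 1) * (T + 5 * Z + 20) + bits i \<and>
    regs s' t = F Z \<and> same t s s'"
proof -
  let ?s0 = "s\<lparr>regs := (regs s)(t := i, Suc t := 0)\<rparr>"
  have b: "bits (int j) \<le> Suc Z" if "j \<le> Z" for j using bits_of_nat[of j] that by linarith
  have "\<exists>\<tau> s'. exec (While (Minus (Var 2) (Var (Suc t)))
      (Seq c (Assign (Suc t) (Plus (Var (Suc t)) (Const 1))))) ?s0 \<tau> s' \<and>
    \<tau> \<le> (Z + 1) * (3 * (Z + 1) + (T + (2 * Z + 5)) + 1) \<and>
    (same t s s' \<and> regs s' t = F Z \<and> regs s' (Suc t) = int Z)"
  proof (rule exec_while_count)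
    fix j s' assume P: "same t s s' \<and> regs s' t = F j \<and> regs s' (Suc t) = int j" and j: "j \<le> Z"
    have "regs s' 2 = int Z" using P t Z by (auto simp: same_def)
    then show "aval (Minus (Var 2) (Var (Suc t))) s' = int Z - int j \<and>
        acost (Minus (Var 2) (Var (Suc t))) s' \<le> 3 * (Z + 1)"
      using P b[of Z] b[of j] b[of "Z - j"] j by (simp add: of_nat_diff)
  next
    fix j s' assume P: "same t s s' \<and> regs s' t = F j \<and> regs s' (Suc t) = int j" and j: "j < Z"
    then obtain \<tau> s'' where 1: "exec c s' \<tau> s''" "\<tau> \<le> T" "same t s s''" "regs s'' t = F (Suc j)"
      "regs s'' (Suc t) = int j" using step by blast
    let ?s3 = "s''\<lparr>regs := (regs s'')(Suc t := int (Suc j))\<rparr>"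
    have 2: "exec (Assign (Suc t) (Plus (Var (Suc t)) (Const 1))) s'' (1 + (bits (int j) + 2 + bits (int (Suc j)))) ?s3"
      using exec.Assign[of "Suc t" "Plus (Var (Suc t)) (Const 1)" s''] 1 by (simp add: add.commute)
    have "\<tau> + (1 + (bits (int j) + 2 + bits (int (Suc j)))) \<le> T + (2 * Z + 5)"
      using 1 b[of j] b[of "Suc j"] j by simp
    moreover have "same t s ?s3 \<and> regs ?s3 t = F (Suc j) \<and> regs ?s3 (Suc t) = int (Suc j)"
      using 1 by (auto simp: same_def)
    ultimately show "\<exists>\<tau> s''. exec (Seq c (Assign (Suc t) (Plus (Var (Suc t)) (Const 1)))) s' \<tau> s'' \<and>
      \<tau> \<le> T + (2 * Z + 5) \<and> (same t s s'' \<and> regs s'' t = F (Suc j) \<and> regs s'' (Suc t) = int (Suc j))"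
      using exec.Seq[OF 1(1) 2] by blast
  next
    show "same t s ?s0 \<and> regs ?s0 t = F 0 \<and> regs ?s0 (Suc t) = int 0" using F0 by (auto simp: same_def)
  qed
  then obtain \<tau> s' where w: "exec (While (Minus (Var 2) (Var (Suc t)))
      (Seq c (Assign (Suc t) (Plus (Var (Suc t)) (Const 1))))) ?s0 \<tau> s'"
    "\<tau> \<le> (Z + 1) * (3 * (Z + 1) + (T + (2 * Z + 5)) + 1)" "same t s s'" "regs s' t = F Z" by blast
  let ?s1 = "s\<lparr>regs := (regs s)(t := i)\<rparr>"
  have 1: "exec (Assign t (Const i)) s (1 + bits i) ?s1" using exec.Assign[of t "Const i" s] by simp
  have 2: "exec (Assign (Suc t) (Const 0)) ?s1 2 ?s0"
    using exec.Assign[of "Suc t" "Const 0" ?s1] by (simp add: numeral_2_eq_2)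
  have "(Z + 1) * (3 * (Z + 1) + (T + (2 * Z + 5)) + 1) + 3 \<le> (Z + 1) * (T + 5 * Z + 20)"
    by (simp add: algebra_simps)
  then have "1 + bits i + (2 + \<tau>) \<le> (Z + 1) * (T + 5 * Z + 20) + bits i"
    using w(2) by linarith
  then show ?thesis using exec.Seq[OF 1 exec.Seq[OF 2 w(1)]] w(3,4) unfolding accum_def by blast
qed

text \<open>The polynomial is chosen before \<open>E\<close>, \<open>t\<close> and the state:
  register numbers cost nothing, so one bound serves every placement of the compiled code.\<close>

definition time_bound :: "'v exp \<Rightarrow> (nat \<Rightarrow> nat) \<Rightarrow> bool" where
  "time_bound e p \<longleftrightarrow> poly_fun p \<and> (\<forall>xs Z \<rho> M E t s. bounded M xs Z \<rho> \<longrightarrow> ready xs Z E t \<rho> s \<longrightarrow>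
    (\<exists>\<tau> s'. exec (compile e E t) s \<tau> s' \<and> \<tau> \<le> p M \<and> regs s' t = ev xs Z e \<rho> \<and> same t s s'))"

lemma time_boundD:
  assumes "time_bound e p" "bounded M xs Z \<rho>" "ready xs Z E t \<rho> s"
  obtains \<tau> s' where "exec (compile e E t) s \<tau> s'" "\<tau> \<le> p M" "regs s' t = ev xs Z e \<rho>" "same t s s'"
  using assms unfolding time_bound_def by blast

text \<open>The value bounds of the operands pay for the final operation, whose cost is linear in
  their bit lengths.\<close>

lemma time_bound_binop:
  assumes a: "time_bound a p" and b: "time_bound b q" and va: "value_bound a p'" and vb: "value_bound b q'"
    and comp: "\<And>E t. compile e E t = Seq (compile a E t) (Seq (compile b E (Suc t)) (Assign t (f (Var t) (Var (Suc t)))))"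
    and val: "\<And>xs Z \<rho> t s. regs s t = ev xs Z a \<rho> \<Longrightarrow> regs s (Suc t) = ev xs Z b \<rho> \<Longrightarrow>
       aval (f (Var t) (Var (Suc t))) s = ev xs Z e \<rho>"
    and cost: "\<And>t s. acost (f (Var t) (Var (Suc t))) s \<le> 2 * (bits (regs s t) + bits (regs s (Suc t)))"
  shows "\<exists>p. time_bound e p"
proof -
  let ?p = "\<lambda>n. p n + (q n + (1 + 2 * (p' n + q' n)))"
  have "poly_fun ?p" using assms unfolding time_bound_def value_bound_def by (intro poly_fun_intros) auto
  moreover have "\<exists>\<tau> s'. exec (compile e E t) s \<tau> s' \<and> \<tau> \<le> ?p M \<and> regs s' t = ev xs Z e \<rho> \<and> same t s s'"
    if bd: "bounded M xs Z \<rho>" and r: "ready xs Z E t \<rho> s" for xs Z \<rho> M E t s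
  proof -
    obtain \<tau>1 s1 where 1: "exec (compile a E t) s \<tau>1 s1" "\<tau>1 \<le> p M" "regs s1 t = ev xs Z a \<rho>" "same t s s1"
      by (rule time_boundD[OF a bd r])
    have "ready xs Z E (Suc t) \<rho> s1" using ready_same[OF r 1(4)] by simp
    then obtain \<tau>2 s2 where 2: "exec (compile b E (Suc t)) s1 \<tau>2 s2" "\<tau>2 \<le> q M"
      "regs s2 (Suc t) = ev xs Z b \<rho>" "same (Suc t) s1 s2"
      by (rule time_boundD[OF b bd])
    have v: "regs s2 t = ev xs Z a \<rho>" using 1 2 by (auto simp: same_def)
    note 3 = exec.Assign[of t "f (Var t) (Var (Suc t))" s2]
    have "\<tau>1 + (\<tau>2 + (1 + acost (f (Var t) (Var (Suc t))) s2)) \<le> ?p M"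
      using 1(2) 2(2) cost[of t s2] value_boundD[OF va bd] value_boundD[OF vb bd] 2(3) v by simp
    moreover have "same t s s2" using same_trans[OF 1(4) 2(4)] by simp
    ultimately show ?thesis
      using exec.Seq[OF 1(1) exec.Seq[OF 2(1) 3]] val[OF v 2(3)] unfolding comp
      by (intro exI conjI) (assumption, auto simp: same_upd)
  qed
  ultimately have "time_bound e ?p" unfolding time_bound_def by blast
  then show ?thesis by blast
qed

text \<open>\<open>F g j\<close> is the partial result after \<open>j\<close> rounds. Its bit length
  has to be controlled throughout and not only at the end, because every round pays for reading the
  accumulator.\<close>

lemma time_bound_loop:
  assumes a: "time_bound a p" and va: "value_bound a p'"
    and comp: "\<And>E t. compile e E t = accum t i (Seq (compile a (E(x := Suc t)) (t + 2)) (Assign t (f (Var t) (Var (t + 2)))))"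
    and val: "\<And>xs Z \<rho>. ev xs Z e \<rho> = F (\<lambda>j. ev xs Z a (\<rho>(x := int j))) Z"
    and step: "\<And>g j t s. regs s t = F g j \<Longrightarrow> regs s (t + 2) = g j \<Longrightarrow>
       aval (f (Var t) (Var (t + 2))) s = F g (Suc j)" and F0: "\<And>g. F g 0 = i"
    and cost: "\<And>t s. acost (f (Var t) (Var (t + 2))) s \<le> 2 * (bits (regs s t) + bits (regs s (t + 2)))"
    and Fb: "\<And>g j b. (\<And>l. l < j \<Longrightarrow> bits (g l) \<le> b) \<Longrightarrow> bits (F g j) \<le> 2 + j * b"
  shows "\<exists>p. time_bound e p"
proof -
  let ?T = "\<lambda>n. p n + (1 + 2 * (2 + n * p' n + p' n))"
  let ?p = "\<lambda>n. (n + 1) * (?T n + 5 * n + 20) + bits i"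
  have "poly_fun ?p" using assms(1,2) unfolding time_bound_def value_bound_def by (intro poly_fun_intros) auto
  moreover have "\<exists>\<tau> s'. exec (compile e E t) s \<tau> s' \<and> \<tau> \<le> ?p M \<and> regs s' t = ev xs Z e \<rho> \<and> same t s s'"
    if bd: "bounded M xs Z \<rho>" and r: "ready xs Z E t \<rho> s" for xs Z \<rho> M E t s
  proof -
    let ?g = "\<lambda>j. ev xs Z a (\<rho>(x := int j))"
    have gb: "bits (?g j) \<le> p' M" if "j < Z" for j using value_boundD[OF va bounded_loop[OF bd that]] .
    have ZM: "Z \<le> M" using bd by (simp add: bounded_def)
    have "\<exists>\<tau> s'. exec (accum t i (Seq (compile a (E(x := Suc t)) (t + 2)) (Assign t (f (Var t) (Var (t + 2)))))) s \<tau> s' \<and>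
      \<tau> \<le> (Z + 1) * (?T M + 5 * Z + 20) + bits i \<and> regs s' t = F ?g Z \<and> same t s s'"
    proof (rule exec_accum[where F = "F ?g"])
      fix j s' assume j: "j < Z" and s': "same t s s'" "regs s' t = F ?g j" "regs s' (Suc t) = int j"
      have "ready xs Z (E(x := Suc t)) (t + 2) (\<rho>(x := int j)) s'"
        using s' by (intro ready_upd ready_same[OF r]) auto
      then obtain \<tau>1 s1 where 1: "exec (compile a (E(x := Suc t)) (t + 2)) s' \<tau>1 s1" "\<tau>1 \<le> p M"
        "regs s1 (t + 2) = ?g j" "same (t + 2) s' s1"
        by (rule time_boundD[OF a bounded_loop[OF bd j]])
      have v: "regs s1 t = F ?g j" "regs s1 (Suc t) = int j" using 1 s' by (auto simp: same_def)
      note 2 = exec.Assign[of t "f (Var t) (Var (t + 2))" s1]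
      have "bits (F ?g j) \<le> 2 + j * p' M" using gb j by (intro Fb) auto
      also have "\<dots> \<le> 2 + M * p' M" using j ZM by simp
      finally have "\<tau>1 + (1 + acost (f (Var t) (Var (t + 2))) s1) \<le> ?T M"
        using cost[of t s1] 1 v gb[OF j] by simp
      moreover have "same t s s1" using same_trans[OF s'(1) 1(4)] by simp
      ultimately show "\<exists>\<tau> s''. exec (Seq (compile a (E(x := Suc t)) (t + 2)) (Assign t (f (Var t) (Var (t + 2))))) s' \<tau> s'' \<and>
        \<tau> \<le> ?T M \<and> same t s s'' \<and> regs s'' t = F ?g (Suc j) \<and> regs s'' (Suc t) = int j"
        using exec.Seq[OF 1(1) 2] step[of s1 t ?g, OF v(1) 1(3)] v
        by (intro exI conjI) (assumption, auto simp: same_upd)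
    qed (use r F0 in \<open>auto simp: ready_def\<close>)
    moreover have "(Z + 1) * (?T M + 5 * Z + 20) + bits i \<le> ?p M"
      using ZM by (intro add_right_mono mult_le_mono) auto
    ultimately show ?thesis unfolding comp val by (meson order_trans)
  qed
  ultimately have "time_bound e ?p" unfolding time_bound_def by blast
  then show ?thesis by blast
qed

lemma ex_time_bound: "\<exists>p. time_bound e p"
proof (induction e)
  case (Cst i)
  have "\<exists>\<tau> s'. exec (compile (Cst i) E t) s \<tau> s' \<and> \<tau> \<le> 1 + bits i \<and>
      regs s' t = ev xs Z (Cst i :: 'a exp) \<rho> \<and> same t s s'" for E :: "'a \<Rightarrow> nat" and xs Z \<rho> t s
  proof -
    have "exec (compile (Cst i) E t) s (1 + bits i) (s\<lparr>regs := (regs s)(t := i)\<rparr>)"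
      using exec.Assign[of t "Const i" s] by simp
    then show ?thesis by (intro exI conjI) (assumption, auto simp: same_upd)
  qed
  then have "time_bound (Cst i :: 'a exp) (\<lambda>_. 1 + bits i)"
    unfolding time_bound_def by (auto intro!: poly_fun_intros)
  then show ?case by blast
next
  case (Vr x)
  have "\<exists>\<tau> s'. exec (compile (Vr x) E t) s \<tau> s' \<and> \<tau> \<le> 1 + M \<and> regs s' t = ev xs Z (Vr x) \<rho> \<and> same t s s'"
    if "bounded M xs Z \<rho>" "ready xs Z E t \<rho> s" for xs Z \<rho> M E t s
    using exec.Assign[of t "Var (E x)" s] that
    unfolding compile.simps by (intro exI conjI) (assumption, auto simp: same_upd ready_def bounded_def)
  then have "time_bound (Vr x) (\<lambda>n. 1 + n)" unfolding time_bound_def by (auto intro!: poly_fun_intros)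
  then show ?case by blast
next
  case (Inp a)
  then obtain p where p: "time_bound a p" by blast
  obtain q where q: "value_bound a q" using ex_value_bound by blast
  have "\<exists>\<tau> s'. exec (compile (Inp a) E t) s \<tau> s' \<and> \<tau> \<le> p M + (1 + (q M + M)) \<and>
      regs s' t = ev xs Z (Inp a) \<rho> \<and> same t s s'"
    if bd: "bounded M xs Z \<rho>" and r: "ready xs Z E t \<rho> s" for xs Z \<rho> M E t s
  proof -
    obtain \<tau>1 s1 where 1: "exec (compile a E t) s \<tau>1 s1" "\<tau>1 \<le> p M" "regs s1 t = ev xs Z a \<rho>" "same t s s1"
      by (rule time_boundD[OF p bd r])
    have arr: "arrs s1 0 = lookup xs" using 1 r by (simp add: same_def ready_def)
    have 2: "exec (Assign t (Arr 0 (Var t))) s1 (1 + acost (Arr 0 (Var t)) s1)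
      (s1\<lparr>regs := (regs s1)(t := ev xs Z (Inp a) \<rho>)\<rparr>)"
      using exec.Assign[of t "Arr 0 (Var t)" s1] arr 1 by simp
    have "acost (Arr 0 (Var t)) s1 \<le> q M + M"
      using arr 1(3) value_boundD[OF q bd] bits_lookup[OF bd, of "ev xs Z a \<rho>"] by simp
    then show ?thesis using exec.Seq[OF 1(1) 2] 1
      unfolding compile.simps by (intro exI conjI) (assumption, auto simp: same_upd)
  qed
  then have "time_bound (Inp a) (\<lambda>M. p M + (1 + (q M + M)))" using p q
    unfolding time_bound_def value_bound_def by (auto intro!: poly_fun_intros)
  then show ?case by blast
next
  case (Add a b)
  then obtain p q p' q' where "time_bound a p" "time_bound b q" "value_bound a p'" "value_bound b q'"
    using ex_value_bound by metis
  then show ?case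
  proof (rule time_bound_binop[where f = Plus])
    show "acost (Plus (Var t) (Var (Suc t))) s \<le> 2 * (bits (regs s t) + bits (regs s (Suc t)))" for t s
      using bits_add[of "regs s t" "regs s (Suc t)"] by simp
  qed auto
next
  case (Sub a b)
  then obtain p q p' q' where "time_bound a p" "time_bound b q" "value_bound a p'" "value_bound b q'"
    using ex_value_bound by metis
  then show ?case
  proof (rule time_bound_binop[where f = Minus])
    show "acost (Minus (Var t) (Var (Suc t))) s \<le> 2 * (bits (regs s t) + bits (regs s (Suc t)))" for t s
      using bits_diff[of "regs s t" "regs s (Suc t)"] by simp
  qed auto
next
  case (Mul a b)
  then obtain p q p' q' where "time_bound a p" "time_bound b q" "value_bound a p'" "value_bound b q'"
    using ex_value_bound by metis
  then show ?case
  proof (rule time_bound_binop[where f = Times])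
    show "acost (Times (Var t) (Var (Suc t))) s \<le> 2 * (bits (regs s t) + bits (regs s (Suc t)))" for t s
      using bits_mult[of "regs s t" "regs s (Suc t)"] by simp
  qed auto
next
  case (Quo a b)
  then obtain p q p' q' where "time_bound a p" "time_bound b q" "value_bound a p'" "value_bound b q'"
    using ex_value_bound by metis
  then show ?case
  proof (rule time_bound_binop[where f = Div])
    show "acost (Div (Var t) (Var (Suc t))) s \<le> 2 * (bits (regs s t) + bits (regs s (Suc t)))" for t s
      using bits_div[of "regs s t" "regs s (Suc t)"] by simp
  qed auto
next
  case (Ite c a b)
  then obtain pc p q where pc: "time_bound c pc" and p: "time_bound a p" and q: "time_bound b q" by blast
  obtain v where v: "value_bound c v" using ex_value_bound by blast
  let ?p = "\<lambda>M. pc M + (1 + v M + (p M + q M))"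
  have "\<exists>\<tau> s'. exec (compile (Ite c a b) E t) s \<tau> s' \<and> \<tau> \<le> ?p M \<and>
      regs s' t = ev xs Z (Ite c a b) \<rho> \<and> same t s s'"
    if bd: "bounded M xs Z \<rho>" and r: "ready xs Z E t \<rho> s" for xs Z \<rho> M E t s
  proof -
    obtain \<tau>1 s1 where 1: "exec (compile c E t) s \<tau>1 s1" "\<tau>1 \<le> pc M" "regs s1 t = ev xs Z c \<rho>" "same t s s1"
      by (rule time_boundD[OF pc bd r])
    have r1: "ready xs Z E t \<rho> s1" using ready_same[OF r 1(4)] by simp
    have vb: "bits (regs s1 t) \<le> v M" using value_boundD[OF v bd] 1(3) by simp
    show ?thesis
    proof (cases "ev xs Z c \<rho> > 0")
      case True
      obtain \<tau>2 s2 where 2: "exec (compile a E t) s1 \<tau>2 s2" "\<tau>2 \<le> p M" "regs s2 t = ev xs Z a \<rho>" "same t s1 s2"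
        by (rule time_boundD[OF p bd r1])
      have "exec (If (Var t) (compile a E t) (compile b E t)) s1 (1 + bits (regs s1 t) + \<tau>2) s2"
        using exec.IfTrue[of "Var t" s1, OF _ 2(1)] True 1(3) by simp
      from exec.Seq[OF 1(1) this] show ?thesis using True 1 2 vb same_trans[OF 1(4) 2(4)]
        unfolding compile.simps by (intro exI conjI) (assumption, auto)
    next
      case False
      obtain \<tau>2 s2 where 2: "exec (compile b E t) s1 \<tau>2 s2" "\<tau>2 \<le> q M" "regs s2 t = ev xs Z b \<rho>" "same t s1 s2"
        by (rule time_boundD[OF q bd r1])
      have "exec (If (Var t) (compile a E t) (compile b E t)) s1 (1 + bits (regs s1 t) + \<tau>2) s2"
        using exec.IfFalse[of "Var t" s1, OF _ 2(1)] False 1(3) by simp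
      from exec.Seq[OF 1(1) this] show ?thesis using False 1 2 vb same_trans[OF 1(4) 2(4)]
        unfolding compile.simps by (intro exI conjI) (assumption, auto)
    qed
  qed
  moreover have "poly_fun ?p" using pc p q v unfolding time_bound_def value_bound_def
    by (intro poly_fun_intros) auto
  ultimately have "time_bound (Ite c a b) ?p" unfolding time_bound_def by blast
  then show ?case by blast
next
  case (Bind x a b)
  then obtain p q where p: "time_bound a p" and q: "time_bound b q" by blast
  obtain v where v: "value_bound a v" using ex_value_bound by blast
  obtain w where w: "value_bound b w" using ex_value_bound by blast
  let ?p = "\<lambda>M. p M + (q (M + v M) + (1 + w (M + v M)))"
  have "\<exists>\<tau> s'. exec (compile (Bind x a b) E t) s \<tau> s' \<and> \<tau> \<le> ?p M \<and>
      regs s' t = ev xs Z (Bind x a b) \<rho> \<and> same t s s'"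
    if bd: "bounded M xs Z \<rho>" and r: "ready xs Z E t \<rho> s" for xs Z \<rho> M E t s
  proof -
    obtain \<tau>1 s1 where 1: "exec (compile a E t) s \<tau>1 s1" "\<tau>1 \<le> p M" "regs s1 t = ev xs Z a \<rho>" "same t s s1"
      by (rule time_boundD[OF p bd r])
    have bd': "bounded (M + v M) xs Z (\<rho>(x := ev xs Z a \<rho>))"
      using bounded_mono[OF bd] value_boundD[OF v bd] by (intro bounded_upd) auto
    have "ready xs Z (E(x := t)) (Suc t) (\<rho>(x := ev xs Z a \<rho>)) s1"
      using 1 by (intro ready_upd ready_same[OF r]) auto
    then obtain \<tau>2 s2 where 2: "exec (compile b (E(x := t)) (Suc t)) s1 \<tau>2 s2" "\<tau>2 \<le> q (M + v M)"
      "regs s2 (Suc t) = ev xs Z b (\<rho>(x := ev xs Z a \<rho>))" "same (Suc t) s1 s2"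
      by (rule time_boundD[OF q bd'])
    have vb: "bits (regs s2 (Suc t)) \<le> w (M + v M)" using value_boundD[OF w bd'] 2(3) by simp
    note 3 = exec.Assign[of t "Var (Suc t)" s2]
    from exec.Seq[OF 1(1) exec.Seq[OF 2(1) 3]] show ?thesis
      using 1 2 vb same_trans[OF 1(4) 2(4)] unfolding compile.simps by (intro exI conjI) (assumption, auto simp: same_upd)
  qed
  moreover have "poly_fun ?p" using p q v w unfolding time_bound_def value_bound_def
    by (intro poly_fun_intros poly_fun_compose[where g = "\<lambda>M. M + v M"]) auto
  ultimately have "time_bound (Bind x a b) ?p" unfolding time_bound_def by blast
  then show ?case by blast
next
  case (Summ x a)
  then obtain p p' where "time_bound a p" "value_bound a p'"
    using ex_value_bound by metis
  then show ?case
  proof (rule time_bound_loop[where f = Plus and F = "\<lambda>g j. sum g {..<j}"])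
    show "acost (Plus (Var t) (Var (t + 2))) s \<le> 2 * (bits (regs s t) + bits (regs s (t + 2)))" for t s
      using bits_add[of "regs s t" "regs s (t + 2)"] by simp
    show "bits (sum g {..<j}) \<le> 2 + j * b" if "\<And>l. l < j \<Longrightarrow> bits (g l) \<le> b" for g j b
      using bits_sum[of j g b] that by simp
  qed auto
next
  case (Prd x a)
  then obtain p p' where "time_bound a p" "value_bound a p'"
    using ex_value_bound by metis
  then show ?case
  proof (rule time_bound_loop[where f = Times and F = "\<lambda>g j. prod g {..<j}"])
    show "acost (Times (Var t) (Var (t + 2))) s \<le> 2 * (bits (regs s t) + bits (regs s (t + 2)))" for t s
      using bits_mult[of "regs s t" "regs s (t + 2)"] by simp
    show "bits (prod g {..<j}) \<le> 2 + j * b" if "\<And>l. l < j \<Longrightarrow> bits (g l) \<le> b" for g j b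
      using bits_prod[of j g b] that by simp
  qed auto
next
  case (Itr y x a)
  then obtain p where a: "time_bound a p" by blast
  obtain p' where va: "value_bound a p'" using ex_value_bound by blast
  let ?T = "\<lambda>n. p (n + 1) + (10 + 6 * p' (n + 1) + 6 * n)"
  let ?p = "\<lambda>n. (n + 1) * (?T n + 5 * n + 20) + 1"
  have "poly_fun ?p" using a va unfolding time_bound_def value_bound_def
    by (intro poly_fun_intros poly_fun_compose[where g = "\<lambda>M. M + 1"]) auto
  moreover have "\<exists>\<tau> s'. exec (compile (Itr y x a) E t) s \<tau> s' \<and> \<tau> \<le> ?p M \<and>
      regs s' t = ev xs Z (Itr y x a) \<rho> \<and> same t s s'"
    if bd: "bounded M xs Z \<rho>" and r: "ready xs Z E t \<rho> s" for xs Z \<rho> M E t s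
  proof -
    let ?f = "\<lambda>j v. ev xs Z a (\<rho>(y := int j, x := v))"
    let ?F = "iter Z ?f"
    have ZM: "Z \<le> M" using bd by (simp add: bounded_def)
    let ?c = "If (Minus (Const 0) (Var (t + 2))) (Assign t (Const 0))
      (If (Minus (Var (t + 2)) (Var 2)) (Assign t (Const 0)) (Assign t (Var (t + 2))))"
    have "\<exists>\<tau> s'. exec (accum t 0 (Seq (compile a (E(y := Suc t, x := t)) (t + 2)) ?c)) s \<tau> s' \<and>
      \<tau> \<le> (Z + 1) * (?T M + 5 * Z + 20) + bits 0 \<and> regs s' t = ?F Z \<and> same t s s'"
    proof (rule exec_accum[where F = ?F])
      fix j s' assume j: "j < Z" and s': "same t s s'" "regs s' t = ?F j" "regs s' (Suc t) = int j"
      \<comment> \<open>The state of the iteration is at most \<open>Z\<close> and so may take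
        \<open>M + 1\<close> bits; this is why the body is measured at \<open>M + 1\<close>.\<close>
      have bd': "bounded (M + 1) xs Z (\<rho>(y := int j, x := ?F j))"
        using order_trans[OF bits_iter] ZM
        by (intro bounded_upd[of _ _ _ "\<rho>(y := int j)"] bounded_loop[OF bounded_mono[OF bd]] j) auto
      have "ready xs Z (E(y := Suc t, x := t)) (t + 2) (\<rho>(y := int j, x := ?F j)) s'"
        using s' by (intro ready_upd ready_same[OF r]) auto
      then obtain \<tau>1 s1 where 1: "exec (compile a (E(y := Suc t, x := t)) (t + 2)) s' \<tau>1 s1" "\<tau>1 \<le> p (M + 1)"
        "regs s1 (t + 2) = ?f j (?F j)" "same (t + 2) s' s1"
        by (rule time_boundD[OF a bd'])
      let ?v = "?f j (?F j)"
      have v: "regs s1 (Suc t) = int j" "regs s1 2 = int Z"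
        using 1 s' r by (auto simp: same_def ready_def)
      have vb: "bits ?v \<le> p' (M + 1)" by (rule value_boundD[OF va bd'])
      have bZ: "bits (int Z) \<le> M + 1" using bits_of_nat[of Z] ZM by linarith
      have c1: "acost (Minus (Const 0) (Var (t + 2))) s1 \<le> 1 + 2 * p' (M + 1)" using vb 1(3) by simp
      have c2: "acost (Minus (Var (t + 2)) (Var 2)) s1 \<le> 2 * p' (M + 1) + 2 * (M + 1)"
        using vb bZ 1(3) v bits_diff[of ?v "int Z"] by simp
      let ?s2 = "s1\<lparr>regs := (regs s1)(t := clamp Z ?v)\<rparr>"
      have "\<exists>\<tau>. exec ?c s1 \<tau> ?s2 \<and> \<tau> \<le> 10 + 6 * p' (M + 1) + 6 * M"
      proof -
        have A0: "exec (Assign t (Const 0)) s1 2 (s1\<lparr>regs := (regs s1)(t := 0)\<rparr>)"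
          using exec.Assign[of t "Const 0" s1] by (simp add: numeral_2_eq_2)
        note e1 = \<open>regs s1 (t + 2) = ?v\<close>
        have arith: "x \<le> 1 + 2 * p \<Longrightarrow> y \<le> 2 * p + 2 * (m + 1) \<Longrightarrow> 1 + x + (1 + y + 2) \<le> 10 + 6 * p + 6 * m"
          "x \<le> 1 + 2 * p \<Longrightarrow> y \<le> 2 * p + 2 * (m + 1) \<Longrightarrow> z \<le> p \<Longrightarrow> 1 + x + (1 + y + (1 + z)) \<le> 10 + 6 * p + 6 * m"
          for x y z p m :: nat by simp_all
        \<comment> \<open>The two nested tests realise \<open>clamp\<close>: a value below 0, above
          \<open>Z\<close>, or in range.\<close>
        consider "?v < 0" | "?v \<ge> 0" "?v > int Z" | "?v \<ge> 0" "?v \<le> int Z" by linarith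
        then show ?thesis
        proof cases
          case 1
          then have "exec ?c s1 (1 + acost (Minus (Const 0) (Var (t + 2))) s1 + 2) ?s2"
            using A0 e1 by (intro exec.IfTrue) (auto simp: clamp_def)
          then show ?thesis using c1 by (intro exI conjI) (assumption, linarith)
        next
          case 2
          then have "exec ?c s1 (1 + acost (Minus (Const 0) (Var (t + 2))) s1 +
              (1 + acost (Minus (Var (t + 2)) (Var 2)) s1 + 2)) ?s2"
            using A0 e1 v by (intro exec.IfFalse exec.IfTrue) (auto simp: clamp_def)
          moreover have "1 + acost (Minus (Const 0) (Var (t + 2))) s1 +
              (1 + acost (Minus (Var (t + 2)) (Var 2)) s1 + 2) \<le> 10 + 6 * p' (M + 1) + 6 * M"
            by (rule arith(1)[OF c1 c2])
          ultimately show ?thesis by blast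
        next
          case 3
          have "exec (Assign t (Var (t + 2))) s1 (1 + bits ?v) ?s2"
            using exec.Assign[of t "Var (t + 2)" s1] e1 3 by (simp add: clamp_def)
          then have "exec ?c s1 (1 + acost (Minus (Const 0) (Var (t + 2))) s1 +
              (1 + acost (Minus (Var (t + 2)) (Var 2)) s1 + (1 + bits ?v))) ?s2"
            using e1 v 3 by (intro exec.IfFalse) auto
          moreover have "1 + acost (Minus (Const 0) (Var (t + 2))) s1 +
              (1 + acost (Minus (Var (t + 2)) (Var 2)) s1 + (1 + bits ?v)) \<le> 10 + 6 * p' (M + 1) + 6 * M"
            by (rule arith(2)[OF c1 c2 vb])
          ultimately show ?thesis by blast
        qed
      qed
      then obtain \<tau>2 where 2: "exec ?c s1 \<tau>2 ?s2" "\<tau>2 \<le> 10 + 6 * p' (M + 1) + 6 * M" by blast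
      have "same t s s1" using same_trans[OF s'(1) 1(4)] by simp
      then have "same t s ?s2" "regs ?s2 t = ?F (Suc j)" "regs ?s2 (Suc t) = int j"
        using v by (auto simp: same_upd)
      moreover have "\<tau>1 + \<tau>2 \<le> ?T M" using 1(2) 2(2) by simp
      ultimately show "\<exists>\<tau> s''. exec (Seq (compile a (E(y := Suc t, x := t)) (t + 2)) ?c) s' \<tau> s'' \<and>
        \<tau> \<le> ?T M \<and> same t s s'' \<and> regs s'' t = ?F (Suc j) \<and> regs s'' (Suc t) = int j"
        using exec.Seq[OF 1(1) 2(1)] by blast
    qed (use r in \<open>auto simp: ready_def\<close>)
    moreover have "(Z + 1) * (?T M + 5 * Z + 20) + bits 0 \<le> ?p M"
      unfolding bits_0 using ZM by (intro add_right_mono mult_le_mono) auto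
    ultimately show ?thesis unfolding compile.simps ev.simps by (meson order_trans)
  qed
  ultimately have "time_bound (Itr y x a) ?p" unfolding time_bound_def by blast
  then show ?case by blast
qed

subsection \<open>Output lists\<close>

datatype 'v out =
    Emit "'v exp"
  | Guard "'v exp" "'v out"
  | For 'v "'v out"
  | Both "'v out" "'v out"

primrec outs :: "int list \<Rightarrow> nat \<Rightarrow> 'v out \<Rightarrow> ('v \<Rightarrow> int) \<Rightarrow> int list" where
  "outs xs Z (Emit e) \<rho> = [ev xs Z e \<rho>]"
| "outs xs Z (Guard e w) \<rho> = (if ev xs Z e \<rho> > 0 then outs xs Z w \<rho> else [])"
| "outs xs Z (For x w) \<rho> = concat (map (\<lambda>i. outs xs Z w (\<rho>(x := int i))) [0..<Z])"
| "outs xs Z (Both v w) \<rho> = outs xs Z v \<rho> @ outs xs Z w \<rho>"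

primrec compile_out :: "'v out \<Rightarrow> ('v \<Rightarrow> nat) \<Rightarrow> nat \<Rightarrow> com" where
  "compile_out (Emit e) E t = Seq (compile e E t)
    (Seq (Store 1 (Var 3) (Var t)) (Assign 3 (Plus (Var 3) (Const 1))))"
| "compile_out (Guard e w) E t = Seq (compile e E t) (If (Var t) (compile_out w E t) Skip)"
| "compile_out (For x w) E t = Seq (Assign t (Const 0)) (While (Minus (Var 2) (Var t))
    (Seq (compile_out w (E(x := t)) (Suc t)) (Assign t (Plus (Var t) (Const 1)))))"
| "compile_out (Both v w) E t = Seq (compile_out v E t) (compile_out w E t)"

definition out_bound :: "'v out \<Rightarrow> (nat \<Rightarrow> nat) \<Rightarrow> bool" where
  "out_bound w p \<longleftrightarrow> poly_fun p \<and> (\<forall>xs Z \<rho> M. bounded M xs Z \<rho> \<longrightarrow>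
    length (outs xs Z w \<rho>) \<le> p M \<and> (\<forall>y\<in>set (outs xs Z w \<rho>). bits y \<le> p M))"

lemma ex_out_bound: "\<exists>p. out_bound w p"
proof (induction w)
  case (Emit e)
  obtain p where "value_bound e p" using ex_value_bound by blast
  then have "out_bound (Emit e) (\<lambda>n. 1 + p n)"
    unfolding out_bound_def value_bound_def by (auto intro!: poly_fun_intros intro: le_SucI)
  then show ?case by blast
next
  case (Guard e w)
  then obtain p where "out_bound w p" by blast
  then have "out_bound (Guard e w) p" unfolding out_bound_def by auto
  then show ?case by blast
next
  case (For x w)
  then obtain p where p: "out_bound w p" by blast
  have "length (outs xs Z (For x w) \<rho>) \<le> p M + M * p M \<and> (\<forall>y\<in>set (outs xs Z (For x w) \<rho>). bits y \<le> p M + M * p M)"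
    if b: "bounded M xs Z \<rho>" for xs Z \<rho> M
  proof -
    have *: "length (outs xs Z w (\<rho>(x := int i))) \<le> p M" "\<And>y. y \<in> set (outs xs Z w (\<rho>(x := int i))) \<Longrightarrow> bits y \<le> p M"
      if "i < Z" for i using p bounded_loop[OF b that] unfolding out_bound_def by blast+
    have "length (outs xs Z (For x w) \<rho>) = (\<Sum>i<Z. length (outs xs Z w (\<rho>(x := int i))))"
      by (simp add: length_concat comp_def interv_sum_list_conv_sum_set_nat atLeast0LessThan)
    also have "\<dots> \<le> (\<Sum>i<Z. p M)" by (intro sum_mono *) auto
    also have "\<dots> \<le> M * p M" using b by (simp add: bounded_def)
    finally show ?thesis using * by (auto simp: trans_le_add1)
  qed
  then have "out_bound (For x w) (\<lambda>M. p M + M * p M)" using p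
    unfolding out_bound_def by (auto intro!: poly_fun_intros)
  then show ?case by blast
next
  case (Both v w)
  then obtain p q where "out_bound v p" "out_bound w q" by blast
  then have "out_bound (Both v w) (\<lambda>n. p n + q n)"
    unfolding out_bound_def by (auto intro!: poly_fun_intros add_mono intro: trans_le_add1 trans_le_add2)
  then show ?case by blast
qed

text \<open>Output is collected in array 1, with its length in register 3, since array 0 has to stay
  readable until the last number has been computed.\<close>

definition written :: "int list \<Rightarrow> state \<Rightarrow> bool" where
  "written ys s \<longleftrightarrow> regs s 3 = int (length ys) \<and> (\<forall>j<length ys. arrs s 1 (int j) = ys ! j)"

definition same' :: "nat \<Rightarrow> state \<Rightarrow> state \<Rightarrow> bool" where
  "same' t s s' \<longleftrightarrow> (\<forall>r<t. r \<noteq> 3 \<longrightarrow> regs s' r = regs s r) \<and> (\<forall>a. a \<noteq> 1 \<longrightarrow> arrs s' a = arrs s a)"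

definition ready' :: "int list \<Rightarrow> nat \<Rightarrow> ('v \<Rightarrow> nat) \<Rightarrow> nat \<Rightarrow> ('v \<Rightarrow> int) \<Rightarrow> state \<Rightarrow> bool" where
  "ready' xs Z E t \<rho> s \<longleftrightarrow> ready xs Z E t \<rho> s \<and> 3 < t \<and> (\<forall>x. E x \<noteq> 3)"

lemma same'_refl [simp]: "same' t s s" by (simp add: same'_def)

lemma same'_trans: "same' t s s' \<Longrightarrow> same' t' s' s'' \<Longrightarrow> t \<le> t' \<Longrightarrow> same' t s s''"
  by (auto simp: same'_def)

lemma same_same': "same t s s' \<Longrightarrow> same' t s s'" by (auto simp: same'_def same_def)

lemma same'_upd: "t \<le> r \<or> r = 3 \<Longrightarrow> same' t s (s'\<lparr>regs := (regs s')(r := v)\<rparr>) \<longleftrightarrow> same' t s s'"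
  by (auto simp: same'_def)

lemma ready'_same': "ready' xs Z E t \<rho> s \<Longrightarrow> same' t s s' \<Longrightarrow> t \<le> t' \<Longrightarrow> ready' xs Z E t' \<rho> s'"
  unfolding ready'_def ready_def same'_def
  by (metis order.strict_trans2 numeral_eq_iff semiring_norm(88) zero_neq_one)

lemma ready'_upd: "ready' xs Z E t \<rho> s \<Longrightarrow> r < t \<Longrightarrow> r \<noteq> 3 \<Longrightarrow> regs s r = v \<Longrightarrow>
    ready' xs Z (E(x := r)) t (\<rho>(x := v)) s"
  unfolding ready'_def by (auto intro: ready_upd)

lemma written_same: "written ys s \<Longrightarrow> same t s s' \<Longrightarrow> 3 < t \<Longrightarrow> written ys s'"
  unfolding written_def same_def by auto

lemma written_upd: "r \<noteq> 3 \<Longrightarrow> written ys (s\<lparr>regs := (regs s)(r := v)\<rparr>) \<longleftrightarrow> written ys s"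
  by (auto simp: written_def)

text \<open>\<open>N\<close> bounds the length of the output including what was written before; the
  cost of counting in register 3 depends on it.\<close>

definition out_time :: "'v out \<Rightarrow> (nat \<Rightarrow> nat) \<Rightarrow> bool" where
  "out_time w p \<longleftrightarrow> poly_fun p \<and> (\<forall>xs Z \<rho> M E t s ys N. bounded M xs Z \<rho> \<longrightarrow> ready' xs Z E t \<rho> s \<longrightarrow>
    written ys s \<longrightarrow> length ys + length (outs xs Z w \<rho>) \<le> N \<longrightarrow>
    (\<exists>\<tau> s'. exec (compile_out w E t) s \<tau> s' \<and> \<tau> \<le> p (M + N) \<and> written (ys @ outs xs Z w \<rho>) s' \<and> same' t s s'))"

lemma out_timeD:
  assumes "out_time w p" "bounded M xs Z \<rho>" "ready' xs Z E t \<rho> s" "written ys s"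
    "length ys + length (outs xs Z w \<rho>) \<le> N"
  obtains \<tau> s' where "exec (compile_out w E t) s \<tau> s'" "\<tau> \<le> p (M + N)"
    "written (ys @ outs xs Z w \<rho>) s'" "same' t s s'"
  using assms unfolding out_time_def by blast

lemma ex_out_time: "\<exists>p. out_time w p"
proof (induction w)
  case (Emit e)
  obtain p where p: "time_bound e p" using ex_time_bound by blast
  obtain v where v: "value_bound e v" using ex_value_bound by blast
  let ?p = "\<lambda>n. p n + (10 + 3 * n + v n)"
  have "poly_fun ?p" using p v unfolding time_bound_def value_bound_def by (intro poly_fun_intros) auto
  moreover have "\<exists>\<tau> s'. exec (compile_out (Emit e) E t) s \<tau> s' \<and> \<tau> \<le> ?p (M + N) \<and>
      written (ys @ outs xs Z (Emit e) \<rho>) s' \<and> same' t s s'"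
    if b: "bounded M xs Z \<rho>" and r: "ready' xs Z E t \<rho> s" and w: "written ys s"
      and N: "length ys + length (outs xs Z (Emit e) \<rho>) \<le> N" for xs Z \<rho> M E t s ys N
  proof -
    let ?y = "ev xs Z e \<rho>"
    have b': "bounded (M + N) xs Z \<rho>" using bounded_mono[OF b] by simp
    from r have r': "ready xs Z E t \<rho> s" and t: "3 < t" by (auto simp: ready'_def)
    obtain \<tau>1 s1 where 1: "exec (compile e E t) s \<tau>1 s1" "\<tau>1 \<le> p (M + N)" "regs s1 t = ?y" "same t s s1"
      by (rule time_boundD[OF p b' r'])
    have w1: "written ys s1" by (rule written_same[OF w 1(4) t])
    let ?s2 = "s1\<lparr>arrs := (arrs s1)(1 := (arrs s1 1)(int (length ys) := ?y))\<rparr>"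
    let ?s3 = "?s2\<lparr>regs := (regs s1)(3 := int (Suc (length ys)))\<rparr>"
    have 2: "exec (Store 1 (Var 3) (Var t)) s1 (1 + bits (int (length ys)) + bits ?y) ?s2"
      using exec.Store[of 1 "Var 3" "Var t" s1] 1 w1 by (simp add: written_def)
    have 3: "exec (Assign 3 (Plus (Var 3) (Const 1))) ?s2 (1 + (bits (int (length ys)) + 2 + bits (int (Suc (length ys))))) ?s3"
      using exec.Assign[of 3 "Plus (Var 3) (Const 1)" ?s2] w1 by (simp add: written_def add.commute)
    have "written (ys @ [?y]) ?s3" using w1 by (auto simp: written_def nth_append)
    moreover have "same' t s ?s3" using 1(4) by (auto simp: same_def same'_def)
    moreover have "\<tau>1 + (1 + bits (int (length ys)) + bits ?y + (1 + (bits (int (length ys)) + 2 + bits (int (Suc (length ys)))))) \<le> ?p (M + N)"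
      using 1(2) bits_of_nat[of "length ys"] bits_of_nat[of "Suc (length ys)"] value_boundD[OF v b'] N by simp
    ultimately show ?thesis using exec.Seq[OF 1(1) exec.Seq[OF 2 3]] unfolding compile_out.simps outs.simps by blast
  qed
  ultimately have "out_time (Emit e) ?p" unfolding out_time_def by blast
  then show ?case by blast
next
  case (Guard e w)
  then obtain q where q: "out_time w q" by blast
  obtain p where p: "time_bound e p" using ex_time_bound by blast
  obtain v where v: "value_bound e v" using ex_value_bound by blast
  let ?p = "\<lambda>n. p n + (2 + v n + q n)"
  have "poly_fun ?p" using p q v unfolding time_bound_def value_bound_def out_time_def by (intro poly_fun_intros) auto
  moreover have "\<exists>\<tau> s'. exec (compile_out (Guard e w) E t) s \<tau> s' \<and> \<tau> \<le> ?p (M + N) \<and>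
      written (ys @ outs xs Z (Guard e w) \<rho>) s' \<and> same' t s s'"
    if b: "bounded M xs Z \<rho>" and r: "ready' xs Z E t \<rho> s" and w: "written ys s"
      and N: "length ys + length (outs xs Z (Guard e w) \<rho>) \<le> N" for xs Z \<rho> M E t s ys N
  proof -
    let ?y = "ev xs Z e \<rho>"
    have b': "bounded (M + N) xs Z \<rho>" using bounded_mono[OF b] by simp
    from r have r': "ready xs Z E t \<rho> s" and t: "3 < t" by (auto simp: ready'_def)
    obtain \<tau>1 s1 where 1: "exec (compile e E t) s \<tau>1 s1" "\<tau>1 \<le> p (M + N)" "regs s1 t = ?y" "same t s s1"
      by (rule time_boundD[OF p b' r'])
    have w1: "written ys s1" by (rule written_same[OF w 1(4) t])
    have vb: "bits (regs s1 t) \<le> v (M + N)" using value_boundD[OF v b'] 1(3) by simp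
    show ?thesis
    proof (cases "?y > 0")
      case True
      have "ready' xs Z E t \<rho> s1" using ready'_same'[OF r same_same'[OF 1(4)]] by simp
      moreover have "length ys + length (outs xs Z w \<rho>) \<le> N" using N True by simp
      ultimately obtain \<tau>2 s2 where 2: "exec (compile_out w E t) s1 \<tau>2 s2" "\<tau>2 \<le> q (M + N)"
        "written (ys @ outs xs Z w \<rho>) s2" "same' t s1 s2"
        by (rule out_timeD[OF q b _ w1])
      have 3: "exec (If (Var t) (compile_out w E t) Skip) s1 (1 + bits (regs s1 t) + \<tau>2) s2"
        using exec.IfTrue[of "Var t" s1, OF _ 2(1)] True 1(3) by simp
      have "same' t s s2" using same'_trans[OF same_same'[OF 1(4)] 2(4)] by simp
      moreover have "\<tau>1 + (1 + bits (regs s1 t) + \<tau>2) \<le> ?p (M + N)" using 1(2) 2(2) vb by linarith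
      ultimately show ?thesis using exec.Seq[OF 1(1) 3] 2(3) True unfolding compile_out.simps by auto
    next
      case False
      have 3: "exec (If (Var t) (compile_out w E t) Skip) s1 (1 + bits (regs s1 t) + 1) s1"
        using exec.IfFalse[of "Var t" s1, OF _ exec.Skip] False 1(3) by simp
      have "\<tau>1 + (1 + bits (regs s1 t) + 1) \<le> ?p (M + N)" using 1(2) vb by linarith
      then show ?thesis using exec.Seq[OF 1(1) 3] w1 False same_same'[OF 1(4)]
        unfolding compile_out.simps by auto
    qed
  qed
  ultimately have "out_time (Guard e w) ?p" unfolding out_time_def by blast
  then show ?case by blast
next
  case (For x w)
  then obtain p where p: "out_time w p" by blast
  let ?p = "\<lambda>n. 2 + (n + 1) * (3 * (n + 1) + (p n + (2 * n + 5)) + 1)"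
  have "poly_fun ?p" using p unfolding out_time_def by (intro poly_fun_intros) auto
  moreover have "\<exists>\<tau> s'. exec (compile_out (For x w) E t) s \<tau> s' \<and> \<tau> \<le> ?p (M + N) \<and>
      written (ys @ outs xs Z (For x w) \<rho>) s' \<and> same' t s s'"
    if bd: "bounded M xs Z \<rho>" and r: "ready' xs Z E t \<rho> s" and w: "written ys s"
      and N: "length ys + length (outs xs Z (For x w) \<rho>) \<le> N" for xs Z \<rho> M E t s ys N
  proof -
    have b: "bits (int j) \<le> Suc Z" if "j \<le> Z" for j using bits_of_nat[of j] that by linarith
    from r have t: "3 < t" and Z: "regs s 2 = int Z" by (auto simp: ready'_def ready_def)
    have ZM: "Z \<le> M" using bd by (simp add: bounded_def)
    define F where "F j = concat (map (\<lambda>i. outs xs Z w (\<rho>(x := int i))) [0..<j])" for j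
    have F_Suc: "F (Suc j) = F j @ outs xs Z w (\<rho>(x := int j))" for j by (simp add: F_def)
    have F_mono: "length (F j) \<le> length (F (j + d))" for j d by (induction d) (auto simp: F_Suc)
    let ?s0 = "s\<lparr>regs := (regs s)(t := 0)\<rparr>"
    let ?T = "p (M + N) + (2 * Z + 5)"
    have "\<exists>\<tau> s'. exec (While (Minus (Var 2) (Var t))
        (Seq (compile_out w (E(x := t)) (Suc t)) (Assign t (Plus (Var t) (Const 1))))) ?s0 \<tau> s' \<and>
      \<tau> \<le> (Z + 1) * (3 * (Z + 1) + ?T + 1) \<and> (same' t s s' \<and> written (ys @ F Z) s' \<and> regs s' t = int Z)"
    proof (rule exec_while_count)
      fix j s' assume P: "same' t s s' \<and> written (ys @ F j) s' \<and> regs s' t = int j" and j: "j \<le> Z"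
      have "regs s' 2 = int Z" using P t Z by (auto simp: same'_def)
      then show "aval (Minus (Var 2) (Var t)) s' = int Z - int j \<and> acost (Minus (Var 2) (Var t)) s' \<le> 3 * (Z + 1)"
        using P b[of Z] b[of j] b[of "Z - j"] j by (simp add: of_nat_diff)
    next
      fix j s' assume P: "same' t s s' \<and> written (ys @ F j) s' \<and> regs s' t = int j" and j: "j < Z"
      have r': "ready' xs Z (E(x := t)) (Suc t) (\<rho>(x := int j)) s'"
        using P t by (intro ready'_upd ready'_same'[OF r]) auto
      have "length (F (Suc j)) \<le> length (F Z)" using F_mono[of "Suc j" "Z - Suc j"] j by simp
      then have "length (ys @ F j) + length (outs xs Z w (\<rho>(x := int j))) \<le> N"
        using N by (simp add: F_Suc F_def)
      then obtain \<tau> s1 where 1: "exec (compile_out w (E(x := t)) (Suc t)) s' \<tau> s1" "\<tau> \<le> p (M + N)"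
        "written ((ys @ F j) @ outs xs Z w (\<rho>(x := int j))) s1" "same' (Suc t) s' s1"
        using out_timeD[OF p bounded_loop[OF bd j] r'] P by blast
      have v: "regs s1 t = int j" using P 1(4) t by (simp add: same'_def)
      let ?s2 = "s1\<lparr>regs := (regs s1)(t := int (Suc j))\<rparr>"
      have 2: "exec (Assign t (Plus (Var t) (Const 1))) s1 (1 + (bits (int j) + 2 + bits (int (Suc j)))) ?s2"
        using exec.Assign[of t "Plus (Var t) (Const 1)" s1] v by (simp add: add.commute)
      have "\<tau> + (1 + (bits (int j) + 2 + bits (int (Suc j)))) \<le> ?T"
        using 1 b[of j] b[of "Suc j"] j by simp
      moreover have "same' t s s1" using same'_trans[OF conjunct1[OF P] 1(4)] by simp
      then have "same' t s ?s2 \<and> written (ys @ F (Suc j)) ?s2 \<and> regs ?s2 t = int (Suc j)"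
        using 1(3) t by (simp add: F_Suc same'_upd written_upd)
      ultimately show "\<exists>\<tau> s''. exec (Seq (compile_out w (E(x := t)) (Suc t)) (Assign t (Plus (Var t) (Const 1)))) s' \<tau> s'' \<and>
        \<tau> \<le> ?T \<and> (same' t s s'' \<and> written (ys @ F (Suc j)) s'' \<and> regs s'' t = int (Suc j))"
        using exec.Seq[OF 1(1) 2] by blast
    next
      show "same' t s ?s0 \<and> written (ys @ F 0) ?s0 \<and> regs ?s0 t = int 0"
        using w t by (simp add: F_def same'_upd written_upd)
    qed
    then obtain \<tau> s' where l: "exec (While (Minus (Var 2) (Var t))
        (Seq (compile_out w (E(x := t)) (Suc t)) (Assign t (Plus (Var t) (Const 1))))) ?s0 \<tau> s'"
      "\<tau> \<le> (Z + 1) * (3 * (Z + 1) + ?T + 1)" "same' t s s'" "written (ys @ F Z) s'" by blast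
    have 1: "exec (Assign t (Const 0)) s 2 ?s0"
      using exec.Assign[of t "Const 0" s] by (simp add: numeral_2_eq_2)
    have "(Z + 1) * (3 * (Z + 1) + ?T + 1) \<le> (M + N + 1) * (3 * (M + N + 1) + (p (M + N) + (2 * (M + N) + 5)) + 1)"
      using ZM by (intro mult_le_mono) auto
    then have "2 + \<tau> \<le> ?p (M + N)" using l(2) by linarith
    then show ?thesis using exec.Seq[OF 1 l(1)] l(3,4) unfolding compile_out.simps outs.simps F_def by blast
  qed
  ultimately have "out_time (For x w) ?p" unfolding out_time_def by blast
  then show ?case by blast
next
  case (Both u w)
  then obtain p q where p: "out_time u p" and q: "out_time w q" by blast
  have "\<exists>\<tau> s'. exec (compile_out (Both u w) E t) s \<tau> s' \<and> \<tau> \<le> p (M + N) + q (M + N) \<and>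
      written (ys @ outs xs Z (Both u w) \<rho>) s' \<and> same' t s s'"
    if b: "bounded M xs Z \<rho>" and r: "ready' xs Z E t \<rho> s" and w: "written ys s"
      and N: "length ys + length (outs xs Z (Both u w) \<rho>) \<le> N" for xs Z \<rho> M E t s ys N
  proof -
    have "length ys + length (outs xs Z u \<rho>) \<le> N" using N by simp
    then obtain \<tau>1 s1 where 1: "exec (compile_out u E t) s \<tau>1 s1" "\<tau>1 \<le> p (M + N)"
      "written (ys @ outs xs Z u \<rho>) s1" "same' t s s1"
      by (rule out_timeD[OF p b r w])
    have "ready' xs Z E t \<rho> s1" using ready'_same'[OF r 1(4)] by simp
    moreover have "length (ys @ outs xs Z u \<rho>) + length (outs xs Z w \<rho>) \<le> N" using N by simp
    ultimately obtain \<tau>2 s2 where 2: "exec (compile_out w E t) s1 \<tau>2 s2" "\<tau>2 \<le> q (M + N)"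
      "written ((ys @ outs xs Z u \<rho>) @ outs xs Z w \<rho>) s2" "same' t s1 s2"
      by (rule out_timeD[OF q b _ 1(3)])
    have "same' t s s2" using same'_trans[OF 1(4) 2(4)] by simp
    then show ?thesis using exec.Seq[OF 1(1) 2(1)] 1(2) 2(2,3) unfolding compile_out.simps outs.simps append_assoc
      using add_mono by blast
  qed
  then have "out_time (Both u w) (\<lambda>n. p n + q n)" using p q
    unfolding out_time_def by (auto intro!: poly_fun_intros)
  then show ?case by blast
qed

text \<open>With the bound \<open>n + k + 2\<close> the loops reach beyond every position of the
  input and beyond the parameter, and as a base it is at least 2.\<close>

definition start_env :: "'v \<Rightarrow> 'v \<Rightarrow> 'v \<Rightarrow> nat \<Rightarrow> nat \<Rightarrow> 'v \<Rightarrow> int" where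
  "start_env vn vk vz n k = (\<lambda>_. 0)(vn := int n, vk := int k, vz := int (n + k + 2))"

text \<open>All variables without a register of their own share register 4. It is never written and
  so holds the value 0 that \<open>start_env\<close> gives them; the compiled code works from
  register 5 on.\<close>

definition out_prog :: "'v \<Rightarrow> 'v \<Rightarrow> 'v \<Rightarrow> 'v out \<Rightarrow> 'v exp \<Rightarrow> com" where
  "out_prog vn vk vz w e = (let E = (\<lambda>_. 4)(vn := 0, vk := 1, vz := 2) in
    Seq (Assign 2 (Plus (Plus (Var 0) (Var 1)) (Const 2)))
    (Seq (compile_out w E 5) (Seq (compile e E 5) (Seq (copy_loop 6 3 1 0)
      (Seq (Assign 0 (Var 3)) (Assign 1 (Var 5)))))))"

lemma bits_2 [simp]: "bits 2 = 3"
  by (simp add: bits_def floorlog_def)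

theorem out_prog_computes:
  "\<exists>C q. \<forall>xs k. 0 \<le> ev xs (length xs + k + 2) e (start_env vn vk vz (length xs) k) \<longrightarrow>
    (\<exists>t. computes (out_prog vn vk vz w e) (xs, k) t
      (outs xs (length xs + k + 2) w (start_env vn vk vz (length xs) k),
       nat (ev xs (length xs + k + 2) e (start_env vn vk vz (length xs) k))) \<and>
     t \<le> C * (k + 1) ^ q * (input_size xs + 1) ^ q)"
proof -
  obtain p where p: "out_time w p" using ex_out_time by blast
  obtain pb where pb: "out_bound w pb" using ex_out_bound by blast
  obtain q where q: "time_bound e q" using ex_time_bound by blast
  obtain v where v: "value_bound e v" using ex_value_bound by blast
  let ?E = "(\<lambda>_. 4)(vn := 0, vk := 1, vz := 2) :: 'a \<Rightarrow> nat"
  let ?P = "\<lambda>M. (1 + (4 * M + 3)) + (p (M + pb M) + (q M + (((pb M + 1) * (7 * pb M + pb M + 20) + 2) +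
    ((1 + (pb M + 1)) + (1 + v M))))) + pb M * pb M"
  have "poly_fun ?P" using p pb q v
    unfolding out_time_def out_bound_def time_bound_def value_bound_def
    by (intro poly_fun_intros poly_fun_compose[where g = "\<lambda>M. M + pb M"]) auto
  then obtain C d where C: "\<And>M. ?P M \<le> C * (M + 1) ^ d" using poly_fun_bound by blast
  have "\<exists>t. computes (out_prog vn vk vz w e) (xs, k) t
      (outs xs (length xs + k + 2) w (start_env vn vk vz (length xs) k),
       nat (ev xs (length xs + k + 2) e (start_env vn vk vz (length xs) k))) \<and>
     t \<le> (C * 4 ^ d) * (k + 1) ^ d * (input_size xs + 1) ^ d"
    if pos: "0 \<le> ev xs (length xs + k + 2) e (start_env vn vk vz (length xs) k)" for xs k
  proof -
    define Z where "Z = length xs + k + 2"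
    define \<rho> where "\<rho> = start_env vn vk vz (length xs) k"
    define M where "M = input_size xs + k + 3"
    define ys where "ys = outs xs Z w \<rho>"
    define y where "y = ev xs Z e \<rho>"
    have ZM: "Suc Z \<le> M" using length_le_input_size[of xs] by (simp add: Z_def M_def)
    have bb: "bits (int j) \<le> M" if "j \<le> Z" for j using bits_of_nat[of j] that ZM by linarith
    have bd: "bounded M xs Z \<rho>"
      unfolding bounded_def
    proof (intro conjI allI ballI)
      fix x show "bits (\<rho> x) \<le> M" using bb[of 0] bb[of "length xs"] bb[of k] bb[of Z]
        by (auto simp: \<rho>_def start_env_def Z_def)
      show "bits x \<le> M" if "x \<in> set xs" for x using bits_le_input_size[OF that] by (simp add: M_def)
    qed (use ZM in auto)
    have pbM: "length ys \<le> pb M" "\<And>x. x \<in> set ys \<Longrightarrow> bits x \<le> pb M"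
      using pb bd unfolding out_bound_def ys_def by blast+
    let ?s0 = "init_state (xs, k)"
    let ?s1 = "?s0\<lparr>regs := (regs ?s0)(2 := int Z)\<rparr>"
    have 1: "exec (Assign 2 (Plus (Plus (Var 0) (Var 1)) (Const 2))) ?s0
      (1 + (bits (int (length xs)) + bits (int k) + bits (int (length xs) + int k) + 3 + bits (int Z))) ?s1"
      using exec.Assign[of 2 "Plus (Plus (Var 0) (Var 1)) (Const 2)" ?s0]
      by (simp add: init_state_def Z_def ac_simps)
    have r1: "ready' xs Z ?E 5 \<rho> ?s1"
      by (auto simp: ready'_def ready_def init_state_def \<rho>_def start_env_def Z_def lookup_def fun_eq_iff)
    have w1: "written [] ?s1" by (simp add: written_def init_state_def)
    have "length [] + length (outs xs Z w \<rho>) \<le> pb M" using pbM by (simp add: ys_def)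
    from out_timeD[OF p bd r1 w1 this] obtain \<tau>2 s2 where 2: "exec (compile_out w ?E 5) ?s1 \<tau>2 s2"
      "\<tau>2 \<le> p (M + pb M)" "written ([] @ outs xs Z w \<rho>) s2" "same' 5 ?s1 s2" by blast
    have r2: "ready xs Z ?E 5 \<rho> s2" using ready'_same'[OF r1 2(4)] by (simp add: ready'_def)
    obtain \<tau>3 s3 where 3: "exec (compile e ?E 5) s2 \<tau>3 s3" "\<tau>3 \<le> q M" "regs s3 5 = y" "same 5 s2 s3"
      unfolding y_def by (rule time_boundD[OF q bd r2])
    have w3: "written ys s3" using written_same[OF _ 3(4)] 2(3) by (simp add: ys_def)
    have "\<exists>t s'. exec (copy_loop 6 3 1 0) s3 t s' \<and> t \<le> (length ys + 1) * (7 * length ys + pb M + 20) + 2 \<and>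
      (\<forall>r. r \<noteq> 6 \<longrightarrow> regs s' r = regs s3 r) \<and> (\<forall>c. c \<noteq> 0 \<longrightarrow> arrs s' c = arrs s3 c) \<and>
      arrs s' 0 = (\<lambda>j. if 0 \<le> j \<and> j < int (length ys) then arrs s3 1 j else arrs s3 0 j)"
      using w3 pbM by (intro exec_copy_loop) (auto simp: written_def)
    then obtain \<tau>4 s4 where 4: "exec (copy_loop 6 3 1 0) s3 \<tau>4 s4"
      "\<tau>4 \<le> (length ys + 1) * (7 * length ys + pb M + 20) + 2"
      and r4: "\<And>r. r \<noteq> 6 \<Longrightarrow> regs s4 r = regs s3 r"
      and a4: "arrs s4 0 = (\<lambda>j. if 0 \<le> j \<and> j < int (length ys) then arrs s3 1 j else arrs s3 0 j)" by blast
    let ?s5 = "s4\<lparr>regs := (regs s4)(0 := int (length ys))\<rparr>"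
    let ?s6 = "s4\<lparr>regs := (regs s4)(0 := int (length ys), 1 := y)\<rparr>"
    have 5: "exec (Assign 0 (Var 3)) s4 (1 + bits (int (length ys))) ?s5"
      using exec.Assign[of 0 "Var 3" s4] r4[of 3] w3 by (simp add: written_def)
    have 6: "exec (Assign 1 (Var 5)) ?s5 (1 + bits y) ?s6"
      using exec.Assign[of 1 "Var 5" ?s5] r4[of 5] 3(3) by simp
    have out: "holds_output ?s6 (ys, nat y)"
      using pos w3 a4 by (auto simp: holds_output_def written_def y_def Z_def \<rho>_def)
    let ?t = "1 + (bits (int (length xs)) + bits (int k) + bits (int (length xs) + int k) + 3 + bits (int Z)) +
      (\<tau>2 + (\<tau>3 + (\<tau>4 + (1 + bits (int (length ys)) + (1 + bits y)))))"
    have ex: "exec (out_prog vn vk vz w e) ?s0 ?t ?s6"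
      unfolding out_prog_def Let_def
      by (rule exec.Seq[OF 1 exec.Seq[OF 2(1) exec.Seq[OF 3(1) exec.Seq[OF 4(1) exec.Seq[OF 5 6]]]]])
    have "bits (int (length xs) + int k) \<le> M" using bb[of "length xs + k"] by (simp add: Z_def)
    then have b1: "bits (int (length xs)) + bits (int k) + bits (int (length xs) + int k) + 3 + bits (int Z) \<le> 4 * M + 3"
      using bb[of "length xs"] bb[of k] bb[of Z] by (simp add: Z_def)
    have b4: "\<tau>4 \<le> (pb M + 1) * (7 * pb M + pb M + 20) + 2"
      using pbM(1) by (intro order_trans[OF 4(2)] add_right_mono mult_le_mono) auto
    have b5: "bits (int (length ys)) \<le> pb M + 1" using bits_of_nat[of "length ys"] pbM(1) by linarith
    have b6: "bits y \<le> v M" unfolding y_def by (rule value_boundD[OF v bd])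
    have b7: "input_size ys \<le> pb M * pb M"
      using order_trans[OF input_size_le[of ys "pb M"] mult_le_mono1[OF pbM(1)]] pbM(2) by blast
    have "?t + input_size ys \<le> ?P M"
      by (intro add_mono b1 2(2) 3(2) b4 b5 b6 b7 order_refl)
    also have "\<dots> \<le> C * (M + 1) ^ d" by (rule C)
    \<comment> \<open>\<open>M + 1\<close> is \<open>input_size xs + k + 4\<close>, which is at most
      four times the product of \<open>k + 1\<close> and \<open>input_size xs + 1\<close>.\<close>
    also have "\<dots> \<le> C * (4 * (k + 1) * (input_size xs + 1)) ^ d"
      by (intro mult_le_mono power_mono) (auto simp: M_def algebra_simps)
    also have "\<dots> = (C * 4 ^ d) * (k + 1) ^ d * (input_size xs + 1) ^ d"
      by (simp only: power_mult_distrib mult.assoc)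
    finally have "?t + input_size ys \<le> (C * 4 ^ d) * (k + 1) ^ d * (input_size xs + 1) ^ d" .
    moreover have "computes (out_prog vn vk vz w e) (xs, k) (?t + input_size ys) (ys, nat y)"
      using ex out unfolding computes_def fst_conv by blast
    ultimately show ?thesis unfolding ys_def y_def Z_def \<rho>_def by blast
  qed
  then show ?thesis by blast
qed

section \<open>Functions of bounded degree on sets\<close>

text \<open>The coefficient of the monomial of \<open>X\<close> when \<open>f\<close> is written as
  a multilinear polynomial in the 0-1 indicators of the elements.\<close>

definition mob :: "('a set \<Rightarrow> int) \<Rightarrow> 'a set \<Rightarrow> int" where
  "mob f X = (\<Sum>Y\<in>Pow X. (- 1) ^ card (X - Y) * f Y)"

text \<open>Subsets with and without \<open>x\<close> contribute with opposite signs, so the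
  coefficient is one of the discrete derivative of \<open>f\<close> in direction \<open>x\<close>.
  Inversion, the vanishing results and the evaluation by \<open>mob_exp\<close> all rest on this
  recursion.\<close>

lemma mob_insert:
  assumes "finite X" "x \<notin> X"
  shows "mob f (insert x X) = mob (\<lambda>Y. f (insert x Y)) X - mob f X"
proof -
  have inj: "inj_on (insert x) (Pow X)" using assms by (auto simp: inj_on_def)
  have "mob f (insert x X) = (\<Sum>Y\<in>Pow X. (- 1) ^ card (insert x X - Y) * f Y) +
      (\<Sum>Y\<in>insert x ` Pow X. (- 1) ^ card (insert x X - Y) * f Y)"
    unfolding mob_def Pow_insert using assms by (intro sum.union_disjoint) auto
  also have "(\<Sum>Y\<in>insert x ` Pow X. (- 1) ^ card (insert x X - Y) * f Y) =
      (\<Sum>Y\<in>Pow X. (- 1) ^ card (insert x X - insert x Y) * f (insert x Y))"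
    by (simp add: sum.reindex[OF inj])
  also have "\<dots> = mob (\<lambda>Y. f (insert x Y)) X"
    unfolding mob_def
  proof (intro sum.cong refl)
    fix Y assume "Y \<in> Pow X"
    then have "insert x X - insert x Y = X - Y" using assms by auto
    then show "(- 1) ^ card (insert x X - insert x Y) * f (insert x Y) = (- 1) ^ card (X - Y) * f (insert x Y)" by simp
  qed
  also have "(\<Sum>Y\<in>Pow X. (- 1) ^ card (insert x X - Y) * f Y) = - mob f X"
    unfolding mob_def sum_negf[symmetric]
  proof (intro sum.cong refl)
    fix Y assume "Y \<in> Pow X"
    then have "insert x X - Y = insert x (X - Y)" using assms by auto
    then show "(- 1) ^ card (insert x X - Y) * f Y = - ((- 1) ^ card (X - Y) * f Y)" using assms by simp
  qed
  finally show ?thesis by simp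
qed

lemma mob_empty [simp]: "mob f {} = f {}" by (simp add: mob_def)

lemma sum_mob:
  assumes "finite S" shows "(\<Sum>X\<in>Pow S. mob f X) = f S"
  using assms
proof (induction S arbitrary: f)
  case (insert x S)
  have inj: "inj_on (insert x) (Pow S)" using insert.hyps by (auto simp: inj_on_def)
  have "(\<Sum>X\<in>Pow (insert x S). mob f X) = (\<Sum>X\<in>Pow S. mob f X) + (\<Sum>X\<in>insert x ` Pow S. mob f X)"
    unfolding Pow_insert using insert by (intro sum.union_disjoint) auto
  also have "(\<Sum>X\<in>insert x ` Pow S. mob f X) = (\<Sum>X\<in>Pow S. mob f (insert x X))"
    by (simp add: sum.reindex[OF inj])
  also have "(\<Sum>X\<in>Pow S. mob f X) + \<dots> = (\<Sum>X\<in>Pow S. mob (\<lambda>Y. f (insert x Y)) X)"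
    unfolding sum.distrib[symmetric]
    using insert by (intro sum.cong refl) (subst mob_insert; auto intro: finite_subset)
  finally show ?case using insert.IH by simp
qed simp

lemma mob_add: "mob (\<lambda>S. f S + g S) X = mob f X + mob g X"
  by (simp add: mob_def distrib_left sum.distrib)

lemma mob_cmult: "mob (\<lambda>S. c * f S) X = c * mob f X"
  by (simp add: mob_def sum_distrib_left mult.left_commute)

lemma mob_sum: "mob (\<lambda>S. \<Sum>i\<in>I. f i S) X = (\<Sum>i\<in>I. mob (f i) X)"
  unfolding mob_def sum_distrib_left by (rule sum.swap)

text \<open>Needed for the choice of the base, since the coefficients enter as digits.\<close>

lemma abs_mob_le:
  assumes "finite X" "\<And>Y. Y \<subseteq> X \<Longrightarrow> \<bar>f Y\<bar> \<le> b"
  shows "\<bar>mob f X\<bar> \<le> 2 ^ card X * b"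
proof -
  have "\<bar>mob f X\<bar> \<le> (\<Sum>Y\<in>Pow X. \<bar>(- 1) ^ card (X - Y) * f Y\<bar>)" unfolding mob_def by (rule sum_abs)
  also have "\<dots> \<le> (\<Sum>Y\<in>Pow X. b)" using assms by (intro sum_mono) (auto simp: abs_mult power_abs)
  also have "\<dots> = 2 ^ card X * b" using assms by (simp add: card_Pow)
  finally show ?thesis .
qed

definition degree_le :: "nat \<Rightarrow> ('a set \<Rightarrow> int) \<Rightarrow> bool" where
  "degree_le r f \<longleftrightarrow> (\<forall>X. finite X \<longrightarrow> r < card X \<longrightarrow> mob f X = 0)"

lemma degree_le_mono: "degree_le r f \<Longrightarrow> r \<le> s \<Longrightarrow> degree_le s f"
  by (auto simp: degree_le_def)

lemma degree_le_add: "degree_le r f \<Longrightarrow> degree_le r g \<Longrightarrow> degree_le r (\<lambda>S. f S + g S)"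
  by (simp add: degree_le_def mob_add)

lemma degree_le_cmult: "degree_le r f \<Longrightarrow> degree_le r (\<lambda>S. c * f S)"
  by (simp add: degree_le_def mob_cmult)

lemma degree_le_sum: "(\<And>i. i \<in> I \<Longrightarrow> degree_le r (f i)) \<Longrightarrow> degree_le r (\<lambda>S. \<Sum>i\<in>I. f i S)"
  by (simp add: degree_le_def mob_sum)

text \<open>A set \<open>X\<close> with more than \<open>r\<close> elements has some
  \<open>x\<close> outside \<open>V\<close>, and the derivative in direction \<open>x\<close>
  vanishes.\<close>

lemma degree_le_support:
  assumes "finite V" "card V \<le> r" "\<And>S. f S = f (S \<inter> V)"
  shows "degree_le r f"
  unfolding degree_le_def
proof (intro allI impI)
  fix X :: "'a set" assume X: "finite X" "r < card X"
  then have "\<not> X \<subseteq> V" using assms card_mono[of V X] by auto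
  then obtain x where x: "x \<in> X" "x \<notin> V" by blast
  have "mob (\<lambda>Y. f (insert x Y)) (X - {x}) = mob f (X - {x})"
    unfolding mob_def using x assms(3) by (intro sum.cong refl) (metis Int_insert_left_if0)
  with mob_insert[of "X - {x}" x f] X x show "mob f X = 0" by (simp add: insert_absorb)
qed

text \<open>Used for the shift by \<open>Suc\<close>: nodes are counted from 0, but 0 will serve as
  padding. Points of \<open>X\<close> outside the range of \<open>g\<close> are invisible to the
  function, so the derivative in their direction is 0.\<close>

lemma degree_le_vimage:
  fixes g :: "'a \<Rightarrow> 'b"
  assumes "degree_le r f" "inj g" shows "degree_le r (\<lambda>S. f (g -` S))"
  unfolding degree_le_def
proof (intro allI impI)
  fix X :: "'b set" assume X: "finite X" "r < card X"
  let ?h = "\<lambda>S. f (g -` S)"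
  show "mob ?h X = 0"
  proof (cases "X \<subseteq> range g")
    case True
    then obtain Y where Y: "X = g ` Y" by (auto simp: subset_image_iff)
    have inj: "inj_on g Y" for Y using assms(2) by (rule inj_on_subset) simp
    have "mob ?h X = (\<Sum>Z\<in>Pow Y. (- 1) ^ card (g ` Y - g ` Z) * f (g -` g ` Z))"
      unfolding mob_def Y image_Pow_surj[OF refl, symmetric] by (subst sum.reindex) (auto simp: inj_on_image_Pow[OF inj])
    also have "\<dots> = mob f Y"
      unfolding mob_def
      by (intro sum.cong refl) (simp add: inj_vimage_image_eq[OF assms(2)] image_set_diff[OF assms(2), symmetric] card_image[OF inj])
    also have "\<dots> = 0" using assms(1) X card_image[OF inj] finite_imageD[OF _ inj] unfolding degree_le_def Y by metis
    finally show ?thesis .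
  next
    case False
    then obtain x where x: "x \<in> X" "x \<notin> range g" by blast
    then have "g -` insert x Y = g -` Y" for Y by auto
    then have "mob (\<lambda>Y. ?h (insert x Y)) (X - {x}) = mob ?h (X - {x})" by simp
    with mob_insert[of "X - {x}" x ?h] X x show ?thesis by (simp add: insert_absorb)
  qed
qed

lemma sum_mob_degree:
  assumes "degree_le r f" "finite S"
  shows "(\<Sum>X | X \<subseteq> S \<and> card X \<le> r. mob f X) = f S"
proof -
  have "(\<Sum>X | X \<subseteq> S \<and> card X \<le> r. mob f X) = (\<Sum>X\<in>Pow S. mob f X)"
    using assms by (intro sum.mono_neutral_left) (auto simp: degree_le_def not_le[symmetric] dest: finite_subset)
  then show ?thesis using sum_mob[OF assms(2)] by simp
qed

section \<open>Circuits of weft one\<close>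

definition node_val :: "circuit \<Rightarrow> nat set \<Rightarrow> nat \<Rightarrow> bool" where
  "node_val C S u = node_vals C S ! u"

lemma length_node_vals [simp]: "length (node_vals C S) = length C"
  by (induction C rule: rev_induct) (auto simp: node_vals_def)

lemma node_vals_snoc: "node_vals (C @ [g]) S = node_vals C S @ [gate_val S (node_vals C S) g]"
  by (simp add: node_vals_def)

lemma node_val_append: "u < length C \<Longrightarrow> node_val (C @ D) S u = node_val C S u"
  by (induction D rule: rev_induct)
    (auto simp: node_val_def append_assoc[symmetric] node_vals_snoc nth_append simp del: append_assoc)

lemma node_val_unfold:
  assumes "wf_circuit C" "u < length C"
  shows "node_val C S u = (case C ! u of Input \<Rightarrow> u \<in> S | Not j \<Rightarrow> \<not> node_val C S j
    | And js \<Rightarrow> \<forall>j\<in>set js. node_val C S j | Or js \<Rightarrow> \<exists>j\<in>set js. node_val C S j)"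
proof -
  have C: "C = take u C @ [C ! u] @ drop (Suc u) C" using assms(2) by (simp add: id_take_nth_drop)
  have *: "node_val C S v = node_val (take u C) S v" if "v < u" for v
    using node_val_append[of v "take u C" "[C ! u] @ drop (Suc u) C" S] that assms(2) C by simp
  have p: "j < u" if "j \<in> set (preds (C ! u))" for j using assms that by (auto simp: wf_circuit_def)
  have "node_val C S u = node_val (take u C @ [C ! u]) S u"
    using node_val_append[of u "take u C @ [C ! u]" "drop (Suc u) C" S] assms(2) C by simp
  also have "\<dots> = gate_val S (node_vals (take u C) S) (C ! u)"
    using assms(2) by (simp add: node_val_def node_vals_snoc nth_append)
  also have "\<dots> = (case C ! u of Input \<Rightarrow> u \<in> S | Not j \<Rightarrow> \<not> node_val C S j
    | And js \<Rightarrow> \<forall>j\<in>set js. node_val C S j | Or js \<Rightarrow> \<exists>j\<in>set js. node_val C S j)"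
    using * p assms(2) by (cases "C ! u") (auto simp: node_val_def)
  finally show ?thesis .
qed

lemma satisfies_node_val:
  assumes "C \<noteq> []" shows "satisfies S C \<longleftrightarrow> node_val C S (length C - 1)"
proof -
  have "node_vals C S \<noteq> []" using assms by (metis length_0_conv length_node_vals)
  then show ?thesis by (simp add: satisfies_def node_val_def last_conv_nth)
qed

section \<open>Weft and depth by recursion from the output\<close>

inductive ipath :: "circuit \<Rightarrow> nat \<Rightarrow> nat list \<Rightarrow> bool" for C where
  start: "u \<in> inputs C \<Longrightarrow> ipath C u [u]"
| step: "ipath C v p \<Longrightarrow> u < length C \<Longrightarrow> v \<in> set (preds (C ! u)) \<Longrightarrow> ipath C u (p @ [u])"

text \<open>Paths to an arbitrary node that grow at their end allow induction on the last gate;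
  those that end in the output are the paths of \<open>io_path\<close>.\<close>

lemma ipath_iff:
  "ipath C u p \<longleftrightarrow> p \<noteq> [] \<and> hd p \<in> inputs C \<and> last p = u \<and>
    (\<forall>i. Suc i < length p \<longrightarrow> p ! Suc i < length C \<and> p ! i \<in> set (preds (C ! (p ! Suc i))))"
proof
  assume "ipath C u p"
  then show "p \<noteq> [] \<and> hd p \<in> inputs C \<and> last p = u \<and>
    (\<forall>i. Suc i < length p \<longrightarrow> p ! Suc i < length C \<and> p ! i \<in> set (preds (C ! (p ! Suc i))))"
  proof induction
    case (step v p u)
    have "i = length p - 1" if "Suc i = length p" for i using that by simp
    with step show ?case by (auto simp: nth_append last_conv_nth less_Suc_eq)
  qed auto
next
  assume "p \<noteq> [] \<and> hd p \<in> inputs C \<and> last p = u \<and>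
    (\<forall>i. Suc i < length p \<longrightarrow> p ! Suc i < length C \<and> p ! i \<in> set (preds (C ! (p ! Suc i))))"
  then show "ipath C u p"
  proof (induction p arbitrary: u rule: rev_induct)
    case (snoc x p)
    show ?case
    proof (cases "p = []")
      case True
      with snoc show ?thesis by (auto intro: ipath.start)
    next
      case False
      have st: "(p @ [x]) ! Suc i < length C \<and> (p @ [x]) ! i \<in> set (preds (C ! ((p @ [x]) ! Suc i)))"
        if "Suc i < length (p @ [x])" for i using snoc.prems that by blast
      have "ipath C (last p) p"
      proof (rule snoc.IH, intro conjI allI impI)
        fix i assume "Suc i < length p"
        then show "p ! Suc i < length C" "p ! i \<in> set (preds (C ! (p ! Suc i)))"
          using st[of i] by (auto simp: nth_append)
      qed (use snoc.prems False in auto)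
      moreover have "x < length C" "last p \<in> set (preds (C ! x))"
        using st[of "length p - 1"] False by (auto simp: nth_append last_conv_nth)
      ultimately show ?thesis using snoc.prems ipath.step by fastforce
    qed
  qed simp
qed

lemma io_path_iff: "io_path C p \<longleftrightarrow> ipath C (length C - 1) p"
  by (auto simp: io_path_def ipath_iff)

lemma ipath_cases:
  assumes "ipath C u p"
  obtains "p = [u]" "u \<in> inputs C" | v q where "p = q @ [u]" "ipath C v q" "v \<in> set (preds (C ! u))"
  using assms by (cases) auto

text \<open>Every gate other than an input has an earlier argument, so going backwards ends in an
  input. Hence every predecessor of \<open>u\<close> lies on a path to \<open>u\<close>, and a
  condition on paths constrains all of them.\<close>

lemma ex_ipath:
  assumes "wf_circuit C" "u < length C" shows "\<exists>p. ipath C u p"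
  using assms(2)
proof (induction u rule: less_induct)
  case (less u)
  show ?case
  proof (cases "C ! u = Input")
    case True
    with less have "u \<in> inputs C" by (simp add: inputs_def)
    then show ?thesis by (blast intro: ipath.start)
  next
    case False
    with assms less obtain v where v: "v \<in> set (preds (C ! u))" "v < u"
      unfolding wf_circuit_def by (metis list.set_intros(1) neq_Nil_conv)
    with less show ?thesis by (meson ipath.step less_trans)
  qed
qed

text \<open>\<open>d\<close> and \<open>t\<close> are the remaining budgets of depth and of large
  gates. The recursion replaces the quantification over paths, and for fixed \<open>d\<close> it can
  be unfolded into an expression of the language.\<close>

primrec shallow :: "circuit \<Rightarrow> nat \<Rightarrow> nat \<Rightarrow> nat \<Rightarrow> bool" where
  "shallow C 0 t u \<longleftrightarrow> preds (C ! u) = []"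
| "shallow C (Suc d) t u \<longleftrightarrow> (if large (C ! u) then 0 < t \<and> (\<forall>v\<in>set (preds (C ! u)). shallow C d (t - 1) v)
     else \<forall>v\<in>set (preds (C ! u)). shallow C d t v)"

text \<open>A path to an argument extends to \<open>u\<close> at the price of one edge and, if
  \<open>u\<close> is large, one unit of \<open>t\<close>. The existence of a path to each argument
  yields \<open>0 < t\<close> at a large gate and excludes arguments when no depth is left.\<close>

lemma shallow_iff:
  assumes "wf_circuit C" "u < length C"
  shows "shallow C d t u \<longleftrightarrow>
    (\<forall>p. ipath C u p \<longrightarrow> length p \<le> Suc d \<and> length (filter (\<lambda>i. large (C ! i)) p) \<le> t)"
  using assms(2)
proof (induction d arbitrary: t u)
  case 0
  have wf: "j < u" if "j \<in> set (preds (C ! u))" for j using assms(1) 0 that by (auto simp: wf_circuit_def)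
  show ?case
  proof
    assume L: "shallow C 0 t u"
    show "\<forall>p. ipath C u p \<longrightarrow> length p \<le> Suc 0 \<and> length (filter (\<lambda>i. large (C ! i)) p) \<le> t"
    proof (intro allI impI)
      fix p assume "ipath C u p"
      then have "p = [u]" by (cases rule: ipath_cases) (use L in auto)
      then show "length p \<le> Suc 0 \<and> length (filter (\<lambda>i. large (C ! i)) p) \<le> t" using L by (simp add: large_def)
    qed
  next
    assume R: "\<forall>p. ipath C u p \<longrightarrow> length p \<le> Suc 0 \<and> length (filter (\<lambda>i. large (C ! i)) p) \<le> t"
    have False if v: "v \<in> set (preds (C ! u))" for v
    proof -
      obtain p where p: "ipath C v p" using ex_ipath[OF assms(1), of v] wf[OF v] 0 by auto
      have "p \<noteq> []" using p by (simp add: ipath_iff)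
      with R ipath.step[OF p 0 v] show False by fastforce
    qed
    then show "shallow C 0 t u" by (cases "preds (C ! u)") auto
  qed
next
  case (Suc d)
  have v: "v < length C" if "v \<in> set (preds (C ! u))" for v
    using assms(1) Suc.prems that by (fastforce simp: wf_circuit_def)
  show ?case
  proof
    assume L: "shallow C (Suc d) t u"
    show "\<forall>p. ipath C u p \<longrightarrow> length p \<le> Suc (Suc d) \<and> length (filter (\<lambda>i. large (C ! i)) p) \<le> t"
    proof (intro allI impI)
      fix p assume "ipath C u p"
      then show "length p \<le> Suc (Suc d) \<and> length (filter (\<lambda>i. large (C ! i)) p) \<le> t"
      proof (cases rule: ipath_cases)
        case 1
        then show ?thesis by (auto simp: inputs_def large_def)
      next
        case (2 w q)
        have "shallow C d (if large (C ! u) then t - 1 else t) w" using L 2(3) by auto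
        then have "length q \<le> Suc d"
          "length (filter (\<lambda>i. large (C ! i)) q) \<le> (if large (C ! u) then t - 1 else t)"
          using 2(2) unfolding Suc.IH[OF v[OF 2(3)]] by blast+
        moreover have "large (C ! u) \<Longrightarrow> 0 < t" using L by simp
        ultimately show ?thesis using 2(1) by (auto split: if_splits)
      qed
    qed
  next
    assume R: "\<forall>p. ipath C u p \<longrightarrow> length p \<le> Suc (Suc d) \<and> length (filter (\<lambda>i. large (C ! i)) p) \<le> t"
    have P: "length p \<le> Suc d \<and> length (filter (\<lambda>i. large (C ! i)) p) + (if large (C ! u) then 1 else 0) \<le> t"
      if "w \<in> set (preds (C ! u))" "ipath C w p" for w p
      using R[rule_format, OF ipath.step[OF that(2) Suc.prems that(1)]] by (auto split: if_splits)
    have sh: "shallow C d (if large (C ! u) then t - 1 else t) w" if w: "w \<in> set (preds (C ! u))" for w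
      unfolding Suc.IH[OF v[OF w]]
    proof (intro allI impI)
      fix p assume "ipath C w p"
      from P[OF w this] show "length p \<le> Suc d \<and>
          length (filter (\<lambda>i. large (C ! i)) p) \<le> (if large (C ! u) then t - 1 else t)"
        by (auto split: if_splits)
    qed
    show "shallow C (Suc d) t u"
    proof (cases "large (C ! u)")
      case True
      then obtain w where w: "w \<in> set (preds (C ! u))" by (cases "preds (C ! u)") (auto simp: large_def)
      then obtain p where "ipath C w p" using ex_ipath[OF assms(1) v] by blast
      with P[OF w this] True have "0 < t" by auto
      then show ?thesis using True sh by simp
    qed (use sh in simp)
  qed
qed

lemma weft_depth_iff_shallow:
  assumes "wf_circuit C"
  shows "weft_le C t \<and> depth_le C d \<longleftrightarrow> shallow C d t (length C - 1)"
proof -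
  have "length C - 1 < length C" using assms by (auto simp: wf_circuit_def)
  from shallow_iff[OF assms this] show ?thesis
    unfolding weft_le_def depth_le_def io_path_iff by (auto simp: le_diff_conv)
qed

text \<open>
  Large gates and inputs are the atoms of the top part of the circuit.  Their \<open>defect\<close> is a
  nonnegative integer that determines the truth value and is a sum of functions of few inputs.
\<close>

definition defect :: "circuit \<Rightarrow> nat set \<Rightarrow> nat \<Rightarrow> int" where
  "defect C S u = (case C ! u of Input \<Rightarrow> of_bool (u \<in> S) | Not j \<Rightarrow> 0
    | And js \<Rightarrow> (\<Sum>j\<in>set js. of_bool (\<not> node_val C S j)) | Or js \<Rightarrow> (\<Sum>j\<in>set js. of_bool (node_val C S j)))"

fun is_And :: "gate \<Rightarrow> bool" where
  "is_And (And js) = True"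
| "is_And _ = False"

fun is_Not :: "gate \<Rightarrow> bool" where
  "is_Not (Not j) = True"
| "is_Not _ = False"

text \<open>Where the evaluation of the top part stops. Among the nodes leading to the output of a
  circuit of weft 1, no large gate lies below another one.\<close>

definition atom :: "gate \<Rightarrow> bool" where
  "atom g \<longleftrightarrow> preds g = [] \<or> large g"

text \<open>For \<open>And\<close> the defect counts false arguments and has to be 0; for inputs and
  \<open>Or\<close> it counts true ones and has to be positive.\<close>

definition atom_good :: "gate \<Rightarrow> int \<Rightarrow> bool" where
  "atom_good g v \<longleftrightarrow> (if is_And g then v \<le> 0 else 0 < v)"

text \<open>
  \<open>profile\<close> collects the defects of the atoms below \<open>u\<close> as digits in base \<open>Z\<close>, and \<open>good\<close> evaluates
  the top part of the circuit on such a collection.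
\<close>

primrec profile :: "circuit \<Rightarrow> int \<Rightarrow> nat set \<Rightarrow> nat \<Rightarrow> nat \<Rightarrow> int" where
  "profile C Z S 0 u = defect C S u"
| "profile C Z S (Suc d) u = (if atom (C ! u) then defect C S u
     else if length (preds (C ! u)) = 1 then profile C Z S d (preds (C ! u) ! 0)
     else profile C Z S d (preds (C ! u) ! 0) + Z ^ (2 ^ d) * profile C Z S d (preds (C ! u) ! 1))"

primrec good :: "circuit \<Rightarrow> int \<Rightarrow> nat \<Rightarrow> nat \<Rightarrow> int \<Rightarrow> bool" where
  "good C Z 0 u v = atom_good (C ! u) v"
| "good C Z (Suc d) u v = (if atom (C ! u) then atom_good (C ! u) v
     else if is_Not (C ! u) then \<not> good C Z d (preds (C ! u) ! 0) v
     else if length (preds (C ! u)) = 1 then good C Z d (preds (C ! u) ! 0) v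
     else if is_And (C ! u) then good C Z d (preds (C ! u) ! 0) (v mod Z ^ (2 ^ d)) \<and> good C Z d (preds (C ! u) ! 1) (v div Z ^ (2 ^ d))
     else good C Z d (preds (C ! u) ! 0) (v mod Z ^ (2 ^ d)) \<or> good C Z d (preds (C ! u) ! 1) (v div Z ^ (2 ^ d)))"

lemma atom_good_defect:
  assumes "wf_circuit C" "u < length C" "atom (C ! u)"
  shows "atom_good (C ! u) (defect C S u) \<longleftrightarrow> node_val C S u"
proof -
  show ?thesis
    unfolding node_val_unfold[OF assms(1,2)] using assms(3)
    by (cases "C ! u") (auto simp: atom_good_def defect_def atom_def large_def card_gt_0_iff)
qed

lemma defect_bounds:
  assumes "length (preds (C ! u)) < Z" "2 \<le> Z"
  shows "0 \<le> defect C S u" "defect C S u < int Z"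
proof -
  have b: "0 \<le> (\<Sum>j\<in>set js. of_bool (P j) :: int) \<and> (\<Sum>j\<in>set js. of_bool (P j) :: int) \<le> int (length js)"
    for js :: "nat list" and P
  proof
    have "(\<Sum>j\<in>set js. of_bool (P j) :: int) \<le> (\<Sum>j\<in>set js. 1)" by (intro sum_mono) simp
    then show "(\<Sum>j\<in>set js. of_bool (P j) :: int) \<le> int (length js)" using card_length[of js] by simp
  qed (intro sum_nonneg, simp)
  have "0 \<le> defect C S u \<and> defect C S u \<le> int (max 1 (length (preds (C ! u))))"
  proof (cases "C ! u")
    case (And js)
    then show ?thesis using b[of "\<lambda>j. \<not> node_val C S j" js] by (simp add: defect_def)
  next
    case (Or js)
    then show ?thesis using b[of "node_val C S" js] by (simp add: defect_def)
  qed (auto simp: defect_def)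
  moreover have "int (max 1 (length (preds (C ! u)))) < int Z" using assms by simp
  ultimately show "0 \<le> defect C S u" "defect C S u < int Z" by linarith+
qed

lemma small_preds:
  assumes "\<not> atom g"
  obtains v where "preds g = [v]" | v w where "preds g = [v, w]" "\<not> is_Not g"
proof -
  from assms have "preds g \<noteq> []" "length (preds g) \<le> 2" by (auto simp: atom_def large_def)
  then consider v where "preds g = [v]" | v w where "preds g = [v, w]"
    by (cases "preds g"; cases "tl (preds g)") auto
  then show ?thesis using that by cases (cases g; auto)+
qed

text \<open>With \<open>Y = Z ^ (2 ^ d)\<close>, two profiles below \<open>Y\<close> combine to at
  most \<open>(Y - 1) + Y * (Y - 1) < Y * Y\<close>, and squaring \<open>Y\<close> doubles the
  exponent \<open>2 ^ d\<close>: there is room for one digit for each of the at most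
  \<open>2 ^ d\<close> atoms.\<close>

lemma profile_bounds:
  assumes wf: "wf_circuit C" and Z: "\<And>u. u < length C \<Longrightarrow> length (preds (C ! u)) < Z" "2 \<le> Z" and "u < length C"
  shows "0 \<le> profile C (int Z) S d u \<and> profile C (int Z) S d u < int Z ^ (2 ^ d)"
  using assms(4)
proof (induction d arbitrary: u)
  case 0
  then show ?case using defect_bounds[OF Z(1) Z(2)] by simp
next
  case (Suc d)
  let ?Y = "int Z ^ (2 ^ d)"
  have Y: "1 \<le> ?Y" using Z(2) by simp
  have YY: "int Z ^ (2 ^ Suc d) = ?Y * ?Y" by (simp add: power_add[symmetric] mult_2)
  have YYle: "?Y \<le> ?Y * ?Y" "int Z \<le> ?Y"
    using Y mult_left_mono[of 1 ?Y ?Y] power_increasing[of 1 "2 ^ d" "int Z"] Z(2) by auto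
  have v: "v < length C" if "v \<in> set (preds (C ! u))" for v
    using wf Suc.prems that by (fastforce simp: wf_circuit_def)
  show ?case
  proof (cases "atom (C ! u)")
    case True
    have "int Z \<le> ?Y * ?Y" using YYle by linarith
    with True show ?thesis using defect_bounds[OF Z(1)[OF Suc.prems] Z(2), where S = S]
      unfolding YY profile.simps by (intro conjI; simp only: if_True; linarith)
  next
    case False
    then show ?thesis
    proof (cases rule: small_preds)
      case (1 v)
      then show ?thesis using False Suc.IH[OF v, of v] YYle unfolding YY by simp
    next
      case (2 v w)
      note IH = Suc.IH[OF v, of v] Suc.IH[OF v, of w]
      have "?Y * profile C (int Z) S d w \<le> ?Y * (?Y - 1)" using IH 2 Y by (intro mult_left_mono) auto
      moreover have "0 \<le> ?Y * profile C (int Z) S d w" using IH 2 Y by simp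
      ultimately show ?thesis using False 2 IH unfolding YY by (simp add: algebra_simps)
    qed
  qed
qed

text \<open>By the bounds on profiles, \<open>mod\<close> and \<open>div\<close> by
  \<open>Z ^ (2 ^ d)\<close> recover the two parts. \<open>shallow\<close> guarantees that atoms
  have been reached when the depth is used up.\<close>

lemma good_profile:
  assumes wf: "wf_circuit C" and Z: "\<And>u. u < length C \<Longrightarrow> length (preds (C ! u)) < Z" "2 \<le> Z"
    and "u < length C" "shallow C d t u"
  shows "good C (int Z) d u (profile C (int Z) S d u) \<longleftrightarrow> node_val C S u"
  using assms(4,5)
proof (induction d arbitrary: u)
  case 0
  then show ?case using atom_good_defect[OF wf] by (simp add: atom_def)
next
  case (Suc d)
  show ?case
  proof (cases "atom (C ! u)")
    case True
    then show ?thesis using atom_good_defect[OF wf] Suc by simp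
  next
    case False
    then have sm: "\<not> large (C ! u)" by (simp add: atom_def)
    have v: "v < length C" if "v \<in> set (preds (C ! u))" for v
      using wf Suc.prems that by (fastforce simp: wf_circuit_def)
    have IH: "good C (int Z) d v (profile C (int Z) S d v) \<longleftrightarrow> node_val C S v" if "v \<in> set (preds (C ! u))" for v
      using Suc.IH[OF v[OF that]] Suc.prems(2) sm that by simp
    note nv = node_val_unfold[OF wf Suc.prems(1), of S]
    from False show ?thesis
    proof (cases rule: small_preds)
      case (1 v)
      then show ?thesis using False IH[of v] nv by (cases "C ! u") auto
    next
      case (2 v w)
      let ?Y = "int Z ^ (2 ^ d)"
      let ?a = "profile C (int Z) S d v" and ?b = "profile C (int Z) S d w"
      have b: "0 \<le> ?a" "?a < ?Y" using profile_bounds[OF wf Z v, of v] 2 by simp_all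
      then have "(?a + ?Y * ?b) mod ?Y = ?a" "(?a + ?Y * ?b) div ?Y = ?b"
        using Z(2) by (simp_all add: mod_pos_pos_trivial div_pos_pos_trivial)
      then show ?thesis using False 2 IH[of v] IH[of w] nv by (cases "C ! u") auto
    qed
  qed
qed

text \<open>Without large gates every gate has at most two arguments, so the number of relevant
  inputs at most doubles with each level.\<close>

lemma node_val_support:
  assumes wf: "wf_circuit C" and "u < length C" "shallow C d 0 u"
  shows "\<exists>V. finite V \<and> card V \<le> 2 ^ d \<and> (\<forall>S. node_val C S u = node_val C (S \<inter> V) u)"
  using assms(2,3)
proof (induction d arbitrary: u)
  case 0
  then have "C ! u = Input" using wf by (auto simp: wf_circuit_def)
  then show ?case using node_val_unfold[OF wf 0(1)] by (intro exI[of _ "{u}"]) simp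
next
  case (Suc d)
  have v: "v < length C" if "v \<in> set (preds (C ! u))" for v
    using wf Suc.prems that by (fastforce simp: wf_circuit_def)
  have sm: "\<not> large (C ! u)" using Suc.prems(2) by auto
  have "\<forall>v\<in>set (preds (C ! u)). \<exists>V. finite V \<and> card V \<le> 2 ^ d \<and> (\<forall>S. node_val C S v = node_val C (S \<inter> V) v)"
    using Suc.IH[OF v] Suc.prems(2) sm by simp
  then obtain W where W: "\<And>v. v \<in> set (preds (C ! u)) \<Longrightarrow> finite (W v)" "\<And>v. v \<in> set (preds (C ! u)) \<Longrightarrow> card (W v) \<le> 2 ^ d"
    "\<And>v S. v \<in> set (preds (C ! u)) \<Longrightarrow> node_val C S v = node_val C (S \<inter> W v) v" by metis
  show ?case
  proof (cases "C ! u = Input")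
    case True
    then show ?thesis using node_val_unfold[OF wf Suc.prems(1)] by (intro exI[of _ "{u}"]) simp
  next
    case False
    let ?V = "\<Union>v\<in>set (preds (C ! u)). W v"
    have "card ?V \<le> (\<Sum>v\<in>set (preds (C ! u)). card (W v))" by (rule card_UN_le) simp
    also have "\<dots> \<le> (\<Sum>v\<in>set (preds (C ! u)). 2 ^ d)" by (intro sum_mono W)
    also have "\<dots> \<le> 2 * 2 ^ d" using sm card_length[of "preds (C ! u)"] by (simp add: large_def)
    finally have "card ?V \<le> 2 ^ Suc d" by simp
    moreover have "node_val C S u = node_val C (S \<inter> ?V) u" for S
    proof -
      have *: "\<forall>v\<in>set (preds (C ! u)). node_val C (S \<inter> ?V) v = node_val C S v"
      proof
        fix v assume v: "v \<in> set (preds (C ! u))"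
        then have "S \<inter> ?V \<inter> W v = S \<inter> W v" by auto
        then show "node_val C (S \<inter> ?V) v = node_val C S v" using W(3)[OF v] by metis
      qed
      show ?thesis
        unfolding node_val_unfold[OF wf Suc.prems(1)] using False * by (cases "C ! u") simp_all
    qed
    ultimately show ?thesis using W(1) by (intro exI[of _ ?V]) blast
  qed
qed

lemma degree_le_node_val:
  assumes "wf_circuit C" "u < length C" "shallow C d 0 u"
  shows "degree_le (2 ^ d) (\<lambda>S. of_bool (node_val C S u))" "degree_le (2 ^ d) (\<lambda>S. of_bool (\<not> node_val C S u))"
proof -
  obtain V where "finite V" "card V \<le> 2 ^ d" "\<And>S. node_val C S u = node_val C (S \<inter> V) u"
    using node_val_support[OF assms] by blast
  then show "degree_le (2 ^ d) (\<lambda>S. of_bool (node_val C S u))" "degree_le (2 ^ d) (\<lambda>S. of_bool (\<not> node_val C S u))"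
    by (auto intro!: degree_le_support[of V])
qed

text \<open>Here weft 1 is used: a large gate exhausts the budget, so each of its arguments depends
  on at most \<open>2 ^ (d - 1)\<close> inputs. The degree of a sum is bounded by that of its terms,
  however many there are.\<close>

lemma degree_le_defect:
  assumes wf: "wf_circuit C" and "u < length C" "shallow C d 1 u" "atom (C ! u)"
  shows "degree_le (2 ^ d) (\<lambda>S. defect C S u)"
proof (cases "C ! u = Input")
  case True
  have "degree_le 1 (\<lambda>S. of_bool (u \<in> S))" by (rule degree_le_support[of "{u}"]) auto
  then show ?thesis using True degree_le_mono by (fastforce simp: defect_def)
next
  case False
  then have lg: "large (C ! u)" using assms by (auto simp: atom_def wf_circuit_def)
  then obtain d' where d: "d = Suc d'" using assms(3) by (cases d) (auto simp: large_def)
  have v: "v < length C" if "v \<in> set (preds (C ! u))" for v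
    using wf assms that by (fastforce simp: wf_circuit_def)
  have "shallow C d' 0 v" if "v \<in> set (preds (C ! u))" for v using assms(3) lg that by (simp add: d)
  then have "degree_le (2 ^ d') (\<lambda>S. of_bool (node_val C S v))" "degree_le (2 ^ d') (\<lambda>S. of_bool (\<not> node_val C S v))"
    if "v \<in> set (preds (C ! u))" for v using degree_le_node_val[OF wf v] that by blast+
  then have "degree_le (2 ^ d') (\<lambda>S. defect C S u)"
    using False by (cases "C ! u") (auto simp: defect_def degree_le_def[of _ "\<lambda>_. 0"] mob_def simp del: sum_of_bool_eq intro!: degree_le_sum)
  then show ?thesis by (rule degree_le_mono) (simp add: d)
qed

text \<open>Scaling by a power of \<open>Z\<close> and adding do not raise the degree, so packing
  the counts into one integer costs nothing.\<close>

lemma degree_le_profile: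
  assumes wf: "wf_circuit C" and "u < length C" "shallow C d 1 u"
  shows "degree_le (2 ^ d) (\<lambda>S. profile C Z S d u)"
  using assms(2,3)
proof (induction d arbitrary: u)
  case 0
  then have "atom (C ! u)" by (simp add: atom_def)
  then show ?case using degree_le_defect[OF wf 0] by simp
next
  case (Suc d)
  show ?case
  proof (cases "atom (C ! u)")
    case True
    then show ?thesis using degree_le_defect[OF wf Suc.prems] by simp
  next
    case False
    then have sm: "\<not> large (C ! u)" by (simp add: atom_def)
    have v: "v < length C" if "v \<in> set (preds (C ! u))" for v
      using wf Suc.prems that by (fastforce simp: wf_circuit_def)
    have IH: "degree_le (2 ^ Suc d) (\<lambda>S. profile C Z S d v)" if "v \<in> set (preds (C ! u))" for v
      by (rule degree_le_mono[OF Suc.IH[OF v[OF that]]]) (use Suc.prems(2) sm that in auto)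
    from False show ?thesis
    proof (cases rule: small_preds)
      case (1 v)
      then show ?thesis using False IH[of v] by simp
    next
      case (2 v w)
      then show ?thesis using False IH[of v] IH[of w] by (simp add: degree_le_add degree_le_cmult del: power_Suc)
    qed
  qed
qed

section \<open>Encoding a choice of a set by integers\<close>

text \<open>Digits may be negative. At the lowest position with a nonzero digit, all other terms are
  divisible by the next power of \<open>B\<close>; so \<open>B\<close> divides this digit, which is
  smaller than \<open>B\<close> in absolute value.\<close>

lemma base_expansion_eq_0:
  fixes s :: "'c \<Rightarrow> int"
  assumes "finite C" "inj_on pos C" "\<And>c. c \<in> C \<Longrightarrow> \<bar>s c\<bar> < B" "(\<Sum>c\<in>C. s c * B ^ pos c) = 0"
    and "c \<in> C"
  shows "s c = 0"
proof (rule ccontr)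
  assume "s c \<noteq> 0"
  define D where "D = {c\<in>C. s c \<noteq> 0}"
  have D: "finite D" "c \<in> D" "D \<subseteq> C" using assms \<open>s c \<noteq> 0\<close> by (auto simp: D_def)
  obtain c0 where c0: "c0 \<in> D" "\<And>c. c \<in> D \<Longrightarrow> pos c0 \<le> pos c"
    using ex_min_if_finite[of "pos ` D"] D by (metis empty_iff finite_imageI imageE image_eqI not_le_imp_less)
  have B: "0 < B" using assms(3)[of c0] c0(1) D(3) by (metis abs_ge_zero order.strict_trans1 subsetD)
  have "(\<Sum>c\<in>D. s c * B ^ pos c) = (\<Sum>c\<in>C. s c * B ^ pos c)"
    using assms(1) by (intro sum.mono_neutral_left) (auto simp: D_def)
  then have "(\<Sum>c\<in>D. s c * B ^ pos c) = 0" using assms(4) by simp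
  then have sum: "s c0 * B ^ pos c0 = - (\<Sum>c\<in>D - {c0}. s c * B ^ pos c)"
    using D(1) c0(1) by (simp add: sum.remove)
  have "B ^ Suc (pos c0) dvd (\<Sum>c\<in>D - {c0}. s c * B ^ pos c)"
  proof (rule dvd_sum)
    fix c assume c: "c \<in> D - {c0}"
    then have "pos c \<noteq> pos c0" using assms(2) c0(1) D(3) by (auto dest: inj_onD)
    then have "Suc (pos c0) \<le> pos c" using c0(2)[of c] c by auto
    then show "B ^ Suc (pos c0) dvd s c * B ^ pos c" by (simp add: le_imp_power_dvd del: power_Suc)
  qed
  then have "B * B ^ pos c0 dvd s c0 * B ^ pos c0" unfolding sum by simp
  then have "B dvd s c0" using B by simp
  moreover have "s c0 \<noteq> 0" using c0(1) by (simp add: D_def)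
  ultimately have "\<bar>B\<bar> \<le> \<bar>s c0\<bar>" by (rule dvd_imp_le_int[rotated])
  then show False using assms(3)[of c0] c0(1) D(3) by auto
qed

lemma digit_sum_less:
  assumes "\<And>a. a < r \<Longrightarrow> f a < (Z::nat)" shows "(\<Sum>a<r. f a * Z ^ a) < Z ^ r"
  using assms
proof (induction r)
  case (Suc r)
  then have *: "(\<Sum>a<r. f a * Z ^ a) < Z ^ r" "f r * Z ^ r \<le> (Z - 1) * Z ^ r" and "0 < Z"
    by (fastforce intro!: mult_le_mono1)+
  from * have "(\<Sum>a<r. f a * Z ^ a) + f r * Z ^ r < Z ^ r + (Z - 1) * Z ^ r" by linarith
  also have "\<dots> = Z ^ Suc r" using \<open>0 < Z\<close> by (cases Z) simp_all
  finally show ?case by simp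
qed simp

lemma digit_sum_inj:
  assumes "\<And>a. a < r \<Longrightarrow> f a < (Z::nat)" "\<And>a. a < r \<Longrightarrow> g a < Z"
    and "(\<Sum>a<r. f a * Z ^ a) = (\<Sum>a<r. g a * Z ^ a)" and "a < r"
  shows "f a = g a"
  using assms
proof (induction r)
  case (Suc r)
  have l: "(\<Sum>a<r. f a * Z ^ a) < Z ^ r" "(\<Sum>a<r. g a * Z ^ a) < Z ^ r"
    using Suc.prems by (auto intro: digit_sum_less)
  have e: "(\<Sum>a<r. f a * Z ^ a) + f r * Z ^ r = (\<Sum>a<r. g a * Z ^ a) + g r * Z ^ r" using Suc.prems(3) by simp
  have "0 < Z" using Suc.prems(1)[of r] by simp
  with arg_cong[OF e, of "\<lambda>x. x div Z ^ r"] l have "f r = g r" by simp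
  with e Suc show ?case by (auto simp: less_Suc_eq)
qed simp

text \<open>A set of at most \<open>r\<close> positive numbers as an \<open>r\<close>-tuple. The
  zeros in front are the reason why indices start at 1 and inputs are shifted by 1. For sets of
  equal size, entries at the same place correspond in increasing order.\<close>

definition pad :: "nat \<Rightarrow> nat set \<Rightarrow> nat list" where
  "pad r U = replicate (r - card U) 0 @ sorted_list_of_set U"

lemma length_pad: "finite U \<Longrightarrow> card U \<le> r \<Longrightarrow> length (pad r U) = r"
  by (simp add: pad_def)

lemma set_pad: "finite U \<Longrightarrow> set (pad r U) \<subseteq> insert 0 U" "finite U \<Longrightarrow> U \<subseteq> set (pad r U)"
  by (auto simp: pad_def)

lemma pad_inj:
  assumes "pad r U = pad r V" "finite U" "finite V" "0 \<notin> U" "0 \<notin> V" shows "U = V"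
proof -
  have "U = set (pad r U) - {0}" "V = set (pad r V) - {0}" using set_pad assms by blast+
  then show ?thesis using assms(1) by simp
qed

datatype coord = CW | CS "nat set" | CV nat | CE "nat set" nat

text \<open>
  \<open>CW\<close> carries the weight, \<open>CS U\<close> and \<open>CV i\<close> count the numbers chosen for the index set \<open>U\<close>
  and for the \<open>i\<close>-th element, and \<open>CE U a\<close> tests that these choices agree.
\<close>

datatype label = LA int | LB nat nat | LC "nat set" "nat set"

lemma sum_mset_sum_swap:
  "(\<Sum>l\<in>#L. \<Sum>c\<in>C. f l c) = (\<Sum>c\<in>C. \<Sum>l\<in>#L. (f l c :: int))"
  by (induction L) (auto simp: sum.distrib)

lemma sum_mset_subtractf: "(\<Sum>l\<in>#L. f l - g l) = (\<Sum>l\<in>#L. f l) - (\<Sum>l\<in>#L. (g l :: int))"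
  by (induction L) auto

lemma sum_mset_partition:
  assumes "finite T" "\<And>l. l \<in># L \<Longrightarrow> slot l \<in> T"
  shows "(\<Sum>l\<in>#L. (g l :: 'b :: comm_monoid_add)) = (\<Sum>\<sigma>\<in>T. \<Sum>l\<in>#filter_mset (\<lambda>l. slot l = \<sigma>) L. g l)"
  using assms(2)
proof (induction L)
  case (add x L)
  have "(\<Sum>\<sigma>\<in>T. \<Sum>l\<in>#filter_mset (\<lambda>l. slot l = \<sigma>) (add_mset x L). g l) =
      (\<Sum>\<sigma>\<in>T. (if \<sigma> = slot x then g x else 0) + (\<Sum>l\<in>#filter_mset (\<lambda>l. slot l = \<sigma>) L. g l))"
    by (intro sum.cong) auto
  also have "\<dots> = g x + (\<Sum>l\<in>#L. g l)" using add assms(1) by (simp add: sum.distrib sum.delta)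
  finally show ?case by simp
qed simp

text \<open>Different labels may have the same number, so a multiset of numbers is lifted to labels
  by choice.\<close>

lemma ex_preimage_mset:
  assumes "set_mset M \<subseteq> f ` A" shows "\<exists>L. set_mset L \<subseteq> A \<and> image_mset f L = M"
  using assms
proof (induction M)
  case (add x M)
  then obtain L a where "set_mset L \<subseteq> A" "image_mset f L = M" "a \<in> A" "x = f a" by auto
  then show ?case by (intro exI[of _ "add_mset a L"]) auto
qed simp

definition small_sets :: "nat \<Rightarrow> nat \<Rightarrow> nat set set" where
  "small_sets r k = {U. U \<subseteq> {1..k} \<and> card U \<le> r}"

definition code :: "nat \<Rightarrow> nat \<Rightarrow> nat set \<Rightarrow> nat" where
  "code r Z U = (\<Sum>a<r. pad r U ! a * Z ^ a)"

text \<open>Blocks of width \<open>Z ^ r\<close>, numbered 0, 1, \<open>a + 2\<close> and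
  \<open>r + 2\<close>; within a block the place is \<open>code\<close> or \<open>i\<close>.
  \<open>CW\<close> has the exponent 0, where the target 1 is read off.\<close>

fun coord_pos :: "nat \<Rightarrow> nat \<Rightarrow> coord \<Rightarrow> nat" where
  "coord_pos r Z CW = 0"
| "coord_pos r Z (CS U) = Z ^ r + code r Z U"
| "coord_pos r Z (CE U a) = Z ^ r * (a + 2) + code r Z U"
| "coord_pos r Z (CV i) = Z ^ r * (r + 2) + i"

definition coords :: "nat \<Rightarrow> nat \<Rightarrow> coord set" where
  "coords r k = insert CW (CS ` small_sets r k \<union> CV ` {1..k} \<union> (\<lambda>(U, a). CE U a) ` (small_sets r k \<times> {..<r}))"

text \<open>\<open>LA v\<close> fixes the value \<open>v\<close>, \<open>LB i x\<close> names
  \<open>x\<close> as element number \<open>i\<close>, and \<open>LC U X\<close> names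
  \<open>X\<close> as the part with indices \<open>U\<close>. At \<open>CW\<close>, the digit
  \<open>1 - v\<close> and the weights add up to 1 iff the weights add up to \<open>v\<close>. At
  \<open>CE U a\<close>, the entry of \<open>X\<close> meets \<open>- x\<close> for the index at
  place \<open>a\<close>; a padding place matches no index and has entry 0 on both sides.\<close>

fun coef :: "nat \<Rightarrow> (nat set \<Rightarrow> int) \<Rightarrow> label \<Rightarrow> coord \<Rightarrow> int" where
  "coef r w (LA v) c = (case c of CW \<Rightarrow> 1 - v | CS U \<Rightarrow> - 1 | CV i \<Rightarrow> - 1 | CE U a \<Rightarrow> 0)"
| "coef r w (LB i x) c = (case c of CV j \<Rightarrow> of_bool (j = i)
    | CE U a \<Rightarrow> if pad r U ! a = i then - int x else 0 | _ \<Rightarrow> 0)"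
| "coef r w (LC U X) c = (case c of CW \<Rightarrow> w X | CS V \<Rightarrow> of_bool (V = U)
    | CE V a \<Rightarrow> if V = U then int (pad r X ! a) else 0 | CV i \<Rightarrow> 0)"

definition label_val :: "nat \<Rightarrow> nat \<Rightarrow> nat \<Rightarrow> (nat set \<Rightarrow> int) \<Rightarrow> int \<Rightarrow> label \<Rightarrow> int" where
  "label_val r k Z w B l = (\<Sum>c\<in>coords r k. coef r w l c * B ^ coord_pos r Z c)"

text \<open>\<open>LB\<close> admits every \<open>x < Z\<close>. That \<open>x\<close> belongs to
  \<open>I\<close> follows from the index sets \<open>{i}\<close>, as the labels \<open>LC\<close>
  range over subsets of \<open>I\<close> only.\<close>

definition labels :: "nat \<Rightarrow> nat \<Rightarrow> nat \<Rightarrow> nat set \<Rightarrow> int set \<Rightarrow> label set" where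
  "labels r k Z I Good = LA ` Good \<union> {LB i x | i x. i \<in> {1..k} \<and> x < Z} \<union>
    {LC U X | U X. U \<in> small_sets r k \<and> X \<subseteq> I \<and> card X = card U}"

fun label_slot :: "label \<Rightarrow> coord" where
  "label_slot (LA v) = CW"
| "label_slot (LB i x) = CV i"
| "label_slot (LC U X) = CS U"

definition slots :: "nat \<Rightarrow> nat \<Rightarrow> coord set" where
  "slots r k = insert CW (CS ` small_sets r k \<union> CV ` {1..k})"

lemma finite_small_sets [simp]: "finite (small_sets r k)"
  by (rule finite_subset[of _ "Pow {1..k}"]) (auto simp: small_sets_def)

lemma small_setsD: "U \<in> small_sets r k \<Longrightarrow> finite U \<and> card U \<le> r \<and> U \<subseteq> {1..k} \<and> 0 \<notin> U"
  by (auto simp: small_sets_def intro: finite_subset)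

lemma finite_coords [simp]: "finite (coords r k)" and finite_slots [simp]: "finite (slots r k)"
  by (auto simp: coords_def slots_def)

lemma sum_slots:
  "(\<Sum>\<sigma>\<in>slots r k. f \<sigma>) = f CW + (\<Sum>U\<in>small_sets r k. f (CS U)) + (\<Sum>i=1..k. (f (CV i) :: 'a :: comm_monoid_add))"
proof -
  have "(\<Sum>\<sigma>\<in>slots r k. f \<sigma>) = f CW + (\<Sum>\<sigma>\<in>CS ` small_sets r k \<union> CV ` {1..k}. f \<sigma>)"
    unfolding slots_def by (subst sum.insert) auto
  also have "(\<Sum>\<sigma>\<in>CS ` small_sets r k \<union> CV ` {1..k}. f \<sigma>) = sum f (CS ` small_sets r k) + sum f (CV ` {1..k})"
    by (intro sum.union_disjoint) auto
  finally show ?thesis by (simp add: sum.reindex inj_on_def add.assoc)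
qed

lemma sum_coords:
  "(\<Sum>c\<in>coords r k. f c) = f CW + (\<Sum>U\<in>small_sets r k. f (CS U)) + (\<Sum>i=1..k. f (CV i)) +
    (\<Sum>U\<in>small_sets r k. \<Sum>a<r. (f (CE U a) :: 'a :: comm_monoid_add))"
proof -
  have "coords r k = slots r k \<union> (\<lambda>(U, a). CE U a) ` (small_sets r k \<times> {..<r})"
    by (auto simp: coords_def slots_def)
  then have "(\<Sum>c\<in>coords r k. f c) = sum f (slots r k) + sum f ((\<lambda>(U, a). CE U a) ` (small_sets r k \<times> {..<r}))"
    by (simp, intro sum.union_disjoint) (auto simp: slots_def)
  also have "sum f ((\<lambda>(U, a). CE U a) ` (small_sets r k \<times> {..<r})) = (\<Sum>U\<in>small_sets r k. \<Sum>a<r. f (CE U a))"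
    by (subst sum.reindex) (auto simp: inj_on_def sum.cartesian_product intro!: sum.cong)
  finally show ?thesis by (simp add: sum_slots)
qed

text \<open>\<open>Q\<close> bounds all digits of all numbers. With at most
  \<open>card (slots r k)\<close> summands, the digit sums stay below \<open>B\<close> even after
  the digit 1 of the target has been subtracted. \<open>2 \<le> r\<close> makes the index sets
  \<open>{i, j}\<close> available.\<close>

locale gadget =
  fixes r k Z :: nat and Q B :: int and I :: "nat set" and w :: "nat set \<Rightarrow> int" and Good :: "int set"
  assumes r: "2 \<le> r" and k: "k < Z" and I: "I \<subseteq> {1..<Z}"
    and Good: "\<And>v. v \<in> Good \<Longrightarrow> 0 \<le> v \<and> v \<le> Q"
    and w: "\<And>X. X \<subseteq> I \<Longrightarrow> card X \<le> r \<Longrightarrow> \<bar>w X\<bar> \<le> Q"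
    and ZQ: "int Z \<le> Q"
    and B: "int (card (slots r k)) * Q + 1 < B"
begin

abbreviation "SS \<equiv> small_sets r k"

lemma finite_I: "finite I" using I by (rule finite_subset) simp

lemma pad_less:
  assumes "U \<in> SS" "a < r" shows "pad r U ! a \<le> k"
proof -
  have "pad r U ! a \<in> set (pad r U)" using assms small_setsD[of U r k] by (intro nth_mem) (simp add: length_pad)
  then show ?thesis using set_pad(1)[of U r] small_setsD[OF assms(1)] by fastforce
qed

lemma pad_less_I:
  assumes "X \<subseteq> I" "card X \<le> r" "a < r" shows "pad r X ! a < Z"
proof -
  have fin: "finite X" using assms(1) finite_I by (rule finite_subset)
  then have "pad r X ! a \<in> set (pad r X)" using assms by (intro nth_mem) (simp add: length_pad)
  then show ?thesis using set_pad(1)[OF fin] assms I k by fastforce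
qed

lemma code_less: "U \<in> SS \<Longrightarrow> code r Z U < Z ^ r"
  unfolding code_def using pad_less k by (intro digit_sum_less) (meson le_less_trans)

lemma code_inj:
  assumes "U \<in> SS" "V \<in> SS" "code r Z U = code r Z V" shows "U = V"
proof -
  have "pad r U ! a = pad r V ! a" if "a < r" for a
    using assms(3) pad_less[OF assms(1)] pad_less[OF assms(2)] k that unfolding code_def
    by (intro digit_sum_inj[of r "\<lambda>a. pad r U ! a" Z "\<lambda>a. pad r V ! a"]) (auto intro: le_less_trans)
  then have "pad r U = pad r V"
    using assms small_setsD by (intro nth_equalityI) (auto simp: length_pad)
  then show ?thesis using assms small_setsD by (intro pad_inj) auto
qed

text \<open>All places are below \<open>Z ^ r\<close>, so quotient and remainder by
  \<open>Z ^ r\<close> recover block and place.\<close>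

lemma coord_pos_inj: "inj_on (coord_pos r Z) (coords r k)"
proof -
  define hd where "hd c = (case c of CW \<Rightarrow> 0 | CS U \<Rightarrow> 1 | CE U a \<Rightarrow> a + 2 | CV i \<Rightarrow> r + 2)" for c
  define tl where "tl c = (case c of CW \<Rightarrow> 0 | CS U \<Rightarrow> code r Z U | CE U a \<Rightarrow> code r Z U | CV i \<Rightarrow> i)" for c
  have pos: "coord_pos r Z c = Z ^ r * hd c + tl c" for c by (cases c) (auto simp: hd_def tl_def)
  have "Z ^ 1 \<le> Z ^ r" using r k by (intro power_increasing) auto
  then have "k < Z ^ r" using k by simp
  then have tl: "tl c < Z ^ r" if "c \<in> coords r k" for c
    using that code_less k by (auto simp: coords_def tl_def)
  show ?thesis
  proof (rule inj_onI)
    fix c d assume cd: "c \<in> coords r k" "d \<in> coords r k" "coord_pos r Z c = coord_pos r Z d"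
    have "hd c = coord_pos r Z c div Z ^ r" "tl c = coord_pos r Z c mod Z ^ r"
      "hd d = coord_pos r Z d div Z ^ r" "tl d = coord_pos r Z d mod Z ^ r"
      using tl[OF cd(1)] tl[OF cd(2)] k unfolding pos by simp_all
    then have "hd c = hd d" "tl c = tl d" using cd(3) by auto
    then show "c = d" using cd by (auto simp: coords_def hd_def tl_def dest: code_inj)
  qed
qed

lemma abs_coef:
  assumes "l \<in> labels r k Z I Good" "c \<in> coords r k" shows "\<bar>coef r w l c\<bar> \<le> Q"
proof -
  have Q: "1 \<le> Q" using k ZQ by linarith
  show ?thesis
  proof (cases l)
    case (LA v)
    then show ?thesis using Good[of v] Q assms by (auto simp: labels_def split: coord.split)
  next
    case (LB i x)
    then show ?thesis using ZQ Q assms by (auto simp: labels_def split: coord.split)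
  next
    case (LC U X)
    then have X: "X \<subseteq> I" "card X \<le> r" using assms small_setsD[of U r k] by (auto simp: labels_def)
    show ?thesis using LC w[OF X] pad_less_I[OF X] ZQ Q assms
      by (fastforce simp: coords_def split: coord.split)
  qed
qed

lemma sum_label_val: "(\<Sum>l\<in>#L. label_val r k Z w B l) = (\<Sum>c\<in>coords r k. (\<Sum>l\<in>#L. coef r w l c) * B ^ coord_pos r Z c)"
  unfolding label_val_def sum_mset_sum_swap by (simp add: sum_mset_distrib_right)

lemma abs_sum_coef:
  assumes "set_mset L \<subseteq> labels r k Z I Good" "c \<in> coords r k"
  shows "\<bar>\<Sum>l\<in>#L. coef r w l c\<bar> \<le> int (size L) * Q"
  using assms(1)
proof (induction L)
  case (add l L)
  then show ?case using abs_coef[of l c] assms(2) by (simp add: algebra_simps)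
qed simp

lemma card_slots: "card (slots r k) = 1 + card SS + k"
  using sum_slots[of "\<lambda>_. 1 :: nat" r k] by simp

text \<open>Comparison with the digits of 1 gives digit sum 1 at \<open>CW\<close> and 0 elsewhere.
  At a counting coordinate this says that its labels are as many as the labels \<open>LA\<close>. So
  the size is \<open>card (slots r k)\<close> times this number, which the size bound limits to 1
  and the nonzero sum keeps from being 0.\<close>

lemma slots_of_solution:
  assumes L: "set_mset L \<subseteq> labels r k Z I Good" "size L \<le> card (slots r k)"
    and one: "(\<Sum>l\<in>#L. label_val r k Z w B l) = 1"
  shows "\<exists>lab. (\<forall>\<sigma>\<in>slots r k. lab \<sigma> \<in># L \<and> label_slot (lab \<sigma>) = \<sigma>) \<and>
    (\<forall>c\<in>coords r k. (\<Sum>\<sigma>\<in>slots r k. coef r w (lab \<sigma>) c) = of_bool (c = CW))"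
proof -
  define s where "s c = (\<Sum>l\<in>#L. coef r w l c)" for c
  define n where "n \<sigma> = size (filter_mset (\<lambda>l. label_slot l = \<sigma>) L)" for \<sigma>
  have Q: "0 \<le> Q" using k ZQ by linarith
  have sl: "label_slot l \<in> slots r k" if "l \<in># L" for l
  proof -
    have "l \<in> labels r k Z I Good" using that L by auto
    then show ?thesis by (auto simp: labels_def slots_def)
  qed
  have CW: "CW \<in> coords r k" by (simp add: coords_def)
  \<comment> \<open>The target has an expansion of its own, with the digit 1 at \<open>CW\<close>
    only; subtracting it leaves an expansion of 0.\<close>
  have "(\<Sum>c\<in>coords r k. of_bool (c = CW) * B ^ coord_pos r Z c) = 1"
    using CW by (simp add: of_bool_def if_distrib[of "\<lambda>x. x * _"] sum.delta cong: if_cong)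
  then have "(\<Sum>c\<in>coords r k. (s c - of_bool (c = CW)) * B ^ coord_pos r Z c) = 0"
    using one unfolding sum_label_val s_def[symmetric] by (simp add: left_diff_distrib sum_subtractf)
  moreover have "\<bar>s c - of_bool (c = CW)\<bar> < B" if "c \<in> coords r k" for c
  proof -
    have "\<bar>s c\<bar> \<le> int (size L) * Q" unfolding s_def by (rule abs_sum_coef[OF L(1) that])
    also have "\<dots> \<le> int (card (slots r k)) * Q" using L(2) Q by (intro mult_right_mono) auto
    finally show ?thesis using B by (auto simp: of_bool_def)
  qed
  ultimately have "s c - of_bool (c = CW) = 0" if "c \<in> coords r k" for c
    by (rule base_expansion_eq_0[OF finite_coords coord_pos_inj _ _ that, rotated])
  then have s: "s c = of_bool (c = CW)" if "c \<in> coords r k" for c using that by simp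
  have count: "(\<Sum>l\<in>#K. (if P l then 1 else 0 :: int)) = int (size (filter_mset P K))" for P and K :: "label multiset"
    by (induction K) auto
  have nS: "n \<sigma> = n CW" if "\<sigma> \<in> slots r k" for \<sigma>
  proof (cases "\<sigma> = CW")
    case False
    then have "\<sigma> \<in> coords r k" using that by (auto simp: slots_def coords_def)
    then have s0: "s \<sigma> = 0" using s False by simp
    \<comment> \<open>A counting coordinate receives +1 from its own labels, -1 from every
      \<open>LA\<close>, and 0 from all others.\<close>
    have eq: "coef r w l \<sigma> = (if label_slot l = \<sigma> then 1 else 0) - (if label_slot l = CW then 1 else 0)" for l
      using False that unfolding slots_def by (cases l) (elim insertE UnE imageE; simp; blast)+
    have "s \<sigma> = (\<Sum>l\<in>#L. (if label_slot l = \<sigma> then 1 else 0)) - (\<Sum>l\<in>#L. (if label_slot l = CW then 1 else 0))"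
      unfolding s_def eq by (rule sum_mset_subtractf)
    also have "\<dots> = int (n \<sigma>) - int (n CW)" unfolding count n_def ..
    finally show ?thesis using s0 by simp
  qed simp
  have "size L = (\<Sum>\<sigma>\<in>slots r k. n \<sigma>)"
    unfolding n_def size_eq_sum_mset by (rule sum_mset_partition) (simp_all add: sl)
  also have "\<dots> = card (slots r k) * n CW" using nS by simp
  finally have sz: "size L = card (slots r k) * n CW" .
  \<comment> \<open>Here the target 1 matters: for target 0 the empty choice would be a
    solution.\<close>
  have "n CW \<noteq> 0"
  proof
    assume "n CW = 0"
    then have "L = {#}" using sz by simp
    then show False using s[OF CW] by (simp add: s_def)
  qed
  moreover have "n CW \<le> 1"
  proof -
    have "card (slots r k) * n CW \<le> card (slots r k) * 1" using sz L(2) by simp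
    moreover have "0 < card (slots r k)" by (simp add: card_slots)
    ultimately show ?thesis by (simp only: mult_le_cancel1)
  qed
  ultimately have n1: "n \<sigma> = 1" if "\<sigma> \<in> slots r k" for \<sigma> using nS[OF that] by linarith
  have "\<forall>\<sigma>\<in>slots r k. \<exists>l. filter_mset (\<lambda>l. label_slot l = \<sigma>) L = {#l#}"
    using n1 unfolding n_def by (intro ballI size_1_singleton_mset) blast
  from bchoice[OF this] obtain lab where
    lab: "\<And>\<sigma>. \<sigma> \<in> slots r k \<Longrightarrow> filter_mset (\<lambda>l. label_slot l = \<sigma>) L = {#lab \<sigma>#}" by blast
  have "lab \<sigma> \<in># L \<and> label_slot (lab \<sigma>) = \<sigma>" if "\<sigma> \<in> slots r k" for \<sigma>
  proof -
    have "lab \<sigma> \<in># filter_mset (\<lambda>l. label_slot l = \<sigma>) L" using lab[OF that] by simp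
    then show ?thesis by simp
  qed
  moreover have "(\<Sum>\<sigma>\<in>slots r k. coef r w (lab \<sigma>) c) = of_bool (c = CW)" if "c \<in> coords r k" for c
    using s[OF that] sum_mset_partition[of "slots r k" L label_slot "\<lambda>l. coef r w l c"] sl lab
    unfolding s_def by simp
  ultimately show ?thesis by blast
qed

section \<open>Increasing enumerations and padded lists\<close>

lemma sorted_list_of_set_strict_mono:
  fixes x :: "nat \<Rightarrow> nat"
  assumes "finite U" "strict_mono_on U x"
  shows "sorted_list_of_set (x ` U) = map x (sorted_list_of_set U)"
proof (rule strict_sorted_equal)
  show "sorted_wrt (<) (map x (sorted_list_of_set U))"
    unfolding sorted_wrt_map using assms
    by (intro sorted_wrt_mono_rel[OF _ strict_sorted_list_of_set[of U]]) (auto dest: strict_mono_onD)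
qed (use assms in auto)

lemma nth_pad_image:
  assumes "U \<in> SS" "strict_mono_on U x" "a < r"
  shows "pad r (x ` U) ! a = (if pad r U ! a = 0 then 0 else x (pad r U ! a))"
proof -
  have U: "finite U" "card U \<le> r" "0 \<notin> U" using small_setsD[OF assms(1)] by auto
  have c: "card (x ` U) = card U" using assms(2) by (simp add: card_image strict_mono_on_imp_inj_on)
  show ?thesis
  proof (cases "a < r - card U")
    case True
    then show ?thesis by (simp add: pad_def c nth_append)
  next
    case False
    have "sorted_list_of_set U ! (a - (r - card U)) \<in> set (sorted_list_of_set U)"
      using False assms(3) U by (intro nth_mem) simp
    then have "sorted_list_of_set U ! (a - (r - card U)) \<noteq> 0" using U by (metis set_sorted_list_of_set)
    then show ?thesis using False assms(3) U
      by (simp add: pad_def c nth_append sorted_list_of_set_strict_mono[OF U(1) assms(2)])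
  qed
qed

text \<open>Index sets are in bijection with the small subsets of the enumerated set; this turns the
  Moebius expansion into a sum over slots.\<close>

lemma sum_small_subsets:
  fixes x :: "nat \<Rightarrow> nat"
  assumes "strict_mono_on {1..k} x"
  shows "(\<Sum>X | X \<subseteq> x ` {1..k} \<and> card X \<le> r. f X) = (\<Sum>U\<in>SS. (f (x ` U) :: int))"
proof -
  have inj: "inj_on x {1..k}" using assms by (rule strict_mono_on_imp_inj_on)
  have "{X. X \<subseteq> x ` {1..k} \<and> card X \<le> r} = (`) x ` SS"
  proof (intro equalityI subsetI)
    fix X assume X: "X \<in> {X. X \<subseteq> x ` {1..k} \<and> card X \<le> r}"
    then obtain U where "U \<subseteq> {1..k}" "X = x ` U" by (auto simp: subset_image_iff)
    with X show "X \<in> (`) x ` SS"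
      using card_image[OF inj_on_subset[OF inj]] by (auto simp: small_sets_def)
  next
    fix X assume "X \<in> (`) x ` SS"
    then show "X \<in> {X. X \<subseteq> x ` {1..k} \<and> card X \<le> r}"
      using card_image[OF inj_on_subset[OF inj]] by (auto simp: small_sets_def)
  qed
  moreover have "inj_on ((`) x) SS"
    using inj_on_image_Pow[OF inj] by (rule inj_on_subset) (auto simp: small_sets_def)
  ultimately show ?thesis by (simp add: sum.reindex)
qed

text \<open>The labels in the slots \<open>CV i\<close> of a solution give a sequence
  \<open>x\<close>, and the coordinates \<open>CE\<close> force the label in \<open>CS U\<close> to
  name the image of \<open>U\<close>. Then \<open>CW\<close> says that the weights of the small
  subsets of the range of \<open>x\<close> add up to a value in \<open>Good\<close>. Conversely, the
  increasing enumeration of \<open>S\<close> provides one label for each slot.\<close>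

theorem solvable_iff:
  assumes "set xs = label_val r k Z w B ` labels r k Z I Good"
  shows "(\<exists>M. set_mset M \<subseteq> set xs \<and> size M \<le> card (slots r k) \<and> \<Sum>\<^sub># M = 1) \<longleftrightarrow>
    (\<exists>S\<subseteq>I. card S = k \<and> (\<Sum>X | X \<subseteq> S \<and> card X \<le> r. w X) \<in> Good)"
proof
  assume "\<exists>M. set_mset M \<subseteq> set xs \<and> size M \<le> card (slots r k) \<and> \<Sum>\<^sub># M = 1"
  then obtain M where M: "set_mset M \<subseteq> label_val r k Z w B ` labels r k Z I Good" "size M \<le> card (slots r k)" "\<Sum>\<^sub># M = 1"
    using assms by auto
  from ex_preimage_mset[OF M(1)] obtain L where L: "set_mset L \<subseteq> labels r k Z I Good"
    "image_mset (label_val r k Z w B) L = M" by blast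
  then have "size L \<le> card (slots r k)" "(\<Sum>l\<in>#L. label_val r k Z w B l) = 1" using M by auto
  from slots_of_solution[OF L(1) this] obtain lab where
    lab': "\<forall>\<sigma>\<in>slots r k. lab \<sigma> \<in># L \<and> label_slot (lab \<sigma>) = \<sigma>"
    and sum': "\<forall>c\<in>coords r k. (\<Sum>\<sigma>\<in>slots r k. coef r w (lab \<sigma>) c) = of_bool (c = CW)" by blast
  have lab: "lab \<sigma> \<in> labels r k Z I Good" "label_slot (lab \<sigma>) = \<sigma>" if "\<sigma> \<in> slots r k" for \<sigma>
    using lab'[rule_format, OF that] L(1) by blast+
  have sum: "(\<Sum>\<sigma>\<in>slots r k. coef r w (lab \<sigma>) c) = of_bool (c = CW)" if "c \<in> coords r k" for c
    using sum'[rule_format, OF that] .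
  have "CW \<in> slots r k" by (simp add: slots_def)
  from lab[OF this] have "\<exists>v. lab CW = LA v \<and> v \<in> Good" by (cases "lab CW") (auto simp: labels_def)
  then obtain v where v: "lab CW = LA v" "v \<in> Good" by blast
  have "\<forall>i\<in>{1..k}. \<exists>x. lab (CV i) = LB i x"
  proof
    fix i assume "i \<in> {1..k}"
    then have "CV i \<in> slots r k" by (simp add: slots_def)
    from lab(2)[OF this] show "\<exists>x. lab (CV i) = LB i x" by (cases "lab (CV i)") auto
  qed
  from bchoice[OF this] obtain x where x: "\<And>i. i \<in> {1..k} \<Longrightarrow> lab (CV i) = LB i (x i)" by blast
  have "\<forall>U\<in>SS. \<exists>X. lab (CS U) = LC U X \<and> X \<subseteq> I \<and> card X = card U"
  proof
    fix U assume "U \<in> SS"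
    then have "CS U \<in> slots r k" by (simp add: slots_def)
    from lab[OF this] show "\<exists>X. lab (CS U) = LC U X \<and> X \<subseteq> I \<and> card X = card U"
      by (cases "lab (CS U)") (auto simp: labels_def)
  qed
  from bchoice[OF this] obtain X where X: "\<And>U. U \<in> SS \<Longrightarrow> lab (CS U) = LC U (X U)" "\<And>U. U \<in> SS \<Longrightarrow> X U \<subseteq> I"
    "\<And>U. U \<in> SS \<Longrightarrow> card (X U) = card U" by blast
  have total: "(\<Sum>\<sigma>\<in>slots r k. coef r w (lab \<sigma>) c) =
      coef r w (LA v) c + (\<Sum>U\<in>SS. coef r w (LC U (X U)) c) + (\<Sum>i=1..k. coef r w (LB i (x i)) c)" for c
    unfolding sum_slots using v x X(1) by simp
  \<comment> \<open>At \<open>CE U a\<close> only the label in \<open>CS U\<close> and the label for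
    the index at place \<open>a\<close> contribute.\<close>
  have agree: "pad r (X U) ! a = x (pad r U ! a)" if U: "U \<in> SS" and a: "a < r" and nz: "pad r U ! a \<noteq> 0" for U a
  proof -
    have "CE U a \<in> coords r k" using U a by (auto simp: coords_def)
    then have "0 = (\<Sum>V\<in>SS. if U = V then int (pad r (X V) ! a) else 0) + (\<Sum>i=1..k. if pad r U ! a = i then - int (x i) else 0)"
      using sum[of "CE U a"] unfolding total by simp
    also have "\<dots> = int (pad r (X U) ! a) - int (x (pad r U ! a))"
      using U nz pad_less[OF U a] by (simp add: sum.delta)
    finally show ?thesis by simp
  qed
  have fin: "finite (X U)" if "U \<in> SS" for U using X(2)[OF that] finite_I by (rule finite_subset)
  \<comment> \<open>Equal cardinality makes the paddings of \<open>X U\<close> and \<open>U\<close>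
    equally long, so beyond them \<open>agree\<close> compares the two sorted lists entry by
    entry.\<close>
  have XU: "sorted_list_of_set (X U) = map x (sorted_list_of_set U)" if U: "U \<in> SS" for U
  proof (rule nth_equalityI)
    have fU: "finite U" "card U \<le> r" "0 \<notin> U" using small_setsD[OF U] by auto
    show "length (sorted_list_of_set (X U)) = length (map x (sorted_list_of_set U))"
      using X(3)[OF U] by simp
    fix j assume "j < length (sorted_list_of_set (X U))"
    then have j: "j < card U" using X(3)[OF U] by simp
    have p: "pad r U ! (r - card U + j) = sorted_list_of_set U ! j" "pad r (X U) ! (r - card U + j) = sorted_list_of_set (X U) ! j"
      by (simp_all add: pad_def nth_append X(3)[OF U])
    have "sorted_list_of_set U ! j \<in> set (sorted_list_of_set U)" using j fU by (intro nth_mem) simp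
    then have "sorted_list_of_set U ! j \<noteq> 0" using fU by (metis set_sorted_list_of_set)
    then show "sorted_list_of_set (X U) ! j = map x (sorted_list_of_set U) ! j"
      using agree[OF U, of "r - card U + j"] p j fU by simp
  qed
  have X_image: "X U = x ` U" if "U \<in> SS" for U
    using arg_cong[OF XU[OF that], of set] fin[OF that] small_setsD[OF that] by simp
  \<comment> \<open>For a pair, the sorted list of the chosen set is \<open>[x i, x j]\<close>, and
    sorted lists of sets increase strictly. So no element is named twice and the range of
    \<open>x\<close> has exactly \<open>k\<close> elements.\<close>
  have mono: "strict_mono_on {1..k} x"
  proof (rule strict_mono_onI)
    fix i j assume ij: "i \<in> {1..k}" "j \<in> {1..k}" "i < j"
    then have U: "{i, j} \<in> SS" using r by (auto simp: small_sets_def)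
    have "sorted_list_of_set {i, j} = [i, j]" using ij by simp
    then have "sorted_list_of_set (X {i, j}) = [x i, x j]" using XU[OF U] by simp
    moreover have "sorted_wrt (<) (sorted_list_of_set (X {i, j}))" by simp
    ultimately show "x i < x j" by simp
  qed
  have xI: "x i \<in> I" if "i \<in> {1..k}" for i
  proof -
    have "{i} \<in> SS" using that r by (auto simp: small_sets_def)
    then show ?thesis using X(2)[of "{i}"] X_image[of "{i}"] by auto
  qed
  have "CW \<in> coords r k" by (simp add: coords_def)
  then have "1 = 1 - v + (\<Sum>U\<in>SS. w (X U))" using sum[of CW] unfolding total by simp
  also have "(\<Sum>U\<in>SS. w (X U)) = (\<Sum>X | X \<subseteq> x ` {1..k} \<and> card X \<le> r. w X)"
    unfolding sum_small_subsets[OF mono] using X_image by simp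
  finally have "(\<Sum>X | X \<subseteq> x ` {1..k} \<and> card X \<le> r. w X) = v" by simp
  moreover have "card (x ` {1..k}) = k" using strict_mono_on_imp_inj_on[OF mono] by (simp add: card_image)
  ultimately show "\<exists>S\<subseteq>I. card S = k \<and> (\<Sum>X | X \<subseteq> S \<and> card X \<le> r. w X) \<in> Good"
    using v(2) xI by (intro exI[of _ "x ` {1..k}"]) auto
next
  assume "\<exists>S\<subseteq>I. card S = k \<and> (\<Sum>X | X \<subseteq> S \<and> card X \<le> r. w X) \<in> Good"
  then obtain S where S: "S \<subseteq> I" "card S = k" "(\<Sum>X | X \<subseteq> S \<and> card X \<le> r. w X) \<in> Good" by blast
  have fin: "finite S" using S(1) finite_I by (rule finite_subset)
  define v where "v = (\<Sum>X | X \<subseteq> S \<and> card X \<le> r. w X)"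
  \<comment> \<open>Indices start at 1, positions in a list at 0.\<close>
  define x where "x i = sorted_list_of_set S ! (i - 1)" for i
  have len: "length (sorted_list_of_set S) = k" using S(2) by simp
  have mono: "strict_mono_on {1..k} x"
  proof (rule strict_mono_onI)
    fix i j assume "i \<in> {1..k}" "j \<in> {1..k}" "i < j"
    then show "x i < x j" unfolding x_def
      using sorted_wrt_nth_less[OF strict_sorted_list_of_set[of S], of "i - 1" "j - 1"] len by simp
  qed
  have img: "x ` {1..k} = S"
  proof -
    have "x ` {1..k} = (\<lambda>i. sorted_list_of_set S ! i) ` {..<k}"
      unfolding image_Suc_lessThan[symmetric] image_image x_def by simp
    also have "\<dots> = set (sorted_list_of_set S)" using len by (auto simp: set_conv_nth simp del: set_sorted_list_of_set)
    finally show ?thesis using fin by simp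
  qed
  \<comment> \<open>\<open>CE\<close> is not a slot, so the value in its case is a dummy.\<close>
  define lab where "lab \<sigma> = (case \<sigma> of CW \<Rightarrow> LA v | CV i \<Rightarrow> LB i (x i) | CS U \<Rightarrow> LC U (x ` U) | CE U a \<Rightarrow> LA v)" for \<sigma>
  have monoU: "strict_mono_on U x" if "U \<in> SS" for U
    using mono small_setsD[OF that] by (meson monotone_on_subset)
  have xZ: "x i < Z" if "i \<in> {1..k}" for i using that img S(1) I by fastforce
  have lab: "lab \<sigma> \<in> labels r k Z I Good" if "\<sigma> \<in> slots r k" for \<sigma>
  proof -
    have "x ` U \<subseteq> I \<and> card (x ` U) = card U" if "U \<in> SS" for U
      using card_image[OF strict_mono_on_imp_inj_on[OF monoU[OF that]]] small_setsD[OF that] img S(1) by auto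
    then show ?thesis using that xZ S(3) by (auto simp: slots_def labels_def lab_def v_def)
  qed
  let ?L = "image_mset lab (mset_set (slots r k))"
  have sum: "(\<Sum>l\<in>#?L. coef r w l c) =
      coef r w (LA v) c + (\<Sum>U\<in>SS. coef r w (LC U (x ` U)) c) + (\<Sum>i=1..k. coef r w (LB i (x i)) c)" for c
  proof -
    have "(\<Sum>l\<in>#?L. coef r w l c) = (\<Sum>\<sigma>\<in>slots r k. coef r w (lab \<sigma>) c)"
      by (simp add: sum_unfold_sum_mset image_mset.compositionality comp_def)
    then show ?thesis unfolding sum_slots by (simp add: lab_def)
  qed
  have "(\<Sum>l\<in>#?L. coef r w l c) = of_bool (c = CW)" if c: "c \<in> coords r k" for c
  proof -
    consider "c = CW" | U where "c = CS U" "U \<in> SS" | i where "c = CV i" "i \<in> {1..k}"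
      | U a where "c = CE U a" "U \<in> SS" "a < r" using c by (auto simp: coords_def)
    then show ?thesis
    proof cases
      case 1
      then show ?thesis unfolding sum using sum_small_subsets[OF mono, of w] unfolding img by (simp add: v_def)
    next
      case (2 U)
      then show ?thesis unfolding sum by (simp add: of_bool_def sum.delta)
    next
      case (3 i)
      then show ?thesis unfolding sum by (simp add: of_bool_def sum.delta)
    next
      case (4 U a)
      then have "(\<Sum>i=1..k. coef r w (LB i (x i)) c) = - int (pad r (x ` U) ! a)"
        using pad_less[OF 4(2,3)] nth_pad_image[OF 4(2) monoU[OF 4(2)] 4(3)] by (auto simp: sum.delta)
      then show ?thesis unfolding sum using 4 by (simp add: sum.delta)
    qed
  qed
  then have "(\<Sum>l\<in>#?L. label_val r k Z w B l) = (\<Sum>c\<in>coords r k. of_bool (c = CW) * B ^ coord_pos r Z c)"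
    unfolding sum_label_val by (intro sum.cong) auto
  also have "\<dots> = 1"
    by (simp add: of_bool_def if_distrib[of "\<lambda>x. x * _"] sum.delta coords_def cong: if_cong)
  finally have "\<Sum>\<^sub># (image_mset (label_val r k Z w B) ?L) = 1" .
  then show "\<exists>M. set_mset M \<subseteq> set xs \<and> size M \<le> card (slots r k) \<and> \<Sum>\<^sub># M = 1"
    using lab assms by (intro exI[of _ "image_mset (label_val r k Z w B) ?L"]) auto
qed

end

section \<open>Reading a circuit\<close>

text \<open>\<open>VN\<close>, \<open>VK\<close> and \<open>VZ\<close> hold the length of the input,
  the parameter and the loop bound. \<open>NU\<close>, \<open>NA\<close> and \<open>NV\<close>
  (node, argument number, value) are indexed by the remaining depth, so that nested evaluations do
  not overwrite each other. \<open>NJ\<close> and \<open>NX\<close> hold the tuples for an index set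
  and a set of inputs, \<open>NG\<close> the digits of a candidate for \<open>Good\<close>.\<close>

datatype nm = VN | VK | VZ | PP | CC | NB | NI | NY
  | NU nat | NA nat | NV nat | NJ nat | NX nat | NG nat

section \<open>Formulas as expressions that are true when positive\<close>

definition holds :: "int list \<Rightarrow> nat \<Rightarrow> 'v exp \<Rightarrow> ('v \<Rightarrow> int) \<Rightarrow> bool" where
  "holds xs Z e \<rho> \<longleftrightarrow> 0 < ev xs Z e \<rho>"

definition Less :: "'v exp \<Rightarrow> 'v exp \<Rightarrow> 'v exp" where "Less a b = Sub b a"
definition Leq :: "'v exp \<Rightarrow> 'v exp \<Rightarrow> 'v exp" where "Leq a b = Sub (Add b (Cst 1)) a"
definition Conj :: "'v exp \<Rightarrow> 'v exp \<Rightarrow> 'v exp" where "Conj a b = Ite a b (Cst 0)"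
definition Disj :: "'v exp \<Rightarrow> 'v exp \<Rightarrow> 'v exp" where "Disj a b = Ite a (Cst 1) b"
definition Neg :: "'v exp \<Rightarrow> 'v exp" where "Neg a = Ite a (Cst 0) (Cst 1)"
definition Equ :: "'v exp \<Rightarrow> 'v exp \<Rightarrow> 'v exp" where "Equ a b = Conj (Leq a b) (Leq b a)"
definition All :: "'v \<Rightarrow> 'v exp \<Rightarrow> 'v exp" where "All x a = Prd x (Ite a (Cst 1) (Cst 0))"
definition Exi :: "'v \<Rightarrow> 'v exp \<Rightarrow> 'v exp" where "Exi x a = Summ x (Ite a (Cst 1) (Cst 0))"

lemma holds_simps [simp]:
  "holds xs Z (Less a b) \<rho> \<longleftrightarrow> ev xs Z a \<rho> < ev xs Z b \<rho>"
  "holds xs Z (Leq a b) \<rho> \<longleftrightarrow> ev xs Z a \<rho> \<le> ev xs Z b \<rho>"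
  "holds xs Z (Conj a b) \<rho> \<longleftrightarrow> holds xs Z a \<rho> \<and> holds xs Z b \<rho>"
  "holds xs Z (Disj a b) \<rho> \<longleftrightarrow> holds xs Z a \<rho> \<or> holds xs Z b \<rho>"
  "holds xs Z (Neg a) \<rho> \<longleftrightarrow> \<not> holds xs Z a \<rho>"
  "holds xs Z (Equ a b) \<rho> \<longleftrightarrow> ev xs Z a \<rho> = ev xs Z b \<rho>"
  "holds xs Z (Bind x a b) \<rho> \<longleftrightarrow> holds xs Z b (\<rho>(x := ev xs Z a \<rho>))"
  "holds xs Z (Ite c a b) \<rho> \<longleftrightarrow> (if holds xs Z c \<rho> then holds xs Z a \<rho> else holds xs Z b \<rho>)"
  "holds xs Z (Cst i) \<rho> \<longleftrightarrow> 0 < i"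
  by (auto simp: holds_def Less_def Leq_def Conj_def Disj_def Neg_def Equ_def)

lemma holds_All [simp]: "holds xs Z (All x a) \<rho> \<longleftrightarrow> (\<forall>i<Z. holds xs Z a (\<rho>(x := int i)))"
proof -
  have "(\<Prod>i<n. if P i then 1 else 0 :: int) = (if \<forall>i<n. P i then 1 else 0)" for P and n :: nat
    by (induction n) (auto simp: less_Suc_eq)
  then show ?thesis by (simp add: holds_def All_def cong: if_cong)
qed

lemma holds_Exi [simp]: "holds xs Z (Exi x a) \<rho> \<longleftrightarrow> (\<exists>i<Z. holds xs Z a (\<rho>(x := int i)))"
proof -
  have "0 \<le> (\<Sum>i<n. if P i then 1 else 0 :: int) \<and> (0 < (\<Sum>i<n. if P i then 1 else 0 :: int) \<longleftrightarrow> (\<exists>i<n. P i))"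
    for P and n :: nat
    by (induction n) (auto simp: less_Suc_eq)
  then show ?thesis by (simp add: holds_def Exi_def cong: if_cong)
qed

lemma ev_Ite [simp]: "ev xs Z (Ite c a b) \<rho> = (if holds xs Z c \<rho> then ev xs Z a \<rho> else ev xs Z b \<rho>)"
  by (simp add: holds_def)

declare ev.simps(8) [simp del]

text \<open>Total also on malformed input: tags are classified by thresholds, and a position past
  the end stays put. Malformed gates are sorted out by \<open>gate_ok\<close>.\<close>

definition next_gate :: "int list \<Rightarrow> int \<Rightarrow> int" where
  "next_gate xs p = (if int (length xs) \<le> p then p else if lookup xs p \<le> 0 then p + 1
     else if lookup xs p \<le> 1 then p + 2 else p + 2 + lookup xs (p + 1))"

definition gate_start :: "int list \<Rightarrow> nat \<Rightarrow> nat \<Rightarrow> int" where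
  "gate_start xs Z = iter Z (\<lambda>_. next_gate xs)"

text \<open>\<open>Itr\<close> always makes \<open>Z\<close> rounds; the test on \<open>CC\<close>
  freezes the position after as many steps as the value of \<open>x\<close>.\<close>

definition start_exp :: "nm \<Rightarrow> nm exp" where
  "start_exp x = Itr CC PP (Ite (Less (Vr CC) (Vr x))
     (Ite (Leq (Vr VN) (Vr PP)) (Vr PP) (Ite (Leq (Inp (Vr PP)) (Cst 0)) (Add (Vr PP) (Cst 1))
       (Ite (Leq (Inp (Vr PP)) (Cst 1)) (Add (Vr PP) (Cst 2))
         (Add (Add (Vr PP) (Cst 2)) (Inp (Add (Vr PP) (Cst 1)))))))
     (Vr PP))"

text \<open>From round \<open>u\<close> on, each round clamps a position that is already in range,
  which changes nothing.\<close>

lemma ev_start: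
  assumes "\<rho> VN = int (length xs)" "\<rho> x = int u" "u \<le> Z" "x \<notin> {PP, CC}"
  shows "ev xs Z (start_exp x) \<rho> = gate_start xs Z u"
proof -
  have x: "PP \<noteq> x" "CC \<noteq> x" "x \<noteq> PP" "x \<noteq> CC" using assms(4) by auto
  let ?f = "\<lambda>j v. if int j < int u then next_gate xs v else v"
  have "iter Z ?f j = gate_start xs Z (min j u)" for j
  proof (induction j)
    case (Suc j)
    have "clamp Z (gate_start xs Z u) = gate_start xs Z u"
      using iter_bounds[of Z "\<lambda>_. next_gate xs" u] by (simp add: clamp_def gate_start_def)
    with Suc show ?case by (auto simp: gate_start_def min_def not_le le_Suc_eq less_Suc_eq)
  qed (simp add: gate_start_def)
  moreover have "ev xs Z (start_exp x) \<rho> = iter Z ?f Z"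
    unfolding start_exp_def ev.simps(12)
    by (intro arg_cong[where f = "\<lambda>f. iter Z f Z"] ext) (simp add: assms x next_gate_def)
  ultimately show ?thesis using assms(3) by simp
qed

definition gate_ok :: "int list \<Rightarrow> int \<Rightarrow> int \<Rightarrow> bool" where
  "gate_ok xs u p \<longleftrightarrow> lookup xs p = 0 \<or>
    lookup xs p = 1 \<and> p + 1 < int (length xs) \<and> 0 \<le> lookup xs (p + 1) \<and> lookup xs (p + 1) < u \<or>
    (lookup xs p = 2 \<or> lookup xs p = 3) \<and> p + 1 < int (length xs) \<and> 1 \<le> lookup xs (p + 1) \<and>
      p + 1 + lookup xs (p + 1) < int (length xs) \<and>
      (\<forall>a. int a < lookup xs (p + 1) \<longrightarrow> 0 \<le> lookup xs (p + 2 + int a) \<and> lookup xs (p + 2 + int a) < u \<and>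
         (\<forall>b<a. lookup xs (p + 2 + int b) \<noteq> lookup xs (p + 2 + int a)))"

text \<open>A gate takes at least one entry, so \<open>length xs\<close> steps suffice to reach the
  end, where the position then stays. Equality demands that a gate ends exactly with the
  list.\<close>

definition parse_ok :: "int list \<Rightarrow> nat \<Rightarrow> bool" where
  "parse_ok xs Z \<longleftrightarrow> xs \<noteq> [] \<and> gate_start xs Z (length xs) = int (length xs) \<and>
    (\<forall>u<Z. gate_start xs Z u < int (length xs) \<longrightarrow> gate_ok xs (int u) (gate_start xs Z u))"

definition len_exp :: "nm exp" where "len_exp = Inp (Add (Vr PP) (Cst 1))"
definition arg_exp :: "nm \<Rightarrow> nm exp" where "arg_exp a = Inp (Add (Add (Vr PP) (Cst 2)) (Vr a))"

definition args_ok_exp :: "nm exp" where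
  "args_ok_exp = All (NA 0) (Disj (Leq len_exp (Vr (NA 0)))
    (Conj (Leq (Cst 0) (arg_exp (NA 0))) (Conj (Less (arg_exp (NA 0)) (Vr (NU 0)))
      (All NB (Disj (Leq (Vr (NA 0)) (Vr NB)) (Neg (Equ (arg_exp NB) (arg_exp (NA 0)))))))))"

definition gate_ok_exp :: "nm exp" where
  "gate_ok_exp = Disj (Equ (Inp (Vr PP)) (Cst 0)) (Disj
    (Conj (Equ (Inp (Vr PP)) (Cst 1)) (Conj (Less (Add (Vr PP) (Cst 1)) (Vr VN))
      (Conj (Leq (Cst 0) len_exp) (Less len_exp (Vr (NU 0))))))
    (Conj (Disj (Equ (Inp (Vr PP)) (Cst 2)) (Equ (Inp (Vr PP)) (Cst 3))) (Conj (Less (Add (Vr PP) (Cst 1)) (Vr VN))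
      (Conj (Leq (Cst 1) len_exp) (Conj (Less (Add (Add (Vr PP) (Cst 1)) len_exp) (Vr VN)) args_ok_exp)))))"

definition parse_exp :: "nm exp" where
  "parse_exp = Conj (Less (Cst 0) (Vr VN)) (Conj (Equ (start_exp VN) (Vr VN))
    (All (NU 0) (Bind PP (start_exp (NU 0)) (Disj (Leq (Vr VN) (Vr PP)) gate_ok_exp))))"

text \<open>Loops run up to \<open>Z\<close>, arguments only up to the arity; the assumed bound on
  the arity places all arguments inside the loops.\<close>

lemma holds_args_ok:
  assumes "\<rho> PP = p" "\<rho> (NU 0) = u" "0 \<le> p" "p + 1 + lookup xs (p + 1) < int Z"
  shows "holds xs Z args_ok_exp \<rho> \<longleftrightarrow>
    (\<forall>a. int a < lookup xs (p + 1) \<longrightarrow> 0 \<le> lookup xs (p + 2 + int a) \<and> lookup xs (p + 2 + int a) < u \<and>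
      (\<forall>b<a. lookup xs (p + 2 + int b) \<noteq> lookup xs (p + 2 + int a)))" (is "?L \<longleftrightarrow> ?R")
proof -
  have "?L \<longleftrightarrow> (\<forall>a<Z. lookup xs (p + 1) \<le> int a \<or> 0 \<le> lookup xs (p + 2 + int a) \<and> lookup xs (p + 2 + int a) < u \<and>
      (\<forall>b<Z. a \<le> b \<or> lookup xs (p + 2 + int b) \<noteq> lookup xs (p + 2 + int a)))" (is "_ \<longleftrightarrow> ?M")
    using assms(1,2) by (simp add: args_ok_exp_def len_exp_def arg_exp_def)
  also have "?M \<longleftrightarrow> ?R"
  proof
    assume L: ?M
    show ?R
    proof (intro allI impI)
      fix a assume a: "int a < lookup xs (p + 1)"
      then have aZ: "a < Z" using assms(3,4) by linarith
      with L a have *: "0 \<le> lookup xs (p + 2 + int a)" "lookup xs (p + 2 + int a) < u"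
        "\<And>b. b < Z \<Longrightarrow> a \<le> b \<or> lookup xs (p + 2 + int b) \<noteq> lookup xs (p + 2 + int a)"
        by (meson not_le)+
      have "lookup xs (p + 2 + int b) \<noteq> lookup xs (p + 2 + int a)" if "b < a" for b
        using *(3)[of b] that aZ by simp
      with * show "0 \<le> lookup xs (p + 2 + int a) \<and> lookup xs (p + 2 + int a) < u \<and>
         (\<forall>b<a. lookup xs (p + 2 + int b) \<noteq> lookup xs (p + 2 + int a))" by blast
    qed
  next
    assume ?R
    then show ?M by (meson not_le)
  qed
  finally show ?thesis .
qed

lemma holds_gate_ok:
  assumes "\<rho> VN = int (length xs)" "\<rho> PP = p" "\<rho> (NU 0) = u" "0 \<le> p" "length xs < Z"
  shows "holds xs Z gate_ok_exp \<rho> \<longleftrightarrow> gate_ok xs u p"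
proof -
  have "holds xs Z args_ok_exp \<rho> \<longleftrightarrow>
    (\<forall>a. int a < lookup xs (p + 1) \<longrightarrow> 0 \<le> lookup xs (p + 2 + int a) \<and> lookup xs (p + 2 + int a) < u \<and>
      (\<forall>b<a. lookup xs (p + 2 + int b) \<noteq> lookup xs (p + 2 + int a)))"
    if "p + 1 + lookup xs (p + 1) < int (length xs)"
    using assms that by (intro holds_args_ok) auto
  then show ?thesis
    unfolding gate_ok_exp_def gate_ok_def using assms(1-3) by (simp add: len_exp_def cong: conj_cong)
qed

lemma gate_start_bounds: "0 \<le> gate_start xs Z u" "gate_start xs Z u \<le> int Z"
  unfolding gate_start_def by (rule iter_bounds)+

lemma holds_parse:
  assumes "\<rho> VN = int (length xs)" "length xs < Z"
  shows "holds xs Z parse_exp \<rho> \<longleftrightarrow> parse_ok xs Z"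
proof -
  have 1: "ev xs Z (start_exp VN) \<rho> = gate_start xs Z (length xs)"
    using assms by (intro ev_start) auto
  have 2: "ev xs Z (start_exp (NU 0)) (\<rho>(NU 0 := int u)) = gate_start xs Z u" if "u < Z" for u
    using assms that by (intro ev_start) auto
  have 3: "holds xs Z gate_ok_exp (\<rho>(NU 0 := int u, PP := gate_start xs Z u)) \<longleftrightarrow> gate_ok xs (int u) (gate_start xs Z u)" for u
    using assms gate_start_bounds by (intro holds_gate_ok) auto
  show ?thesis
    unfolding parse_exp_def parse_ok_def
    using assms(1) by (auto simp: 1 2 3 not_le)
qed

section \<open>The parser accepts exactly the encodings of well-formed circuits\<close>

lemma length_encode_gate: "0 < length (encode_gate g)"
  by (cases g) auto

lemma encode_append: "encode (C @ D) = encode C @ encode D"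
  by (simp add: encode_def)

lemma encode_Cons: "encode (g # C) = encode_gate g @ encode C"
  by (simp add: encode_def)

lemma lookup_nat: "lookup xs (int i) = (if i < length xs then xs ! i else 0)"
  by (simp add: lookup_def)

definition offset :: "circuit \<Rightarrow> nat \<Rightarrow> nat" where
  "offset C u = length (encode (take u C))"

lemma offset_Suc: "u < length C \<Longrightarrow> offset C (Suc u) = offset C u + length (encode_gate (C ! u))"
  by (simp add: offset_def take_Suc_conv_app_nth encode_append encode_Cons encode_def)

lemma offset_le: "offset C u \<le> length (encode C)"
  using encode_append[of "take u C" "drop u C"] by (simp add: offset_def)

lemma lookup_encode:
  assumes "u < length C" "j < length (encode_gate (C ! u))"
  shows "lookup (encode C) (int (offset C u + j)) = encode_gate (C ! u) ! j"
proof -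
  have C: "C = take u C @ [C ! u] @ drop (Suc u) C" using assms(1) by (simp add: id_take_nth_drop)
  have "encode C = encode (take u C) @ encode_gate (C ! u) @ encode (drop (Suc u) C)"
    by (subst C) (simp only: encode_append encode_Cons append_Cons append_Nil append_assoc)
  then show ?thesis using assms(2) unfolding lookup_nat offset_def by (simp add: nth_append)
qed

lemma offset_less: "u < length C \<Longrightarrow> offset C u < length (encode C)"
  using offset_Suc[of u C] offset_le[of C "Suc u"] length_encode_gate[of "C ! u"] by linarith

lemma next_gate_offset:
  assumes "u < length C" shows "next_gate (encode C) (int (offset C u)) = int (offset C (Suc u))"
proof -
  have l0: "lookup (encode C) (int (offset C u)) = encode_gate (C ! u) ! 0"
    using lookup_encode[OF assms, of 0] length_encode_gate[of "C ! u"] by simp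
  have l1: "lookup (encode C) (int (offset C u) + 1) = encode_gate (C ! u) ! 1" if "1 < length (encode_gate (C ! u))"
    using lookup_encode[OF assms that] by (simp add: add.commute)
  show ?thesis
    using offset_less[OF assms] l0 l1 unfolding next_gate_def offset_Suc[OF assms]
    by (cases "C ! u") auto
qed

lemma gate_start_encode:
  assumes "u \<le> length C" "length (encode C) \<le> Z"
  shows "gate_start (encode C) Z u = int (offset C u)"
  using assms(1)
proof (induction u)
  case 0
  show ?case by (simp add: gate_start_def offset_def encode_def)
next
  case (Suc u)
  then have "gate_start (encode C) Z (Suc u) = clamp Z (int (offset C (Suc u)))"
    using next_gate_offset[of u C] by (simp add: gate_start_def)
  then show ?case using offset_le[of C "Suc u"] assms(2) by (simp add: clamp_def)
qed

lemma gate_start_encode_ge: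
  assumes "length C \<le> u" "length (encode C) \<le> Z"
  shows "gate_start (encode C) Z u = int (length (encode C))"
  using assms(1)
proof (induction u rule: dec_induct)
  case base
  show ?case using gate_start_encode[OF order_refl assms(2)] by (simp add: offset_def)
next
  case (step u)
  then show ?case using assms(2) by (simp add: gate_start_def next_gate_def clamp_def)
qed

lemma length_le_encode: "length C \<le> length (encode C)"
proof (induction C)
  case (Cons g C)
  then show ?case using length_encode_gate[of g] unfolding encode_Cons length_append list.size by linarith
qed simp

text \<open>Read contrapositively: a rejected input is not the encoding of a well-formed circuit, so
  the empty output is right for it.\<close>

lemma parse_ok_encode:
  assumes wf: "wf_circuit C" and Z: "length (encode C) < Z"
  shows "parse_ok (encode C) Z"
proof -
  have ne: "encode C \<noteq> []" using wf length_le_encode[of C] by (auto simp: wf_circuit_def)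
  moreover have "gate_start (encode C) Z (length (encode C)) = int (length (encode C))"
    using Z by (intro gate_start_encode_ge length_le_encode) auto
  moreover have "gate_ok (encode C) (int u) (gate_start (encode C) Z u)"
    if "gate_start (encode C) Z u < int (length (encode C))" for u
  proof -
    have u: "u < length C" using gate_start_encode_ge[of C u Z] that Z by (cases "u < length C") auto
    let ?p = "int (offset C u)"
    have p: "gate_start (encode C) Z u = ?p" using gate_start_encode[of u C Z] u Z by simp
    have l: "lookup (encode C) (?p + int j) = encode_gate (C ! u) ! j" if "j < length (encode_gate (C ! u))" for j
      using lookup_encode[OF u that] by simp
    have l0: "lookup (encode C) ?p = encode_gate (C ! u) ! 0" using l[of 0] length_encode_gate[of "C ! u"] by simp
    have l1: "lookup (encode C) (?p + 1) = encode_gate (C ! u) ! 1" if "1 < length (encode_gate (C ! u))"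
      using l[OF that] by simp
    have l2: "lookup (encode C) (?p + 2 + int a) = encode_gate (C ! u) ! (a + 2)" if "a + 2 < length (encode_gate (C ! u))" for a
      using l[OF that] by (simp add: ac_simps)
    have len: "?p + int (length (encode_gate (C ! u))) \<le> int (length (encode C))"
      using offset_le[of C "Suc u"] offset_Suc[OF u] by simp
    have w: "distinct (preds (C ! u))" "\<forall>j\<in>set (preds (C ! u)). j < u" "C ! u \<noteq> Input \<Longrightarrow> preds (C ! u) \<noteq> []"
      using wf u by (auto simp: wf_circuit_def)
    show ?thesis
    proof (cases "C ! u")
      case Input
      then show ?thesis using l0 p by (simp add: gate_ok_def)
    next
      case (Not j)
      then show ?thesis using l0 l1 len w p by (simp add: gate_ok_def)
    next
      case (And js)
      then show ?thesis using l0 l1 l2 len w p unfolding gate_ok_def by (auto simp: nth_eq_iff_index_eq Suc_le_eq)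
    next
      case (Or js)
      then show ?thesis using l0 l1 l2 len w p unfolding gate_ok_def by (auto simp: nth_eq_iff_index_eq Suc_le_eq)
    qed
  qed
  ultimately show ?thesis unfolding parse_ok_def by blast
qed

definition decode_gate :: "int list \<Rightarrow> int \<Rightarrow> gate" where
  "decode_gate xs p = (let js = map (\<lambda>a. nat (lookup xs (p + 2 + int a))) [0..<nat (lookup xs (p + 1))] in
    if lookup xs p = 0 then Input else if lookup xs p = 1 then Not (nat (lookup xs (p + 1)))
    else if lookup xs p = 2 then And js else Or js)"

lemma decode_gate:
  assumes "gate_ok xs (int u) p" "0 \<le> p" "p < int (length xs)"
  shows "encode_gate (decode_gate xs p) = take (nat (next_gate xs p - p)) (drop (nat p) xs)" (is ?enc)
    and "p < next_gate xs p" "next_gate xs p \<le> int (length xs)"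
    and "distinct (preds (decode_gate xs p))" "\<forall>j\<in>set (preds (decode_gate xs p)). j < u"
    and "decode_gate xs p \<noteq> Input \<longrightarrow> preds (decode_gate xs p) \<noteq> []"
proof -
  obtain q where q: "p = int q" using assms(2) nonneg_int_cases by blast
  have q': "q < length xs" using assms(3) q by simp
  have lk: "lookup xs (int q + 1) = lookup xs (int (Suc q))" "lookup xs (int q + 2 + int a) = lookup xs (int (q + 2 + a))" for a
    by (simp_all add: ac_simps)
  define js where "js = map (\<lambda>a. nat (lookup xs (p + 2 + int a))) [0..<nat (lookup xs (p + 1))]"
  define t where "t = lookup xs p"
  consider "t = 0" | "t = 1" "p + 1 < int (length xs)" "0 \<le> lookup xs (p + 1)" "lookup xs (p + 1) < int u"
    | m where "t = 2 \<or> t = 3" "lookup xs (p + 1) = int m" "1 \<le> m" "q + 1 + m < length xs"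
      "\<And>a. a < m \<Longrightarrow> 0 \<le> lookup xs (p + 2 + int a) \<and> lookup xs (p + 2 + int a) < int u \<and>
         (\<forall>b<a. lookup xs (p + 2 + int b) \<noteq> lookup xs (p + 2 + int a))"
  proof -
    assume A1: "t = 0 \<Longrightarrow> thesis"
      and A2: "t = 1 \<Longrightarrow> p + 1 < int (length xs) \<Longrightarrow> 0 \<le> lookup xs (p + 1) \<Longrightarrow> lookup xs (p + 1) < int u \<Longrightarrow> thesis"
      and A3: "\<And>m. t = 2 \<or> t = 3 \<Longrightarrow> lookup xs (p + 1) = int m \<Longrightarrow> 1 \<le> m \<Longrightarrow> q + 1 + m < length xs \<Longrightarrow>
        (\<And>a. a < m \<Longrightarrow> 0 \<le> lookup xs (p + 2 + int a) \<and> lookup xs (p + 2 + int a) < int u \<and>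
         (\<forall>b<a. lookup xs (p + 2 + int b) \<noteq> lookup xs (p + 2 + int a))) \<Longrightarrow> thesis"
    from assms(1) consider "t = 0" | "t = 1" "p + 1 < int (length xs)" "0 \<le> lookup xs (p + 1)" "lookup xs (p + 1) < int u"
      | "t = 2 \<or> t = 3" "1 \<le> lookup xs (p + 1)" "p + 1 + lookup xs (p + 1) < int (length xs)"
        "\<forall>a. int a < lookup xs (p + 1) \<longrightarrow> 0 \<le> lookup xs (p + 2 + int a) \<and> lookup xs (p + 2 + int a) < int u \<and>
         (\<forall>b<a. lookup xs (p + 2 + int b) \<noteq> lookup xs (p + 2 + int a))"
      unfolding gate_ok_def t_def by blast
    then show thesis
    proof cases
      case 3
      then show thesis using q by (intro A3[of "nat (lookup xs (p + 1))"]) auto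
    qed (use A1 A2 in blast)+
  qed
  note cs = this
  have enc: "?enc \<and> p < next_gate xs p \<and> next_gate xs p \<le> int (length xs) \<and> distinct (preds (decode_gate xs p)) \<and>
    (\<forall>j\<in>set (preds (decode_gate xs p)). j < u) \<and> (decode_gate xs p \<noteq> Input \<longrightarrow> preds (decode_gate xs p) \<noteq> [])"
  proof (cases rule: cs)
    case 1
    then have "next_gate xs p = p + 1" "decode_gate xs p = Input" using assms(3) by (auto simp: next_gate_def decode_gate_def t_def)
    moreover have "xs ! q = 0" using 1 q q' by (simp add: t_def lookup_nat)
    ultimately show ?thesis using q q' by (simp add: take_Suc_conv_app_nth)
  next
    case 2
    then have n: "next_gate xs p = p + 2" and d: "decode_gate xs p = Not (nat (lookup xs (p + 1)))"
      using assms(3) by (auto simp: next_gate_def decode_gate_def t_def)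
    have q2: "Suc q < length xs" using 2(2) q by simp
    moreover have "lookup xs (p + 1) = xs ! Suc q" unfolding q lk lookup_nat using q2 by simp
    moreover have "xs ! q = 1" using 2 q q' by (simp add: t_def lookup_nat)
    moreover have "take 2 (drop q xs) = [xs ! q, xs ! Suc q]" using q2 by (simp add: numeral_2_eq_2 take_Suc_conv_app_nth)
    ultimately show ?thesis using n d 2 q q2 by (simp add: nat_less_iff)
  next
    case (3 m)
    have js: "js = map (\<lambda>a. nat (lookup xs (p + 2 + int a))) [0..<m]" using 3(2) by (simp add: js_def)
    have n: "next_gate xs p = p + 2 + int m" using assms(3) 3 by (auto simp: next_gate_def t_def)
    have "take (Suc (Suc m)) (drop q xs) = xs ! q # xs ! Suc q # map (\<lambda>a. xs ! (q + 2 + a)) [0..<m]"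
    proof (rule nth_equalityI)
      fix i assume "i < length (take (Suc (Suc m)) (drop q xs))"
      then have i: "i < Suc (Suc m)" by simp
      consider "i = 0" | "i = 1" | j where "i = Suc (Suc j)" by (metis One_nat_def not0_implies_Suc)
      then show "take (Suc (Suc m)) (drop q xs) ! i = (xs ! q # xs ! Suc q # map (\<lambda>a. xs ! (q + 2 + a)) [0..<m]) ! i"
        by cases (use 3(4) i in auto)
    qed (use 3(4) in auto)
    moreover have "map int js = map (\<lambda>a. xs ! (q + 2 + a)) [0..<m]"
      unfolding js map_map
    proof (rule map_cong[OF refl])
      fix a assume "a \<in> set [0..<m]"
      then have "a < m" by simp
      then have l: "lookup xs (p + 2 + int a) = xs ! (q + 2 + a)" unfolding q lk lookup_nat using 3(4) by simp
      from \<open>a < m\<close> show "(int \<circ> (\<lambda>a. nat (lookup xs (p + 2 + int a)))) a = xs ! (q + 2 + a)"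
        using 3(5)[of a] l by simp
    qed
    moreover have "lookup xs (p + 1) = xs ! Suc q" unfolding q lk lookup_nat using 3(4) by simp
    then have "xs ! q = t" "xs ! Suc q = int m" using 3(2) q q' by (auto simp: t_def lookup_nat)
    moreover have "length js = m" by (simp add: js)
    moreover have d: "decode_gate xs p = (if t = 2 then And js else Or js)" using 3 by (auto simp: decode_gate_def t_def js_def)
    moreover have "nat (next_gate xs p - p) = Suc (Suc m)" using n by simp
    ultimately have e: ?enc using 3(1) q by auto
    have pr: "preds (decode_gate xs p) = js" using d by simp
    have "inj_on (\<lambda>a. nat (lookup xs (p + 2 + int a))) {0..<m}"
    proof (rule linorder_inj_onI)
      fix b a assume ba: "b < a" "b \<in> {0..<m}" "a \<in> {0..<m}"
      then show "nat (lookup xs (p + 2 + int b)) \<noteq> nat (lookup xs (p + 2 + int a))"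
        using 3(5)[of a] 3(5)[of b] by (metis atLeastLessThan_iff eq_nat_nat_iff)
    qed auto
    then have "distinct js" by (simp add: js distinct_map)
    moreover have "\<forall>j\<in>set js. j < u" using 3(5) by (auto simp: js nat_less_iff)
    moreover have "js \<noteq> []" using 3(3) by (simp add: js)
    ultimately show ?thesis using e pr n 3(4) q by simp
  qed
  from enc show ?enc "p < next_gate xs p" "next_gate xs p \<le> int (length xs)"
    "distinct (preds (decode_gate xs p))" "\<forall>j\<in>set (preds (decode_gate xs p)). j < u"
    "decode_gate xs p \<noteq> Input \<longrightarrow> preds (decode_gate xs p) \<noteq> []" by blast+
qed

text \<open>Gates are decoded up to the least \<open>m\<close> whose start is the end of the list;
  the first \<open>u\<close> decoded gates encode the prefix read in \<open>u\<close> steps. Thus an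
  accepted input always comes with a circuit to argue about.\<close>

lemma parse_ok_imp_encode:
  assumes ok: "parse_ok xs Z" and Z: "length xs < Z"
  shows "\<exists>C. wf_circuit C \<and> xs = encode C"
proof -
  let ?g = "gate_start xs Z"
  have g0: "?g 0 = 0" by (simp add: gate_start_def)
  have gok: "gate_ok xs (int u) (?g u)" if "u < Z" "?g u < int (length xs)" for u
    using ok that by (simp add: parse_ok_def)
  have step: "?g (Suc u) = next_gate xs (?g u)" if "u < Z" "?g u < int (length xs)" for u
    using decode_gate(2,3)[OF gok[OF that] gate_start_bounds(1) that(2)] gate_start_bounds(1)[of xs Z u] Z
    by (simp add: gate_start_def clamp_def)
  define m where "m = (LEAST u. int (length xs) \<le> ?g u)"
  have "int (length xs) \<le> ?g (length xs)" using ok by (simp add: parse_ok_def)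
  then have m: "int (length xs) \<le> ?g m" "m \<le> length xs" unfolding m_def by (auto intro: LeastI Least_le)
  have lt: "?g u < int (length xs)" if "u < m" for u using not_less_Least[of u "\<lambda>u. int (length xs) \<le> ?g u"] that unfolding m_def by auto
  define D where "D u = map (\<lambda>v. decode_gate xs (?g v)) [0..<u]" for u
  have D: "encode (D u) = take (nat (?g u)) xs \<and> ?g u \<le> int (length xs)" if "u \<le> m" for u
    using that
  proof (induction u)
    case 0
    show ?case using g0 by (simp add: D_def encode_def)
  next
    case (Suc u)
    then have u: "u < Z" "?g u < int (length xs)" using m(2) Z lt by auto
    note dg = decode_gate[OF gok[OF u] gate_start_bounds(1) u(2)]
    have "encode (D (Suc u)) = take (nat (?g u)) xs @ take (nat (next_gate xs (?g u) - ?g u)) (drop (nat (?g u)) xs)"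
      using Suc dg(1) by (simp add: D_def encode_append encode_Cons) (simp add: encode_def)
    also have "\<dots> = take (nat (?g u) + nat (next_gate xs (?g u) - ?g u)) xs" by (rule take_add[symmetric])
    also have "nat (?g u) + nat (next_gate xs (?g u) - ?g u) = nat (?g (Suc u))"
      using dg(2) gate_start_bounds(1)[of xs Z u] step[OF u] by simp
    finally show ?case using dg(3) step[OF u] by simp
  qed
  have "encode (D m) = xs" using D[of m] m(1) by simp
  moreover have "wf_circuit (D m)"
    unfolding wf_circuit_def
  proof (intro conjI allI impI)
    show "D m \<noteq> []" using ok \<open>encode (D m) = xs\<close> by (auto simp: parse_ok_def encode_def)
    fix u assume "u < length (D m)"
    then have u: "u < m" by (simp add: D_def)
    then have u': "u < Z" "?g u < int (length xs)" using m(2) Z lt by auto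
    note dg = decode_gate[OF gok[OF u'] gate_start_bounds(1) u'(2)]
    have "D m ! u = decode_gate xs (?g u)" using u by (simp add: D_def)
    then show "distinct (preds (D m ! u))" "\<forall>j\<in>set (preds (D m ! u)). j < u" "D m ! u \<noteq> Input \<Longrightarrow> preds (D m ! u) \<noteq> []"
      using dg by simp_all
  qed
  ultimately show ?thesis by blast
qed

section \<open>Evaluating the circuit\<close>

definition tag_exp :: "nm \<Rightarrow> nm exp" where
  "tag_exp x = Bind PP (start_exp x) (Inp (Vr PP))"

definition arity_exp :: "nm \<Rightarrow> nm exp" where
  "arity_exp x = Bind PP (start_exp x)
    (Ite (Leq (Inp (Vr PP)) (Cst 0)) (Cst 0) (Ite (Leq (Inp (Vr PP)) (Cst 1)) (Cst 1) len_exp))"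

text \<open>The argument of \<open>Not\<close> directly follows the tag; for \<open>And\<close> and
  \<open>Or\<close> the number of arguments stands in between.\<close>

definition pred_exp :: "nm \<Rightarrow> nm exp \<Rightarrow> nm exp" where
  "pred_exp x a = Bind PP (start_exp x)
    (Ite (Leq (Inp (Vr PP)) (Cst 1)) len_exp (Inp (Add (Add (Vr PP) (Cst 2)) a)))"

text \<open>Passes from the node at level \<open>Suc d\<close> to its arguments at level
  \<open>d\<close>, in step with the recursion of \<open>shallow\<close>.\<close>

definition all_preds :: "nat \<Rightarrow> nm exp \<Rightarrow> nm exp" where
  "all_preds d e = All (NA d) (Disj (Leq (arity_exp (NU (Suc d))) (Vr (NA d)))
    (Bind (NU d) (pred_exp (NU (Suc d)) (Vr (NA d))) e))"

definition some_pred :: "nat \<Rightarrow> nm exp \<Rightarrow> nm exp" where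
  "some_pred d e = Exi (NA d) (Conj (Less (Vr (NA d)) (arity_exp (NU (Suc d))))
    (Bind (NU d) (pred_exp (NU (Suc d)) (Vr (NA d))) e))"

definition sum_preds :: "nat \<Rightarrow> nm exp \<Rightarrow> nm exp" where
  "sum_preds d e = Summ (NA d) (Ite (Less (Vr (NA d)) (arity_exp (NU (Suc d))))
    (Bind (NU d) (pred_exp (NU (Suc d)) (Vr (NA d))) e) (Cst 0))"

definition at_pred :: "nat \<Rightarrow> int \<Rightarrow> nm exp \<Rightarrow> nm exp" where
  "at_pred d i e = Bind (NU d) (pred_exp (NU (Suc d)) (Cst i)) e"

primrec shallow_exp :: "nat \<Rightarrow> nat \<Rightarrow> nm exp" where
  "shallow_exp 0 t = Leq (arity_exp (NU 0)) (Cst 0)"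
| "shallow_exp (Suc d) t = Ite (Less (Cst 2) (arity_exp (NU (Suc d))))
     (if 0 < t then all_preds d (shallow_exp d (t - 1)) else Cst 0) (all_preds d (shallow_exp d t))"

text \<open>The variables \<open>NX a\<close> with \<open>a < r\<close> hold the true inputs, shifted by one so that 0 can be used as padding.\<close>

primrec member_exp :: "nat \<Rightarrow> nm \<Rightarrow> nm exp" where
  "member_exp 0 x = Cst 0"
| "member_exp (Suc a) x = Disj (Equ (Vr (NX a)) (Add (Vr x) (Cst 1))) (member_exp a x)"

text \<open>In a shallow circuit depth 0 is reached only at inputs, so membership is the right
  answer there.\<close>

primrec val_exp :: "nat \<Rightarrow> nat \<Rightarrow> nm exp" where
  "val_exp r 0 = member_exp r (NU 0)"
| "val_exp r (Suc d) = Ite (Leq (tag_exp (NU (Suc d))) (Cst 0)) (member_exp r (NU (Suc d)))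
    (Ite (Leq (tag_exp (NU (Suc d))) (Cst 1)) (Neg (at_pred d 0 (val_exp r d)))
    (Ite (Leq (tag_exp (NU (Suc d))) (Cst 2)) (all_preds d (val_exp r d)) (some_pred d (val_exp r d))))"

primrec defect_exp :: "nat \<Rightarrow> nat \<Rightarrow> nm exp" where
  "defect_exp r 0 = Ite (member_exp r (NU 0)) (Cst 1) (Cst 0)"
| "defect_exp r (Suc d) = Ite (Leq (tag_exp (NU (Suc d))) (Cst 0)) (Ite (member_exp r (NU (Suc d))) (Cst 1) (Cst 0))
    (Ite (Leq (tag_exp (NU (Suc d))) (Cst 1)) (Cst 0)
    (Ite (Leq (tag_exp (NU (Suc d))) (Cst 2)) (sum_preds d (Ite (val_exp r d) (Cst 0) (Cst 1)))
      (sum_preds d (Ite (val_exp r d) (Cst 1) (Cst 0)))))"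

definition atom_exp :: "nm \<Rightarrow> nm exp" where
  "atom_exp x = Disj (Leq (arity_exp x) (Cst 0)) (Less (Cst 2) (arity_exp x))"

primrec zpow_exp :: "nat \<Rightarrow> nm exp" where
  "zpow_exp 0 = Vr VZ"
| "zpow_exp (Suc d) = Mul (zpow_exp d) (zpow_exp d)"

primrec profile_exp :: "nat \<Rightarrow> nat \<Rightarrow> nm exp" where
  "profile_exp r 0 = defect_exp r 0"
| "profile_exp r (Suc d) = Ite (atom_exp (NU (Suc d))) (defect_exp r (Suc d))
    (Ite (Leq (arity_exp (NU (Suc d))) (Cst 1)) (at_pred d 0 (profile_exp r d))
      (Add (at_pred d 0 (profile_exp r d)) (Mul (zpow_exp d) (at_pred d 1 (profile_exp r d)))))"

definition atom_good_exp :: "nat \<Rightarrow> nm exp" where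
  "atom_good_exp d = Ite (Equ (tag_exp (NU d)) (Cst 2)) (Leq (Vr (NV d)) (Cst 0)) (Less (Cst 0) (Vr (NV d)))"

text \<open>The language has quotients only, so the remainder is written as
  \<open>v - Y * (v div Y)\<close> with \<open>Y\<close> the value of
  \<open>zpow_exp d\<close>.\<close>

primrec good_exp :: "nat \<Rightarrow> nm exp" where
  "good_exp 0 = atom_good_exp 0"
| "good_exp (Suc d) = Ite (atom_exp (NU (Suc d))) (atom_good_exp (Suc d))
    (Ite (Equ (tag_exp (NU (Suc d))) (Cst 1)) (Neg (at_pred d 0 (Bind (NV d) (Vr (NV (Suc d))) (good_exp d))))
    (Ite (Leq (arity_exp (NU (Suc d))) (Cst 1)) (at_pred d 0 (Bind (NV d) (Vr (NV (Suc d))) (good_exp d)))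
    (Ite (Equ (tag_exp (NU (Suc d))) (Cst 2))
      (Conj (at_pred d 0 (Bind (NV d) (Sub (Vr (NV (Suc d))) (Mul (zpow_exp d) (Quo (Vr (NV (Suc d))) (zpow_exp d)))) (good_exp d)))
        (at_pred d 1 (Bind (NV d) (Quo (Vr (NV (Suc d))) (zpow_exp d)) (good_exp d))))
      (Disj (at_pred d 0 (Bind (NV d) (Sub (Vr (NV (Suc d))) (Mul (zpow_exp d) (Quo (Vr (NV (Suc d))) (zpow_exp d)))) (good_exp d)))
        (at_pred d 1 (Bind (NV d) (Quo (Vr (NV (Suc d))) (zpow_exp d)) (good_exp d)))))))"

text \<open>After the last gate the position stays at the end of the list, so the gates are the
  numbers whose start lies before the end.\<close>

definition count_exp :: "nm exp" where
  "count_exp = Summ NB (Ite (Less (start_exp NB) (Vr VN)) (Cst 1) (Cst 0))"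

definition root_exp :: "nm exp" where "root_exp = Sub count_exp (Cst 1)"

text \<open>The alternating sum \<open>mob\<close>, built up from one element to the next by the recursion \<open>mob_insert\<close>.\<close>

primrec mob_exp :: "nat \<Rightarrow> nat \<Rightarrow> nat \<Rightarrow> nm exp" where
  "mob_exp r d 0 = Bind (NU d) root_exp (profile_exp r d)"
| "mob_exp r d (Suc a) = Ite (Vr (NX a))
    (Sub (mob_exp r d a) (Bind (NX a) (Cst 0) (mob_exp r d a))) (mob_exp r d a)"

definition var_set :: "nat \<Rightarrow> nat \<Rightarrow> (nm \<Rightarrow> int) \<Rightarrow> nat set" where
  "var_set a b \<rho> = {x. 0 < x \<and> (\<exists>c\<in>{a..<b}. \<rho> (NX c) = int x)}"

definition env_ok :: "int list \<Rightarrow> nat \<Rightarrow> nat \<Rightarrow> (nm \<Rightarrow> int) \<Rightarrow> bool" where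
  "env_ok xs k Z \<rho> \<longleftrightarrow> \<rho> VN = int (length xs) \<and> \<rho> VK = int k \<and> \<rho> VZ = int Z"

lemma env_ok_upd [simp]: "x \<notin> {VN, VK, VZ} \<Longrightarrow> env_ok xs k Z (\<rho>(x := v)) = env_ok xs k Z \<rho>"
  by (auto simp: env_ok_def)

lemma var_set_upd [simp]: "(\<And>c. x \<noteq> NX c) \<Longrightarrow> var_set a b (\<rho>(x := v)) = var_set a b \<rho>"
  unfolding var_set_def by (metis (no_types, lifting) fun_upd_other)

fun gate_tag :: "gate \<Rightarrow> int" where
  "gate_tag Input = 0"
| "gate_tag (Not j) = 1"
| "gate_tag (And js) = 2"
| "gate_tag (Or js) = 3"

lemma holds_member: "holds xs Z (member_exp r x) \<rho> \<longleftrightarrow> (\<exists>c<r. \<rho> (NX c) = \<rho> x + 1)"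
  by (induction r) (auto simp: less_Suc_eq)

lemma sum_nth_distinct: "distinct js \<Longrightarrow> (\<Sum>j\<in>set js. f j) = (\<Sum>i<length js. f (js ! i))"
  by (simp add: sum_list_distinct_conv_sum_set[symmetric] sum_list_sum_nth atLeast0LessThan)

section \<open>Correctness of the circuit expressions\<close>

locale parsed =
  fixes C :: circuit and k Z :: nat
  assumes wf: "wf_circuit C" and Z: "Z = length (encode C) + k + 2"
begin

abbreviation "xs \<equiv> encode C"
abbreviation "ok \<equiv> env_ok xs k Z"

text \<open>Thus loops up to \<open>Z\<close> reach all arguments, and counts of arguments are
  digits in base \<open>Z\<close>.\<close>

lemma arity_less: "length (preds (C ! u)) < Z" if "u < length C" for u
proof -
  have "length (preds (C ! u)) \<le> length (encode_gate (C ! u))" by (cases "C ! u") auto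
  also have "\<dots> \<le> length xs" using offset_Suc[OF that] offset_le[of C "Suc u"] by simp
  finally show ?thesis using Z by simp
qed

lemma length_C: "length C < Z" using length_le_encode[of C] Z by simp

lemma ev_start_node:
  assumes "ok \<rho>" "\<rho> x = int u" "u < length C" "x \<notin> {PP, CC}"
  shows "ev xs Z (start_exp x) \<rho> = int (offset C u)"
  using assms length_C gate_start_encode[of u C Z] Z by (subst ev_start) (auto simp: env_ok_def)

lemma lookup_node:
  assumes "u < length C"
  shows "lookup xs (int (offset C u)) = gate_tag (C ! u)"
    and "C ! u \<noteq> Input \<Longrightarrow> \<not> is_Not (C ! u) \<Longrightarrow> lookup xs (int (offset C u) + 1) = int (length (preds (C ! u)))"
    and "is_Not (C ! u) \<Longrightarrow> lookup xs (int (offset C u) + 1) = int (preds (C ! u) ! 0)"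
    and "\<not> is_Not (C ! u) \<Longrightarrow> i < length (preds (C ! u)) \<Longrightarrow>
      lookup xs (int (offset C u) + 2 + int i) = int (preds (C ! u) ! i)"
proof -
  have l: "lookup xs (int (offset C u) + int j) = encode_gate (C ! u) ! j" if "j < length (encode_gate (C ! u))" for j
    using lookup_encode[OF assms that] by simp
  show "lookup xs (int (offset C u)) = gate_tag (C ! u)"
    using l[of 0] by (cases "C ! u") auto
  show "C ! u \<noteq> Input \<Longrightarrow> \<not> is_Not (C ! u) \<Longrightarrow> lookup xs (int (offset C u) + 1) = int (length (preds (C ! u)))"
    "is_Not (C ! u) \<Longrightarrow> lookup xs (int (offset C u) + 1) = int (preds (C ! u) ! 0)"
    using l[of 1] by (cases "C ! u"; simp)+
  show "\<not> is_Not (C ! u) \<Longrightarrow> i < length (preds (C ! u)) \<Longrightarrow>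
      lookup xs (int (offset C u) + 2 + int i) = int (preds (C ! u) ! i)"
    using l[of "i + 2"] by (cases "C ! u") (simp_all add: ac_simps)
qed

lemma ev_tag:
  assumes "ok \<rho>" "\<rho> x = int u" "u < length C" "x \<notin> {PP, CC}"
  shows "ev xs Z (tag_exp x) \<rho> = gate_tag (C ! u)"
  unfolding tag_exp_def using ev_start_node[OF assms] lookup_node(1)[OF assms(3)] by simp

lemma ev_arity:
  assumes "ok \<rho>" "\<rho> x = int u" "u < length C" "x \<notin> {PP, CC}"
  shows "ev xs Z (arity_exp x) \<rho> = int (length (preds (C ! u)))"
  unfolding arity_exp_def len_exp_def using ev_start_node[OF assms] lookup_node(1,2)[OF assms(3)]
  by (cases "C ! u") simp_all

lemma ev_pred:
  assumes "ok \<rho>" "\<rho> x = int u" "u < length C" "x \<notin> {PP, CC}" "i < length (preds (C ! u))"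
    and "\<And>p. ev xs Z a (\<rho>(PP := p)) = int i"
  shows "ev xs Z (pred_exp x a) \<rho> = int (preds (C ! u) ! i)"
  unfolding pred_exp_def len_exp_def
  using ev_start_node[OF assms(1-4)] lookup_node(1)[OF assms(3)] lookup_node(3,4)[OF assms(3)] assms(5,6)
  by (cases "C ! u") simp_all

lemma preds_less: "u < length C \<Longrightarrow> i < length (preds (C ! u)) \<Longrightarrow> preds (C ! u) ! i < length C"
  using wf unfolding wf_circuit_def by (meson nth_mem less_trans)

context
  fixes \<rho> :: "nm \<Rightarrow> int" and d u :: nat
  assumes \<rho>: "ok \<rho>" "\<rho> (NU (Suc d)) = int u" "u < length C"
begin

lemma ev_pred_loop:
  "i < length (preds (C ! u)) \<Longrightarrow>
    ev xs Z (pred_exp (NU (Suc d)) (Vr (NA d))) (\<rho>(NA d := int i)) = int (preds (C ! u) ! i)"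
  "ev xs Z (arity_exp (NU (Suc d))) (\<rho>(NA d := v)) = int (length (preds (C ! u)))"
  using \<rho> by (subst ev_pred ev_arity; simp)+

lemma holds_body:
  "i < length (preds (C ! u)) \<Longrightarrow>
    holds xs Z (Bind (NU d) (pred_exp (NU (Suc d)) (Vr (NA d))) e) (\<rho>(NA d := int i)) \<longleftrightarrow>
    holds xs Z e (\<rho>(NA d := int i, NU d := int (preds (C ! u) ! i)))"
  by (simp only: holds_simps ev_pred_loop(1))

lemma holds_all_preds:
  "holds xs Z (all_preds d e) \<rho> \<longleftrightarrow>
    (\<forall>i<length (preds (C ! u)). holds xs Z e (\<rho>(NA d := int i, NU d := int (preds (C ! u) ! i))))"
proof -
  have "holds xs Z (all_preds d e) \<rho> \<longleftrightarrow> (\<forall>i<Z. length (preds (C ! u)) \<le> i \<or>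
      holds xs Z (Bind (NU d) (pred_exp (NU (Suc d)) (Vr (NA d))) e) (\<rho>(NA d := int i)))"
    by (simp only: all_preds_def holds_All holds_simps(2,4) ev_pred_loop(2) ev.simps(2) fun_upd_same of_nat_le_iff)
  also have "\<dots> \<longleftrightarrow> (\<forall>i<length (preds (C ! u)).
      holds xs Z (Bind (NU d) (pred_exp (NU (Suc d)) (Vr (NA d))) e) (\<rho>(NA d := int i)))"
    using arity_less[OF \<rho>(3)] by (meson less_trans not_le)
  finally show ?thesis by (simp only: holds_body cong: imp_cong)
qed

lemma holds_some_pred:
  "holds xs Z (some_pred d e) \<rho> \<longleftrightarrow>
    (\<exists>i<length (preds (C ! u)). holds xs Z e (\<rho>(NA d := int i, NU d := int (preds (C ! u) ! i))))"
proof -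
  have "holds xs Z (some_pred d e) \<rho> \<longleftrightarrow> (\<exists>i<Z. i < length (preds (C ! u)) \<and>
      holds xs Z (Bind (NU d) (pred_exp (NU (Suc d)) (Vr (NA d))) e) (\<rho>(NA d := int i)))"
    by (simp only: some_pred_def holds_Exi holds_simps(1,3) ev_pred_loop(2) ev.simps(2) fun_upd_same of_nat_less_iff)
  also have "\<dots> \<longleftrightarrow> (\<exists>i<length (preds (C ! u)).
      holds xs Z (Bind (NU d) (pred_exp (NU (Suc d)) (Vr (NA d))) e) (\<rho>(NA d := int i)))"
    using arity_less[OF \<rho>(3)] by (meson less_trans)
  finally show ?thesis by (simp only: holds_body cong: conj_cong)
qed

lemma ev_sum_preds:
  "ev xs Z (sum_preds d e) \<rho> =
    (\<Sum>i<length (preds (C ! u)). ev xs Z e (\<rho>(NA d := int i, NU d := int (preds (C ! u) ! i))))"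
proof -
  have "ev xs Z (sum_preds d e) \<rho> = (\<Sum>i<Z. if i < length (preds (C ! u))
      then ev xs Z e (\<rho>(NA d := int i, NU d := int (preds (C ! u) ! i))) else 0)"
    unfolding sum_preds_def ev.simps(10) by (intro sum.cong refl) (auto simp: ev_pred_loop)
  also have "\<dots> = (\<Sum>i<length (preds (C ! u)). ev xs Z e (\<rho>(NA d := int i, NU d := int (preds (C ! u) ! i))))"
    using arity_less[OF \<rho>(3)] by (intro sum.mono_neutral_cong_right) auto
  finally show ?thesis .
qed

lemma ev_at_pred:
  assumes "nat i < length (preds (C ! u))" "0 \<le> i"
  shows "ev xs Z (at_pred d i e) \<rho> = ev xs Z e (\<rho>(NU d := int (preds (C ! u) ! nat i)))"
    "holds xs Z (at_pred d i e) \<rho> \<longleftrightarrow> holds xs Z e (\<rho>(NU d := int (preds (C ! u) ! nat i)))"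
  using ev_pred[OF \<rho>(1,2,3) _ assms(1), of "Cst i"] assms(2) by (auto simp: at_pred_def)

end

lemma holds_shallow:
  "ok \<rho> \<Longrightarrow> \<rho> (NU d) = int u \<Longrightarrow> u < length C \<Longrightarrow> holds xs Z (shallow_exp d t) \<rho> \<longleftrightarrow> shallow C d t u"
proof (induction d arbitrary: \<rho> u t)
  case 0
  then show ?case using ev_arity[of \<rho> "NU 0" u] by simp
next
  case (Suc d)
  have IH: "holds xs Z (shallow_exp d t) (\<rho>(NA d := int i, NU d := int (preds (C ! u) ! i))) \<longleftrightarrow>
      shallow C d t (preds (C ! u) ! i)" if "i < length (preds (C ! u))" for i t
    using Suc.prems that preds_less Suc.IH[of "\<rho>(NA d := int i, NU d := int (preds (C ! u) ! i))" "preds (C ! u) ! i"] by (simp del: fun_upd_apply add: fun_upd_same)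
  have "(\<forall>i<length js. P (js ! i)) \<longleftrightarrow> (\<forall>v\<in>set js. P v)" for js :: "nat list" and P
    by (simp add: all_set_conv_all_nth)
  then show ?case using ev_arity[of \<rho> "NU (Suc d)" u] Suc.prems IH
    by (simp add: holds_all_preds[OF Suc.prems] large_def)
qed

definition true_inputs :: "nat \<Rightarrow> (nm \<Rightarrow> int) \<Rightarrow> nat set" where
  "true_inputs r \<rho> = {u. Suc u \<in> var_set 0 r \<rho>}"

lemma true_inputs_upd [simp]: "(\<And>c. x \<noteq> NX c) \<Longrightarrow> true_inputs r (\<rho>(x := v)) = true_inputs r \<rho>"
  by (simp add: true_inputs_def)

lemma holds_member_node: "\<rho> x = int u \<Longrightarrow> holds xs Z (member_exp r x) \<rho> \<longleftrightarrow> u \<in> true_inputs r \<rho>"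
  by (auto simp: holds_member true_inputs_def var_set_def ac_simps)

lemma holds_val:
  "ok \<rho> \<Longrightarrow> \<rho> (NU d) = int u \<Longrightarrow> u < length C \<Longrightarrow> shallow C d t u \<Longrightarrow>
    holds xs Z (val_exp r d) \<rho> \<longleftrightarrow> node_val C (true_inputs r \<rho>) u"
proof (induction d arbitrary: \<rho> u t)
  case 0
  then have "C ! u = Input" using wf by (auto simp: wf_circuit_def)
  then show ?case using 0 node_val_unfold[OF wf 0(3)] by (simp add: holds_member_node)
next
  case (Suc d)
  have sh: "shallow C d (if large (C ! u) then t - 1 else t) (preds (C ! u) ! i)" if "i < length (preds (C ! u))" for i
    using Suc.prems(4) nth_mem[OF that] by auto
  have IH: "holds xs Z (val_exp r d) (\<rho>(NA d := int i, NU d := int (preds (C ! u) ! i))) \<longleftrightarrow>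
      node_val C (true_inputs r \<rho>) (preds (C ! u) ! i)" if "i < length (preds (C ! u))" for i
    using Suc.IH[of "\<rho>(NA d := int i, NU d := int (preds (C ! u) ! i))", OF _ _ preds_less[OF Suc.prems(3) that] sh[OF that]] Suc.prems(1) by (simp del: fun_upd_apply add: fun_upd_same)
  have IH0: "holds xs Z (val_exp r d) (\<rho>(NU d := int (preds (C ! u) ! 0))) \<longleftrightarrow>
      node_val C (true_inputs r \<rho>) (preds (C ! u) ! 0)" if "0 < length (preds (C ! u))"
    using Suc.IH[of "\<rho>(NU d := int (preds (C ! u) ! 0))", OF _ _ preds_less[OF Suc.prems(3) that] sh[OF that]] Suc.prems(1) by (simp del: fun_upd_apply add: fun_upd_same)
  have exn: "(\<exists>v\<in>set js. P v) \<longleftrightarrow> (\<exists>i<length js. P (js ! i))" for js :: "nat list" and P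
    by (metis in_set_conv_nth)
  show ?case
    using ev_tag[OF Suc.prems(1-3)] node_val_unfold[OF wf Suc.prems(3)] holds_all_preds[OF Suc.prems(1-3)]
      holds_some_pred[OF Suc.prems(1-3)] ev_at_pred(2)[OF Suc.prems(1-3), of 0] IH IH0 Suc.prems(2)
    by (cases "C ! u") (simp_all add: holds_member_node all_set_conv_all_nth exn cong: conj_cong)
qed

lemma ev_defect:
  assumes "ok \<rho>" "\<rho> (NU d) = int u" "u < length C" "shallow C d t u"
  shows "ev xs Z (defect_exp r d) \<rho> = defect C (true_inputs r \<rho>) u"
proof (cases d)
  case 0
  then have "C ! u = Input" using assms wf by (auto simp: wf_circuit_def)
  then show ?thesis using assms 0 by (simp add: holds_member_node defect_def)
next
  case (Suc d')
  note a = assms(1) assms(2)[unfolded Suc] assms(3)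
  have sh: "shallow C d' (if large (C ! u) then t - 1 else t) (preds (C ! u) ! i)" if "i < length (preds (C ! u))" for i
    using assms(4) Suc nth_mem[OF that] by auto
  have val: "holds xs Z (val_exp r d') (\<rho>(NA d' := int i, NU d' := int (preds (C ! u) ! i))) \<longleftrightarrow>
      node_val C (true_inputs r \<rho>) (preds (C ! u) ! i)" if "i < length (preds (C ! u))" for i
    using holds_val[of "\<rho>(NA d' := int i, NU d' := int (preds (C ! u) ! i))", OF _ _ preds_less[OF assms(3) that] sh[OF that]] assms(1) by (simp del: fun_upd_apply add: fun_upd_same)
  have dist: "distinct (preds (C ! u))" using wf assms(3) by (simp add: wf_circuit_def)
  show ?thesis
    using ev_tag[OF a] ev_sum_preds[OF a] val dist a(2)
    by (cases "C ! u")
      (simp_all add: Suc holds_member_node defect_def sum_nth_distinct of_bool_def del: sum_of_bool_eq,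
        (rule sum.cong[OF refl], simp)+)
qed

lemma ev_zpow: "ok \<rho> \<Longrightarrow> ev xs Z (zpow_exp d) \<rho> = int Z ^ (2 ^ d)"
  by (induction d) (simp_all add: env_ok_def power_add[symmetric] mult_2)

lemma holds_atom:
  assumes "ok \<rho>" "\<rho> x = int u" "u < length C" "x \<notin> {PP, CC}"
  shows "holds xs Z (atom_exp x) \<rho> \<longleftrightarrow> atom (C ! u)"
  using ev_arity[OF assms] by (auto simp: atom_exp_def atom_def large_def)

lemma ev_profile:
  "ok \<rho> \<Longrightarrow> \<rho> (NU d) = int u \<Longrightarrow> u < length C \<Longrightarrow> shallow C d t u \<Longrightarrow>
    ev xs Z (profile_exp r d) \<rho> = profile C (int Z) (true_inputs r \<rho>) d u"
proof (induction d arbitrary: \<rho> u t)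
  case 0
  then show ?case using ev_defect[OF 0] by simp
next
  case (Suc d)
  note a = Suc.prems(1-3)
  have at: "holds xs Z (atom_exp (NU (Suc d))) \<rho> \<longleftrightarrow> atom (C ! u)" using holds_atom[OF a] by simp
  show ?case
  proof (cases "atom (C ! u)")
    case True
    then show ?thesis using at ev_defect[OF Suc.prems, of r] by simp
  next
    case False
    then have sm: "\<not> large (C ! u)" by (simp add: atom_def)
    have IH: "ev xs Z (profile_exp r d) (\<rho>(NU d := int (preds (C ! u) ! i))) =
        profile C (int Z) (true_inputs r \<rho>) d (preds (C ! u) ! i)" if "i < length (preds (C ! u))" for i
    proof -
      have "shallow C d t (preds (C ! u) ! i)" using Suc.prems(4) sm nth_mem[OF that] by simp
      from Suc.IH[of "\<rho>(NU d := int (preds (C ! u) ! i))", OF _ _ preds_less[OF a(3) that] this] a(1) show ?thesis by (simp del: fun_upd_apply add: fun_upd_same)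
    qed
    note ar = ev_arity[OF a]
    from False show ?thesis
    proof (cases rule: small_preds)
      case (1 v)
      then show ?thesis using at False IH[of 0] ar ev_at_pred(1)[OF a, of 0] by simp
    next
      case (2 v w)
      then show ?thesis using at False IH[of 0] IH[of 1] ar ev_at_pred(1)[OF a, of 0] ev_at_pred(1)[OF a, of 1] ev_zpow[OF a(1)] by simp
    qed
  qed
qed

lemma holds_atom_good:
  assumes "ok \<rho>" "\<rho> (NU d) = int u" "u < length C"
  shows "holds xs Z (atom_good_exp d) \<rho> \<longleftrightarrow> atom_good (C ! u) (\<rho> (NV d))"
  using ev_tag[OF assms] by (cases "C ! u") (auto simp: atom_good_exp_def atom_good_def)

lemma holds_good:
  "ok \<rho> \<Longrightarrow> \<rho> (NU d) = int u \<Longrightarrow> u < length C \<Longrightarrow>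
    holds xs Z (good_exp d) \<rho> \<longleftrightarrow> good C (int Z) d u (\<rho> (NV d))"
proof (induction d arbitrary: \<rho> u)
  case 0
  then show ?case using holds_atom_good[OF 0] by simp
next
  case (Suc d)
  note a = Suc.prems
  have at: "holds xs Z (atom_exp (NU (Suc d))) \<rho> \<longleftrightarrow> atom (C ! u)" using holds_atom[OF a] by simp
  have tag: "ev xs Z (tag_exp (NU (Suc d))) \<rho> = gate_tag (C ! u)" using ev_tag[OF a] by simp
  have ar: "ev xs Z (arity_exp (NU (Suc d))) \<rho> = int (length (preds (C ! u)))" using ev_arity[OF a] by simp
  have IH: "holds xs Z (good_exp d) (\<rho>(NU d := int (preds (C ! u) ! i), NV d := v)) \<longleftrightarrow>
      good C (int Z) d (preds (C ! u) ! i) v" if "i < length (preds (C ! u))" for i v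
    using Suc.IH[of "\<rho>(NU d := int (preds (C ! u) ! i), NV d := v)", OF _ _ preds_less[OF a(3) that]] a(1) by (simp del: fun_upd_apply add: fun_upd_same fun_upd_other)
  have zp: "ev xs Z (zpow_exp d) (\<rho>(NU d := v)) = int Z ^ (2 ^ d)" for v using ev_zpow[of "\<rho>(NU d := v)" d] a by simp
  show ?case
  proof (cases "atom (C ! u)")
    case True
    then show ?thesis using at holds_atom_good[OF a] by simp
  next
    case False
    from False show ?thesis
    proof (cases rule: small_preds)
      case (1 v)
      then show ?thesis using at False IH[of 0] tag ar ev_at_pred(2)[OF a, of 0] by (cases "C ! u") auto
    next
      case (2 v w)
      then show ?thesis using at False IH[of 0] IH[of 1] tag ar zp ev_at_pred(2)[OF a, of 0] ev_at_pred(2)[OF a, of 1]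
        by (cases "C ! u") (auto simp: minus_mult_div_eq_mod)
    qed
  qed
qed

lemma ev_root:
  assumes "ok \<rho>" shows "ev xs Z root_exp \<rho> = int (length C - 1)"
proof -
  have s: "ev xs Z (start_exp NB) (\<rho>(NB := int u)) = gate_start xs Z u" if "u < Z" for u
    using assms that by (intro ev_start) (auto simp: env_ok_def)
  have "gate_start xs Z u < int (length xs) \<longleftrightarrow> u < length C" for u
    using gate_start_encode[of u C Z] gate_start_encode_ge[of C u Z] offset_less[of u C] Z
    by (cases "u < length C") auto
  then have "ev xs Z count_exp \<rho> = (\<Sum>u<Z. if u < length C then 1 else 0)"
    unfolding count_exp_def ev.simps(10) using assms
    by (intro sum.cong refl) (simp add: s env_ok_def)
  also have "\<dots> = (\<Sum>u<length C. 1)" using length_C by (intro sum.mono_neutral_cong_right) auto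
  finally show ?thesis using wf by (simp add: root_exp_def wf_circuit_def of_nat_diff Suc_le_eq)
qed

text \<open>The entries from \<open>a\<close> on stay in the set while the alternating sum runs over
  the first \<open>a\<close> entries. Setting \<open>NX a\<close> to 0 removes its element, as by
  distinctness no second copy remains; so the two evaluations in \<open>mob_exp\<close> are the two
  terms of \<open>mob_insert\<close>. Padding entries add nothing.\<close>

lemma ev_mob:
  assumes sh: "shallow C d 1 (length C - 1)"
  shows "ok \<rho> \<Longrightarrow> a \<le> r \<Longrightarrow> (\<And>b. b < a \<Longrightarrow> 0 \<le> \<rho> (NX b)) \<Longrightarrow>
    (\<And>b c. b < a \<Longrightarrow> c < r \<Longrightarrow> c \<noteq> b \<Longrightarrow> 0 < \<rho> (NX b) \<Longrightarrow> \<rho> (NX c) \<noteq> \<rho> (NX b)) \<Longrightarrow>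
    ev xs Z (mob_exp r d a) \<rho> =
      mob (\<lambda>Y. profile C (int Z) {u. Suc u \<in> Y \<union> var_set a r \<rho>} d (length C - 1)) (var_set 0 a \<rho>)"
proof (induction a arbitrary: \<rho>)
  case 0
  have "length C - 1 < length C" using wf by (auto simp: wf_circuit_def)
  then have "ev xs Z (profile_exp r d) (\<rho>(NU d := int (length C - 1))) =
      profile C (int Z) (true_inputs r \<rho>) d (length C - 1)"
    using ev_profile[OF _ _ _ sh, of "\<rho>(NU d := int (length C - 1))" r] 0 by simp
  moreover have "var_set 0 0 \<rho> = {}" by (auto simp: var_set_def)
  ultimately show ?case using ev_root[OF 0(1)] by (simp add: true_inputs_def)
next
  case (Suc a)
  let ?f = "\<lambda>Y. profile C (int Z) {u. Suc u \<in> Y} d (length C - 1)"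
  have iv: "{a..<r} = insert a {Suc a..<r}" "{0..<Suc a} = insert a {0..<a}" using Suc.prems(2) by auto
  have IH: "ev xs Z (mob_exp r d a) \<rho> = mob (\<lambda>Y. ?f (Y \<union> var_set a r \<rho>)) (var_set 0 a \<rho>)"
    using Suc.prems by (intro Suc.IH) auto
  show ?case
  proof (cases "0 < \<rho> (NX a)")
    case False
    then have "\<rho> (NX a) = 0" using Suc.prems(3)[of a] by simp
    then have "var_set (Suc a) r \<rho> = var_set a r \<rho>" "var_set 0 (Suc a) \<rho> = var_set 0 a \<rho>"
      unfolding var_set_def iv by auto
    then show ?thesis using IH False by (simp add: holds_def)
  next
    case True
    then obtain x where x: "\<rho> (NX a) = int x" "0 < x" by (metis of_nat_0_less_iff zero_less_imp_eq_int)
    let ?\<rho> = "\<rho>(NX a := 0)"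
    have IH0: "ev xs Z (mob_exp r d a) ?\<rho> = mob (\<lambda>Y. ?f (Y \<union> var_set a r ?\<rho>)) (var_set 0 a ?\<rho>)"
    proof (rule Suc.IH)
      show "ok ?\<rho>" using Suc.prems(1) by (simp del: fun_upd_apply)
    qed (use Suc.prems in \<open>auto split: if_splits\<close>)
    have vs: "var_set a r ?\<rho> = var_set (Suc a) r \<rho>" "var_set 0 a ?\<rho> = var_set 0 a \<rho>"
      unfolding var_set_def iv by auto
    have ins: "var_set a r \<rho> = insert x (var_set (Suc a) r \<rho>)" "var_set 0 (Suc a) \<rho> = insert x (var_set 0 a \<rho>)"
      using x unfolding var_set_def iv by auto
    have nin: "x \<notin> var_set 0 a \<rho>"
    proof
      assume "x \<in> var_set 0 a \<rho>"
      then obtain c where "c < a" "\<rho> (NX c) = int x" by (auto simp: var_set_def)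
      then show False using Suc.prems(4)[of a c] Suc.prems(2) x by auto
    qed
    have fin: "finite (var_set 0 a \<rho>)"
      by (rule finite_subset[of _ "(\<lambda>c. nat (\<rho> (NX c))) ` {..<a}"]) (force simp: var_set_def)+
    have un: "insert x Y \<union> var_set (Suc a) r \<rho> = Y \<union> var_set a r \<rho>" for Y unfolding ins by auto
    have M: "mob (\<lambda>Y. ?f (Y \<union> var_set (Suc a) r \<rho>)) (insert x (var_set 0 a \<rho>)) =
        mob (\<lambda>Y. ?f (Y \<union> var_set a r \<rho>)) (var_set 0 a \<rho>) - mob (\<lambda>Y. ?f (Y \<union> var_set (Suc a) r \<rho>)) (var_set 0 a \<rho>)"
      by (simp only: mob_insert[OF fin nin] un)
    have "holds xs Z (Vr (NX a)) \<rho>" using True by (simp add: holds_def)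
    then show ?thesis using IH IH0 unfolding vs ins(2) M mob_exp.simps ev_Ite by (simp only: if_True ev.simps)
  qed
qed

end

section \<open>Sums and outputs over tuples\<close>

definition tuples :: "nat \<Rightarrow> nat \<Rightarrow> nat list set" where
  "tuples n Z = {l. set l \<subseteq> {..<Z} \<and> length l = n}"

fun assign :: "('v \<Rightarrow> int) \<Rightarrow> 'v list \<Rightarrow> nat list \<Rightarrow> 'v \<Rightarrow> int" where
  "assign \<rho> (x # ns) (i # l) = assign (\<rho>(x := int i)) ns l"
| "assign \<rho> _ _ = \<rho>"

primrec sum_over :: "'v list \<Rightarrow> 'v exp \<Rightarrow> 'v exp" where
  "sum_over [] e = e"
| "sum_over (x # ns) e = Summ x (sum_over ns e)"

primrec for_over :: "'v list \<Rightarrow> 'v out \<Rightarrow> 'v out" where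
  "for_over [] w = w"
| "for_over (x # ns) w = For x (for_over ns w)"

lemma tuples_0: "tuples 0 Z = {[]}"
  by (auto simp: tuples_def)

lemma tuples_Suc: "tuples (Suc n) Z = (\<lambda>(i, l). i # l) ` ({..<Z} \<times> tuples n Z)"
proof (intro equalityI subsetI)
  fix l assume "l \<in> tuples (Suc n) Z"
  then show "l \<in> (\<lambda>(i, l). i # l) ` ({..<Z} \<times> tuples n Z)" by (cases l) (auto simp: tuples_def)
qed (auto simp: tuples_def)

lemma finite_tuples [simp]: "finite (tuples n Z)"
  using finite_lists_length_eq[of "{..<Z}" n] by (simp add: tuples_def)

lemma card_tuples: "card (tuples n Z) = Z ^ n"
  using card_lists_length_eq[of "{..<Z}" n] by (simp add: tuples_def)

lemma ev_sum_over: "ev xs Z (sum_over ns e) \<rho> = (\<Sum>l\<in>tuples (length ns) Z. ev xs Z e (assign \<rho> ns l))"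
proof (induction ns arbitrary: \<rho>)
  case (Cons x ns)
  have "(\<Sum>l\<in>tuples (Suc (length ns)) Z. ev xs Z e (assign \<rho> (x # ns) l)) =
      (\<Sum>(i, l)\<in>{..<Z} \<times> tuples (length ns) Z. ev xs Z e (assign (\<rho>(x := int i)) ns l))"
    unfolding tuples_Suc by (subst sum.reindex) (auto simp: inj_on_def split_def)
  also have "\<dots> = (\<Sum>i<Z. \<Sum>l\<in>tuples (length ns) Z. ev xs Z e (assign (\<rho>(x := int i)) ns l))"
    by (rule sum.cartesian_product[symmetric])
  finally show ?case using Cons by (simp del: fun_upd_apply)
qed (simp add: tuples_0)

lemma set_outs_for_over: "set (outs xs Z (for_over ns w) \<rho>) = (\<Union>l\<in>tuples (length ns) Z. set (outs xs Z w (assign \<rho> ns l)))"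
proof (induction ns arbitrary: \<rho>)
  case (Cons x ns)
  have "set (outs xs Z (for_over (x # ns) w) \<rho>) = (\<Union>i<Z. set (outs xs Z (for_over ns w) (\<rho>(x := int i))))"
    by (simp add: atLeast0LessThan)
  also have "\<dots> = (\<Union>i<Z. \<Union>l\<in>tuples (length ns) Z. set (outs xs Z w (assign \<rho> (x # ns) (i # l))))"
    unfolding Cons by simp
  also have "\<dots> = (\<Union>l\<in>tuples (length (x # ns)) Z. set (outs xs Z w (assign \<rho> (x # ns) l)))"
    unfolding list.size add_0_right add_Suc_right tuples_Suc by (auto simp del: fun_upd_apply; metis lessThan_iff)
  finally show ?case .
qed (simp add: tuples_0)

lemma assign_other: "x \<notin> set ns \<Longrightarrow> assign \<rho> ns l x = \<rho> x"
  by (induction \<rho> ns l rule: assign.induct) auto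

lemma assign_nth:
  "distinct ns \<Longrightarrow> length l = length ns \<Longrightarrow> a < length ns \<Longrightarrow> assign \<rho> ns l (ns ! a) = int (l ! a)"
proof (induction \<rho> ns l arbitrary: a rule: assign.induct)
  case (1 \<rho> x ns i l)
  then show ?case by (cases a) (auto simp: assign_other fun_upd_same simp del: fun_upd_apply)
qed auto

lemma assign_map:
  assumes "inj N" "l \<in> tuples r Z" "a < r"
  shows "assign \<rho> (map N [0..<r]) l (N a) = int (l ! a)"
proof -
  have "distinct (map N [0..<r])" using assms(1) by (auto simp: distinct_map intro: inj_on_subset)
  from assign_nth[OF this, of l a] assms show ?thesis by (simp add: tuples_def)
qed

lemma env_ok_assign: "set ns \<inter> {VN, VK, VZ} = {} \<Longrightarrow> env_ok xs k Z (assign \<rho> ns l) = env_ok xs k Z \<rho>"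
  by (auto simp: env_ok_def assign_other)

lemma nth_tuples: "l \<in> tuples r Z \<Longrightarrow> a < r \<Longrightarrow> l ! a < Z"
  by (auto simp: tuples_def dest: nth_mem)

lemma ex_digits: "v < Z ^ r \<Longrightarrow> \<exists>l\<in>tuples r Z. v = (\<Sum>a<r. l ! a * Z ^ a)"
proof (induction r arbitrary: v)
  case 0
  then show ?case by (simp add: tuples_0)
next
  case (Suc r)
  have Z: "0 < Z ^ r" using Suc.prems by (cases "Z ^ r") auto
  obtain l where l: "l \<in> tuples r Z" "v mod Z ^ r = (\<Sum>a<r. l ! a * Z ^ a)"
    using Suc.IH[of "v mod Z ^ r"] Z by auto
  have q: "v div Z ^ r < Z" using Suc.prems by (simp add: less_mult_imp_div_less mult.commute)
  have len: "length l = r" using l(1) by (simp add: tuples_def)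
  have "(\<Sum>a<Suc r. (l @ [v div Z ^ r]) ! a * Z ^ a) = (\<Sum>a<r. l ! a * Z ^ a) + v div Z ^ r * Z ^ r"
    using len by (simp add: nth_append)
  also have "\<dots> = v" unfolding l(2)[symmetric] by (rule mod_div_mult_eq)
  finally have "v = (\<Sum>a<Suc r. (l @ [v div Z ^ r]) ! a * Z ^ a)" ..
  moreover have "l @ [v div Z ^ r] \<in> tuples (Suc r) Z" using l(1) q by (auto simp: tuples_def)
  ultimately show ?case by blast
qed

subsection \<open>Padded sets\<close>

text \<open>A local characterisation of padded lists: neighbours increase unless both are 0. For
  fixed \<open>r\<close> this is a formula of fixed size.\<close>

abbreviation canonical :: "nat list \<Rightarrow> bool" where
  "canonical \<equiv> successively (\<lambda>i j. i < j \<or> i = 0 \<and> j = 0)"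

lemma canonical_sorted:
  "canonical (x # l) \<Longrightarrow> 0 < x \<Longrightarrow> sorted_wrt (<) (x # l)"
proof (induction l arbitrary: x)
  case (Cons y l)
  have "x < y" "canonical (y # l)" using Cons.prems by auto
  with Cons.IH[of y] have "sorted_wrt (<) (y # l)" by simp
  with \<open>x < y\<close> show ?case by (auto intro: less_trans)
qed simp

text \<open>Once an entry is positive, all later ones increase strictly; this final part lists the
  set, and only zeros precede it.\<close>

lemma canonical_imp_pad:
  "canonical l \<Longrightarrow> \<exists>U. finite U \<and> 0 \<notin> U \<and> card U \<le> length l \<and> U \<subseteq> set l \<and> l = pad (length l) U"
proof (induction l)
  case Nil
  show ?case by (intro exI[of _ "{}"]) (simp add: pad_def)
next
  case (Cons x l)
  show ?case
  proof (cases "x = 0")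
    case True
    have "canonical l" using Cons.prems by (cases l) auto
    from Cons.IH[OF this] obtain U where
      U: "finite U" "0 \<notin> U" "card U \<le> length l" "U \<subseteq> set l" "l = pad (length l) U" by blast
    then have "pad (Suc (length l)) U = 0 # pad (length l) U" by (simp add: pad_def Suc_diff_le)
    then have "x # l = pad (length (x # l)) U" using U(5) True by simp
    moreover have "card U \<le> length (x # l)" "U \<subseteq> set (x # l)" using U(3,4) by auto
    ultimately show ?thesis using U(1,2) by blast
  next
    case False
    then have s: "sorted_wrt (<) (x # l)" using canonical_sorted[OF Cons.prems] by simp
    have "sorted_list_of_set (set m) = m" if "sorted_wrt (<) m" for m :: "nat list"
      using that by (intro strict_sorted_equal) auto
    from this[OF s] have "sorted_list_of_set (set (x # l)) = x # l" .
    moreover have "card (set (x # l)) = length (x # l)"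
      using s by (intro distinct_card) (auto simp: strict_sorted_iff)
    moreover have "0 \<notin> set (x # l)" using s False by auto
    ultimately show ?thesis by (intro exI[of _ "set (x # l)"]) (simp add: pad_def del: set_simps)
  qed
qed

lemma canonical_pad:
  assumes "finite U" "0 \<notin> U" shows "canonical (pad r U)"
proof -
  have "canonical (sorted_list_of_set U)"
    using sorted_wrt_nth_less[OF strict_sorted_list_of_set[of U]] by (auto simp: successively_conv_nth)
  moreover have "0 < hd (sorted_list_of_set U)" if "sorted_list_of_set U \<noteq> []"
    using hd_in_set[OF that] assms by (metis gr0I set_sorted_list_of_set)
  ultimately show ?thesis
    unfolding pad_def successively_append_iff by (auto simp: successively_conv_nth)
qed

lemma pad_nth_eq_0:
  assumes "finite U" "0 \<notin> U" "a < r" "card U \<le> r" shows "pad r U ! a = 0 \<longleftrightarrow> a < r - card U"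
proof (cases "a < r - card U")
  case False
  have "sorted_list_of_set U ! (a - (r - card U)) \<in> set (sorted_list_of_set U)"
    using False assms by (intro nth_mem) simp
  then have "sorted_list_of_set U ! (a - (r - card U)) \<noteq> 0" using assms by (metis set_sorted_list_of_set)
  then show ?thesis using False by (simp add: pad_def nth_append)
qed (simp add: pad_def nth_append)

lemma pad_tuples: "finite U \<Longrightarrow> card U \<le> r \<Longrightarrow> U \<subseteq> {..<Z} \<Longrightarrow> 0 < Z \<Longrightarrow> pad r U \<in> tuples r Z"
  unfolding tuples_def using set_pad(1)[of U r] length_pad[of U r] by blast

lemma canonical_bounded_iff:
  assumes "l \<in> tuples r Z" "k < Z"
  shows "canonical l \<and> (\<forall>a<r. l ! a \<le> k) \<longleftrightarrow> l \<in> pad r ` small_sets r k"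
proof
  assume L: "canonical l \<and> (\<forall>a<r. l ! a \<le> k)"
  from canonical_imp_pad[OF conjunct1[OF L]] obtain U where
    U: "finite U" "0 \<notin> U" "card U \<le> length l" "U \<subseteq> set l" "l = pad (length l) U" by blast
  have len: "length l = r" using assms(1) by (simp add: tuples_def)
  have "x \<in> {1..k}" if "x \<in> U" for x
  proof -
    have "x \<in> set l" using that U(4) by blast
    then obtain a where "a < r" "x = l ! a" unfolding in_set_conv_nth len by blast
    then have "x \<le> k" using L by simp
    moreover have "1 \<le> x" using that U(2) by (cases x) auto
    ultimately show ?thesis by simp
  qed
  then have "U \<in> small_sets r k" using U(3) len by (auto simp: small_sets_def)
  moreover have "l = pad r U" using U(5) unfolding len .
  ultimately show "l \<in> pad r ` small_sets r k" by (rule rev_image_eqI)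
next
  assume "l \<in> pad r ` small_sets r k"
  then obtain U where U: "U \<in> small_sets r k" "l = pad r U" by blast
  note f = small_setsD[OF U(1)]
  have "l ! a \<le> k" if "a < r" for a
  proof -
    have "l ! a \<in> set l" using that f U(2) by (intro nth_mem) (simp add: length_pad)
    moreover have "set l \<subseteq> insert 0 U" unfolding U(2) using f by (intro set_pad(1)) simp
    ultimately have "l ! a \<in> insert 0 U" by (rule subsetD[rotated])
    then show ?thesis using f by auto
  qed
  moreover have "canonical l" unfolding U(2) using f by (intro canonical_pad) auto
  ultimately show "canonical l \<and> (\<forall>a<r. l ! a \<le> k)" by blast
qed

lemma inj_on_pad: "inj_on (pad r) (small_sets r k)"
  using small_setsD by (intro inj_onI) (auto dest!: pad_inj)

lemma pad_small_sets_tuples: "k < Z \<Longrightarrow> pad r ` small_sets r k \<subseteq> tuples r Z"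
  using small_setsD by (fastforce intro!: pad_tuples)

text \<open>Bounds the new parameter by a polynomial in \<open>k\<close> of degree \<open>r\<close>
  that does not depend on the circuit.\<close>

lemma card_small_sets: "card (small_sets r k) \<le> (k + 1) ^ r"
  using card_inj_on_le[OF inj_on_pad pad_small_sets_tuples[of k "k + 1" r]] by (simp add: card_tuples)

lemma sum_small_sets:
  assumes "k < Z" "\<And>l. l \<in> tuples r Z \<Longrightarrow> P l \<longleftrightarrow> l \<in> pad r ` small_sets r k"
  shows "(\<Sum>l\<in>tuples r Z. if P l then f l else 0) = (\<Sum>U\<in>small_sets r k. (f (pad r U) :: int))"
proof -
  have "(\<Sum>l\<in>tuples r Z. if P l then f l else 0) = (\<Sum>l\<in>pad r ` small_sets r k. f l)"
    using assms(2) pad_small_sets_tuples[OF assms(1), of r] by (intro sum.mono_neutral_cong_right) auto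
  also have "\<dots> = (\<Sum>U\<in>small_sets r k. f (pad r U))" by (simp add: sum.reindex[OF inj_on_pad])
  finally show ?thesis .
qed

subsection \<open>Expressions for the coordinates\<close>

primrec canonical_exp :: "(nat \<Rightarrow> nm) \<Rightarrow> nat \<Rightarrow> nm exp" where
  "canonical_exp N 0 = Cst 1"
| "canonical_exp N (Suc a) = Conj (Disj (Less (Vr (N a)) (Vr (N (Suc a))))
     (Conj (Equ (Vr (N a)) (Cst 0)) (Equ (Vr (N (Suc a))) (Cst 0)))) (canonical_exp N a)"

primrec bounded_exp :: "nat \<Rightarrow> nm exp" where
  "bounded_exp 0 = Cst 1"
| "bounded_exp (Suc a) = Conj (Leq (Vr (NJ a)) (Vr VK)) (bounded_exp a)"

definition index_exp :: "nat \<Rightarrow> nm exp" where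
  "index_exp r = Conj (canonical_exp NJ (r - 1)) (bounded_exp r)"

primrec pow_exp :: "nm exp \<Rightarrow> nat \<Rightarrow> nm exp" where
  "pow_exp e 0 = Cst 1"
| "pow_exp e (Suc n) = Mul e (pow_exp e n)"

text \<open>The power \<open>B ^ (Z ^ a)\<close> by \<open>a\<close> nested products of
  \<open>Z\<close> factors, as the exponent is not a constant of the program. The dummy variable
  \<open>PP\<close> is only a loop counter.\<close>

primrec base_exp :: "nat \<Rightarrow> nat \<Rightarrow> nm exp" where
  "base_exp r 0 = pow_exp (Vr VZ) (3 * r + 3)"
| "base_exp r (Suc a) = Prd PP (base_exp r a)"

text \<open>The value of \<open>g\<close> raised to the value of \<open>x\<close>: a product in
  which just that many factors differ from 1.\<close>

definition digit_exp :: "nm exp \<Rightarrow> nm \<Rightarrow> nm exp" where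
  "digit_exp g x = Prd PP (Ite (Less (Vr PP) (Vr x)) g (Cst 1))"

primrec code_exp :: "nat \<Rightarrow> nat \<Rightarrow> nm exp" where
  "code_exp r 0 = Cst 1"
| "code_exp r (Suc a) = Mul (code_exp r a) (digit_exp (base_exp r a) (NJ a))"

definition CS_exp :: "nat \<Rightarrow> nm exp" where "CS_exp r = Mul (base_exp r r) (code_exp r r)"
definition CE_exp :: "nat \<Rightarrow> nat \<Rightarrow> nm exp" where "CE_exp r a = Mul (pow_exp (base_exp r r) (a + 2)) (code_exp r r)"
definition CV_exp :: "nat \<Rightarrow> nm exp" where "CV_exp r = Mul (pow_exp (base_exp r r) (r + 2)) (digit_exp (base_exp r 0) NI)"

primrec link_exp :: "nat \<Rightarrow> nat \<Rightarrow> nm exp" where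
  "link_exp r 0 = Cst 0"
| "link_exp r (Suc a) = Add (link_exp r a) (Ite (Equ (Vr (NJ a)) (Vr NI)) (CE_exp r a) (Cst 0))"

text \<open>Collects the coordinates \<open>CE\<close> that test the index \<open>NI\<close>; in
  \<open>LB\<close> they all carry the same digit, minus the named element.\<close>

definition links_exp :: "nat \<Rightarrow> nm exp" where
  "links_exp r = sum_over (map NJ [0..<r]) (Ite (index_exp r) (link_exp r r) (Cst 0))"

definition range_exp :: "nm exp" where "range_exp = Conj (Leq (Cst 1) (Vr NI)) (Leq (Vr NI) (Vr VK))"

definition slots_exp :: "nat \<Rightarrow> nm exp" where
  "slots_exp r = Add (sum_over (map NJ [0..<r]) (Ite (index_exp r) (CS_exp r) (Cst 0)))
    (Summ NI (Ite range_exp (CV_exp r) (Cst 0)))"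

definition count_slots_exp :: "nat \<Rightarrow> nm exp" where
  "count_slots_exp r = Add (Add (Cst 1) (sum_over (map NJ [0..<r]) (Ite (index_exp r) (Cst 1) (Cst 0)))) (Vr VK)"

lemma holds_canonical:
  assumes "\<And>a. a < r \<Longrightarrow> \<rho> (N a) = int (l ! a)" "length l = r" "m < r \<or> m = 0"
  shows "holds xs Z (canonical_exp N m) \<rho> \<longleftrightarrow> (\<forall>a<m. l ! a < l ! Suc a \<or> l ! a = 0 \<and> l ! Suc a = 0)"
  using assms(3) assms(1) by (induction m) (auto simp: less_Suc_eq)

lemma holds_canonical_list:
  assumes "\<And>a. a < r \<Longrightarrow> \<rho> (N a) = int (l ! a)" "length l = r"
  shows "holds xs Z (canonical_exp N (r - 1)) \<rho> \<longleftrightarrow> canonical l"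
proof -
  have "(\<forall>a<r - 1. P a) \<longleftrightarrow> (\<forall>a. Suc a < r \<longrightarrow> P a)" for P by (auto simp: less_diff_conv)
  moreover have "r - 1 < r \<or> r - 1 = 0" by arith
  then have "holds xs Z (canonical_exp N (r - 1)) \<rho> \<longleftrightarrow>
      (\<forall>a<r - 1. l ! a < l ! Suc a \<or> l ! a = 0 \<and> l ! Suc a = 0)"
    using assms by (intro holds_canonical) auto
  ultimately show ?thesis unfolding successively_conv_nth assms(2) by simp
qed

lemma ev_pow: "ev xs Z (pow_exp e n) \<rho> = ev xs Z e \<rho> ^ n"
  by (induction n) auto

context
  fixes xs :: "int list" and k Z r :: nat and \<rho> :: "nm \<Rightarrow> int" and B :: int
  assumes ok: "env_ok xs k Z \<rho>" and k: "k < Z" and B: "B = int Z ^ (3 * r + 3)"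
begin

lemma ev_base: "env_ok xs k Z \<rho>' \<Longrightarrow> ev xs Z (base_exp r a) \<rho>' = B ^ (Z ^ a)"
proof (induction a arbitrary: \<rho>')
  case 0
  then show ?case by (simp add: ev_pow B env_ok_def)
next
  case (Suc a)
  then show ?case by (simp add: power_mult[symmetric] mult.commute del: fun_upd_apply)
qed

lemma ev_digit:
  assumes "env_ok xs k Z \<rho>'" "\<rho>' x = int i" "i \<le> Z" "x \<noteq> PP"
  shows "ev xs Z (digit_exp (base_exp r a) x) \<rho>' = B ^ (i * Z ^ a)"
proof -
  have "ev xs Z (digit_exp (base_exp r a) x) \<rho>' = (\<Prod>j<Z. if j < i then B ^ (Z ^ a) else 1)"
    unfolding digit_exp_def ev.simps(11)
  proof (intro prod.cong refl)
    fix j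
    have "env_ok xs k Z (\<rho>'(PP := int j))" using assms(1) by simp
    from ev_base[OF this, of a] show "ev xs Z (Ite (Less (Vr PP) (Vr x)) (base_exp r a) (Cst 1)) (\<rho>'(PP := int j)) =
        (if j < i then B ^ (Z ^ a) else 1)"
      using assms by simp
  qed
  also have "\<dots> = (\<Prod>j<i. B ^ (Z ^ a))" using assms(3) by (intro prod.mono_neutral_cong_right) auto
  also have "\<dots> = B ^ (i * Z ^ a)" by (simp add: power_mult[symmetric] mult.commute)
  finally show ?thesis .
qed

lemma ev_code:
  assumes "env_ok xs k Z \<rho>'" "\<And>b. b < r \<Longrightarrow> \<rho>' (NJ b) = int (l ! b)" "l \<in> tuples r Z" "a \<le> r"
  shows "ev xs Z (code_exp r a) \<rho>' = B ^ (\<Sum>b<a. l ! b * Z ^ b)"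
  using assms(4)
proof (induction a)
  case (Suc a)
  have "ev xs Z (digit_exp (base_exp r a) (NJ a)) \<rho>' = B ^ (l ! a * Z ^ a)"
    using Suc.prems assms nth_tuples[OF assms(3), of a] by (intro ev_digit) auto
  then show ?case using Suc by (simp add: power_add)
qed simp

abbreviation "jn \<equiv> map NJ [0..<r]"

lemma inj_names: "inj NJ" "inj NX" "inj NG" by (auto simp: inj_def)

lemma ok_jn: "env_ok xs k Z (assign \<rho> jn l)"
  using ok by (subst env_ok_assign) auto

lemma jn_nth: "l \<in> tuples r Z \<Longrightarrow> a < r \<Longrightarrow> assign \<rho> jn l (NJ a) = int (l ! a)"
  by (rule assign_map[OF inj_names(1)])

lemma pad_in_tuples: "U \<in> small_sets r k \<Longrightarrow> pad r U \<in> tuples r Z"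
  using pad_small_sets_tuples[OF k] by blast

lemma holds_index:
  assumes "l \<in> tuples r Z" "env_ok xs k Z \<rho>'" "\<And>a. a < r \<Longrightarrow> \<rho>' (NJ a) = int (l ! a)"
  shows "holds xs Z (index_exp r) \<rho>' \<longleftrightarrow> l \<in> pad r ` small_sets r k"
proof -
  have len: "length l = r" using assms(1) by (simp add: tuples_def)
  have "holds xs Z (bounded_exp m) \<rho>' \<longleftrightarrow> (\<forall>a<m. l ! a \<le> k)" if "m \<le> r" for m
    using that assms(2,3) by (induction m) (auto simp: less_Suc_eq env_ok_def)
  then show ?thesis
    unfolding index_exp_def canonical_bounded_iff[OF assms(1) k, symmetric]
    using holds_canonical_list[OF assms(3) len, of xs Z] by simp
qed

lemma ev_CS:
  assumes "l \<in> tuples r Z" "env_ok xs k Z \<rho>'" "\<And>a. a < r \<Longrightarrow> \<rho>' (NJ a) = int (l ! a)" "l = pad r U"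
  shows "ev xs Z (CS_exp r) \<rho>' = B ^ coord_pos r Z (CS U)"
    "ev xs Z (CE_exp r a) \<rho>' = B ^ coord_pos r Z (CE U a)"
proof -
  have c: "ev xs Z (code_exp r r) \<rho>' = B ^ code r Z U"
    using ev_code[OF assms(2) assms(3) assms(1) order_refl] assms(4) by (simp add: code_def)
  show "ev xs Z (CS_exp r) \<rho>' = B ^ coord_pos r Z (CS U)"
    "ev xs Z (CE_exp r a) \<rho>' = B ^ coord_pos r Z (CE U a)"
    unfolding CS_exp_def CE_exp_def ev.simps ev_pow coord_pos.simps c ev_base[OF assms(2)]
    by (simp_all only: power_add power_mult)
qed

lemma ev_CV:
  assumes "env_ok xs k Z \<rho>'" "\<rho>' NI = int i" "i \<le> k"
  shows "ev xs Z (CV_exp r) \<rho>' = B ^ coord_pos r Z (CV i)"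
  using ev_digit[OF assms(1,2), of 0] ev_base[OF assms(1), of r] assms(3) k
  by (simp add: CV_exp_def ev_pow power_add power_mult)

lemma ev_sum_index:
  assumes "\<And>U. U \<in> small_sets r k \<Longrightarrow> ev xs Z e (assign \<rho> jn (pad r U)) = f U"
  shows "ev xs Z (sum_over jn (Ite (index_exp r) e (Cst 0))) \<rho> = (\<Sum>U\<in>small_sets r k. f U)"
proof -
  have "ev xs Z (sum_over jn (Ite (index_exp r) e (Cst 0))) \<rho> =
      (\<Sum>l\<in>tuples r Z. if holds xs Z (index_exp r) (assign \<rho> jn l) then ev xs Z e (assign \<rho> jn l) else 0)"
    by (simp add: ev_sum_over cong: if_cong)
  also have "\<dots> = (\<Sum>U\<in>small_sets r k. ev xs Z e (assign \<rho> jn (pad r U)))"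
    using holds_index ok_jn jn_nth by (intro sum_small_sets[OF k]) blast
  finally show ?thesis using assms by simp
qed

lemma ev_count_slots: "ev xs Z (count_slots_exp r) \<rho> = int (card (slots r k))"
proof -
  have "ev xs Z (sum_over jn (Ite (index_exp r) (Cst 1) (Cst 0))) \<rho> = (\<Sum>U\<in>small_sets r k. 1)"
    by (rule ev_sum_index) simp
  moreover have "card (slots r k) = 1 + card (small_sets r k) + k"
    using sum_slots[of "\<lambda>_. 1 :: nat" r k] by simp
  ultimately show ?thesis using ok by (simp add: count_slots_exp_def env_ok_def)
qed

lemma ev_slots:
  "ev xs Z (slots_exp r) \<rho> =
    (\<Sum>U\<in>small_sets r k. B ^ coord_pos r Z (CS U)) + (\<Sum>i=1..k. B ^ coord_pos r Z (CV i))"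
proof -
  have "ev xs Z (sum_over jn (Ite (index_exp r) (CS_exp r) (Cst 0))) \<rho> = (\<Sum>U\<in>small_sets r k. B ^ coord_pos r Z (CS U))"
    using ev_CS(1) pad_in_tuples ok_jn jn_nth by (intro ev_sum_index) blast
  moreover have "ev xs Z (Summ NI (Ite range_exp (CV_exp r) (Cst 0))) \<rho> =
      (\<Sum>i<Z. if 1 \<le> i \<and> i \<le> k then B ^ coord_pos r Z (CV i) else 0)"
    unfolding ev.simps(10)
  proof (intro sum.cong refl)
    fix i
    have o: "env_ok xs k Z (\<rho>(NI := int i))" using ok by simp
    then have "(\<rho>(NI := int i)) VK = int k" by (simp add: env_ok_def)
    then have "holds xs Z range_exp (\<rho>(NI := int i)) \<longleftrightarrow> 1 \<le> i \<and> i \<le> k" by (auto simp: range_exp_def)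
    then show "ev xs Z (Ite range_exp (CV_exp r) (Cst 0)) (\<rho>(NI := int i)) =
        (if 1 \<le> i \<and> i \<le> k then B ^ coord_pos r Z (CV i) else 0)"
      using ev_CV[OF o, of i] by simp
  qed
  moreover have "(\<Sum>i<Z. if 1 \<le> i \<and> i \<le> k then B ^ coord_pos r Z (CV i) else 0) = (\<Sum>i=1..k. B ^ coord_pos r Z (CV i))"
    using k by (intro sum.mono_neutral_cong_right) auto
  ultimately show ?thesis unfolding slots_exp_def by simp
qed

lemma ev_links:
  assumes "\<rho> NI = int i"
  shows "ev xs Z (links_exp r) \<rho> =
    (\<Sum>U\<in>small_sets r k. \<Sum>a<r. if pad r U ! a = i then B ^ coord_pos r Z (CE U a) else 0)"
  unfolding links_exp_def
proof (rule ev_sum_index)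
  fix U assume U: "U \<in> small_sets r k"
  let ?\<rho> = "assign \<rho> jn (pad r U)"
  have NI: "?\<rho> NI = int i" using assms by (subst assign_other) auto
  have "ev xs Z (link_exp r m) ?\<rho> = (\<Sum>a<m. if pad r U ! a = i then B ^ coord_pos r Z (CE U a) else 0)" if "m \<le> r" for m
    using that
  proof (induction m)
    case (Suc m)
    then show ?case using NI ev_CS(2)[OF pad_in_tuples[OF U] ok_jn jn_nth[OF pad_in_tuples[OF U]] refl] jn_nth[OF pad_in_tuples[OF U], of m] by simp
  qed simp
  then show "ev xs Z (link_exp r r) ?\<rho> = (\<Sum>a<r. if pad r U ! a = i then B ^ coord_pos r Z (CE U a) else 0)" by simp
qed

end

section \<open>The reduction\<close>

text \<open>A single loop stops at \<open>Z - 1\<close>; \<open>r\<close> digits run through all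
  candidates below \<open>Z ^ r\<close>.\<close>

primrec digits_exp :: "nat \<Rightarrow> nm exp" where
  "digits_exp 0 = Cst 0"
| "digits_exp (Suc a) = Add (digits_exp a) (Mul (Vr (NG a)) (pow_exp (Vr VZ) a))"

text \<open>Zeros at the same places make the two padded sets equally large; every other entry must
  be the successor of an input node. The comparison with \<open>VN\<close> rejects node numbers
  beyond the last gate.\<close>

primrec inputs_exp :: "nat \<Rightarrow> nm exp" where
  "inputs_exp 0 = Cst 1"
| "inputs_exp (Suc a) = Conj (inputs_exp a)
    (Ite (Equ (Vr (NX a)) (Cst 0)) (Equ (Vr (NJ a)) (Cst 0))
      (Conj (Less (Cst 0) (Vr (NJ a))) (Bind (NU 0) (Sub (Vr (NX a)) (Cst 1))
        (Conj (Less (start_exp (NU 0)) (Vr VN)) (Equ (tag_exp (NU 0)) (Cst 0))))))"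

primrec agree_exp :: "nat \<Rightarrow> nat \<Rightarrow> nm exp" where
  "agree_exp r 0 = Cst 0"
| "agree_exp r (Suc a) = Add (agree_exp r a) (Mul (Vr (NX a)) (CE_exp r a))"

definition out_LA :: "nat \<Rightarrow> nat \<Rightarrow> nm out" where
  "out_LA r d = for_over (map NG [0..<r])
    (Guard (Bind (NV d) (digits_exp r) (Bind (NU d) root_exp (good_exp d)))
      (Emit (Sub (Sub (Cst 1) (digits_exp r)) (slots_exp r))))"

definition out_LB :: "nat \<Rightarrow> nm out" where
  "out_LB r = For NI (For NY (Guard range_exp (Emit (Sub (CV_exp r) (Mul (Vr NY) (links_exp r))))))"

definition out_LC :: "nat \<Rightarrow> nat \<Rightarrow> nm out" where
  "out_LC r d = for_over (map NJ [0..<r]) (for_over (map NX [0..<r])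
    (Guard (Conj (index_exp r) (Conj (canonical_exp NX (r - 1)) (inputs_exp r)))
      (Emit (Add (Add (mob_exp r d r) (CS_exp r)) (agree_exp r r)))))"

text \<open>If the guard fails, the output is the empty list, which has no solution: the empty sum
  is 0 and not 1.\<close>

definition reduction_out :: "nat \<Rightarrow> nm out" where
  "reduction_out d = Guard (Conj parse_exp (Bind (NU d) root_exp (shallow_exp d 1)))
    (Both (out_LA (2 ^ d) d) (Both (out_LB (2 ^ d)) (out_LC (2 ^ d) d)))"

lemma pad_nth_inj:
  assumes "finite X" "0 \<notin> X" "card X \<le> r" "b < r" "c < r" "pad r X ! b = pad r X ! c" "0 < pad r X ! b"
  shows "b = c"
proof -
  have "\<not> b < r - card X" "\<not> c < r - card X"
    using assms pad_nth_eq_0[of X b r] pad_nth_eq_0[of X c r] by auto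
  then have "sorted_list_of_set X ! (b - (r - card X)) = sorted_list_of_set X ! (c - (r - card X))"
    using assms(6) by (simp add: pad_def nth_append)
  then have "b - (r - card X) = c - (r - card X)"
    using assms(1-5) \<open>\<not> b < r - card X\<close> \<open>\<not> c < r - card X\<close> by (subst (asm) nth_eq_iff_index_eq) auto
  then show ?thesis using \<open>\<not> b < r - card X\<close> \<open>\<not> c < r - card X\<close> by simp
qed

section \<open>Closed forms of the numbers\<close>

lemma label_val_LA:
  "label_val r k Z w B (LA v) =
    1 - v - ((\<Sum>U\<in>small_sets r k. B ^ coord_pos r Z (CS U)) + (\<Sum>i=1..k. B ^ coord_pos r Z (CV i)))"
  unfolding label_val_def sum_coords by (simp add: sum_negf)

lemma label_val_LB:
  assumes "i \<in> {1..k}"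
  shows "label_val r k Z w B (LB i x) = B ^ coord_pos r Z (CV i) -
    int x * (\<Sum>U\<in>small_sets r k. \<Sum>a<r. if pad r U ! a = i then B ^ coord_pos r Z (CE U a) else 0)"
proof -
  have "(\<Sum>j=1..k. of_bool (j = i) * B ^ coord_pos r Z (CV j)) = B ^ coord_pos r Z (CV i)"
    using assms by (simp add: of_bool_def if_distrib[of "\<lambda>x. x * _"] sum.delta cong: if_cong)
  moreover have "(\<Sum>U\<in>small_sets r k. \<Sum>a<r. (if pad r U ! a = i then - int x else 0) * B ^ coord_pos r Z (CE U a)) =
    - (int x * (\<Sum>U\<in>small_sets r k. \<Sum>a<r. if pad r U ! a = i then B ^ coord_pos r Z (CE U a) else 0))"
    unfolding sum_distrib_left sum_negf[symmetric] by (intro sum.cong refl) simp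
  ultimately show ?thesis unfolding label_val_def sum_coords by simp
qed

lemma label_val_LC:
  assumes "U \<in> small_sets r k"
  shows "label_val r k Z w B (LC U X) = w X + B ^ coord_pos r Z (CS U) +
    (\<Sum>a<r. int (pad r X ! a) * B ^ coord_pos r Z (CE U a))"
proof -
  have "(\<Sum>V\<in>small_sets r k. of_bool (V = U) * B ^ coord_pos r Z (CS V)) = B ^ coord_pos r Z (CS U)"
    using assms by (simp add: of_bool_def if_distrib[of "\<lambda>x. x * _"] sum.delta cong: if_cong)
  moreover have "(\<Sum>V\<in>small_sets r k. \<Sum>a<r. (if V = U then int (pad r X ! a) else 0) * B ^ coord_pos r Z (CE V a)) =
    (\<Sum>V\<in>small_sets r k. if V = U then (\<Sum>a<r. int (pad r X ! a) * B ^ coord_pos r Z (CE V a)) else 0)"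
    by (intro sum.cong refl) simp
  then have "(\<Sum>V\<in>small_sets r k. \<Sum>a<r. (if V = U then int (pad r X ! a) else 0) * B ^ coord_pos r Z (CE V a)) =
    (\<Sum>a<r. int (pad r X ! a) * B ^ coord_pos r Z (CE U a))"
    using assms by (simp add: sum.delta)
  ultimately show ?thesis unfolding label_val_def sum_coords by simp
qed

locale reduction = parsed +
  fixes d :: nat
  assumes d: "1 \<le> d" and shallow_root: "shallow C d 1 (length C - 1)"
begin

definition r :: nat where "r = 2 ^ d"
definition B :: int where "B = int Z ^ (3 * r + 3)"
definition prof :: "nat set \<Rightarrow> int" where "prof Y = profile C (int Z) {u. Suc u \<in> Y} d (length C - 1)"
definition Good :: "int set" where "Good = {v. 0 \<le> v \<and> v < int Z ^ r \<and> good C (int Z) d (length C - 1) v}"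

abbreviation "I \<equiv> Suc ` inputs C"

lemma root_less: "length C - 1 < length C" using wf by (auto simp: wf_circuit_def)
lemma k_less: "k < Z" using Z by simp
lemma Z2: "2 \<le> Z" using Z by simp
lemma r2: "2 \<le> r" using d power_increasing[of 1 d "2 :: nat"] by (simp add: r_def)

lemma prof_bounds: "0 \<le> prof Y \<and> prof Y < int Z ^ r"
  unfolding prof_def r_def by (rule profile_bounds[OF wf arity_less Z2 root_less])

lemma prof_Good: "prof Y \<in> Good \<longleftrightarrow> node_val C {u. Suc u \<in> Y} (length C - 1)"
  using good_profile[OF wf arity_less Z2 root_less shallow_root] prof_bounds[of Y]
  by (simp add: Good_def prof_def)

lemma degree_prof: "degree_le r prof"
proof -
  have "degree_le r (\<lambda>S. profile C (int Z) (Suc -` S) d (length C - 1))"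
    unfolding r_def by (rule degree_le_vimage[OF degree_le_profile[OF wf root_less shallow_root]]) simp
  then show ?thesis by (simp add: prof_def[abs_def] vimage_def)
qed

lemma inputs_I: "I \<subseteq> {1..<Z}"
  using length_C by (auto simp: inputs_def)

lemma finite_I': "finite I" using inputs_I by (rule finite_subset) simp

lemma card_slots_le: "card (slots r k) \<le> Z ^ (r + 1)"
proof -
  have "card (slots r k) = 1 + card (small_sets r k) + k"
    using sum_slots[of "\<lambda>_. 1 :: nat" r k] by simp
  also have "\<dots> \<le> 1 + (k + 1) ^ r + k" using card_small_sets[of r k] by simp
  also have "\<dots> \<le> Z ^ r + Z ^ r"
  proof -
    have "(k + 1) ^ r \<le> Z ^ r" using k_less by (intro power_mono) auto
    moreover have "Z ^ 1 \<le> Z ^ r" using r2 Z2 by (intro power_increasing) auto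
    ultimately show ?thesis using k_less by simp
  qed
  also have "\<dots> \<le> Z * Z ^ r" using mult_le_mono1[OF Z2, of "Z ^ r"] by linarith
  finally show ?thesis by simp
qed

text \<open>The origin of the base. Weights are at most \<open>2 ^ r * Z ^ r\<close>, so
  \<open>Z ^ (2 * r)\<close> bounds all digits; there are at most \<open>Z ^ (r + 1)\<close> slots;
  and \<open>Z ^ (3 * r + 1) + 1\<close> is below \<open>Z ^ (3 * r + 3)\<close> because
  \<open>Z\<close> is at least 2.\<close>

lemma gadget: "gadget r k Z (int Z ^ (2 * r)) B I (mob prof) Good"
proof
  have Zr: "int Z ^ r \<le> int Z ^ (2 * r)" using Z2 by (intro power_increasing) auto
  show "2 \<le> r" "k < Z" "I \<subseteq> {1..<Z}" using r2 k_less inputs_I by auto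
  show "0 \<le> v \<and> v \<le> int Z ^ (2 * r)" if "v \<in> Good" for v using that Zr by (simp add: Good_def)
  have "int Z ^ 1 \<le> int Z ^ (2 * r)" using Z2 r2 by (intro power_increasing) auto
  then show "int Z \<le> int Z ^ (2 * r)" by simp
  show "\<bar>mob prof X\<bar> \<le> int Z ^ (2 * r)" if "X \<subseteq> I" "card X \<le> r" for X
  proof -
    have "\<bar>mob prof X\<bar> \<le> 2 ^ card X * int Z ^ r"
      using prof_bounds by (intro abs_mob_le finite_subset[OF that(1) finite_I']) (simp add: less_imp_le)
    also have "2 ^ card X \<le> (2 :: int) ^ r" using that by (intro power_increasing) auto
    also have "(2 :: int) ^ r \<le> int Z ^ r" using Z2 by (intro power_mono) auto
    finally show ?thesis by (simp add: mult_2 power_add mult_right_mono)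
  qed
  have "int (card (slots r k)) * int Z ^ (2 * r) + 1 \<le> int (Z ^ (r + 1)) * int Z ^ (2 * r) + 1"
    using card_slots_le by (intro add_right_mono mult_right_mono) (simp_all only: of_nat_le_iff zero_le_power of_nat_0_le_iff)
  also have "\<dots> = int Z ^ (3 * r + 1) + 1" by (simp add: power_add[symmetric])
  also have "\<dots> < int Z ^ (3 * r + 3)"
  proof -
    have "1 \<le> int Z ^ (3 * r + 1)" using Z2 by (intro one_le_power) simp
    moreover have "2 * 2 * int Z ^ (3 * r + 1) \<le> int Z * int Z * int Z ^ (3 * r + 1)"
      using Z2 by (intro mult_right_mono mult_mono) auto
    moreover have "int Z * int Z * int Z ^ (3 * r + 1) = int Z ^ (3 * r + 3)"
      by (simp add: power_add numeral_3_eq_3)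
    ultimately show ?thesis by linarith
  qed
  finally show "int (card (slots r k)) * int Z ^ (2 * r) + 1 < B" by (simp add: B_def)
qed

text \<open>As \<open>prof\<close> has degree at most \<open>r\<close>, its coefficients on the
  small subsets of \<open>S\<close> add up to \<open>prof S\<close>, which lies in
  \<open>Good\<close> iff the output node is true. What remains is to undo the shift by
  \<open>Suc\<close>.\<close>

lemma solvable_iff_satisfiable:
  assumes "set ys = label_val r k Z (mob prof) B ` labels r k Z I Good"
  shows "(ys, card (slots r k)) \<in> At_Most_k_Sum_Rep_Target_1 \<longleftrightarrow> (xs, k) \<in> WCS 1 d"
proof -
  have "(ys, card (slots r k)) \<in> At_Most_k_Sum_Rep_Target_1 \<longleftrightarrow>
      (\<exists>S\<subseteq>I. card S = k \<and> (\<Sum>X | X \<subseteq> S \<and> card X \<le> r. mob prof X) \<in> Good)"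
    unfolding At_Most_k_Sum_Rep_Target_1_def using gadget.solvable_iff[OF gadget assms] by simp
  also have "\<dots> \<longleftrightarrow> (\<exists>S\<subseteq>I. card S = k \<and> node_val C {u. Suc u \<in> S} (length C - 1))"
    using sum_mob_degree[OF degree_prof finite_subset[OF _ finite_I']] prof_Good by auto
  also have "\<dots> \<longleftrightarrow> (\<exists>S\<subseteq>inputs C. card S = k \<and> node_val C S (length C - 1))"
  proof
    assume "\<exists>S\<subseteq>I. card S = k \<and> node_val C {u. Suc u \<in> S} (length C - 1)"
    then obtain S where S: "S \<subseteq> I" "card S = k" "node_val C {u. Suc u \<in> S} (length C - 1)" by blast
    then obtain T where T: "T \<subseteq> inputs C" "S = Suc ` T" by (auto simp: subset_image_iff)
    then have "{u. Suc u \<in> S} = T" by auto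
    then show "\<exists>S\<subseteq>inputs C. card S = k \<and> node_val C S (length C - 1)" using S T by (auto simp: card_image)
  next
    assume "\<exists>S\<subseteq>inputs C. card S = k \<and> node_val C S (length C - 1)"
    then obtain S where S: "S \<subseteq> inputs C" "card S = k" "node_val C S (length C - 1)" by blast
    moreover have "{u. Suc u \<in> Suc ` S} = S" by auto
    ultimately show "\<exists>S\<subseteq>I. card S = k \<and> node_val C {u. Suc u \<in> S} (length C - 1)"
      by (intro exI[of _ "Suc ` S"]) (auto simp: card_image)
  qed
  also have "\<dots> \<longleftrightarrow> (xs, k) \<in> WCS 1 d"
  proof -
    have ne: "C \<noteq> []" using wf by (simp add: wf_circuit_def)
    have "weft_le C 1 \<and> depth_le C d" using weft_depth_iff_shallow[OF wf] shallow_root by blast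
    then show ?thesis using wf satisfies_node_val[OF ne] inj_encode unfolding WCS_def by (auto dest: injD)
  qed
  finally show ?thesis .
qed

context
  fixes \<rho> :: "nm \<Rightarrow> int"
  assumes \<rho>: "ok \<rho>"
begin

lemma ev_digits:
  assumes "ok \<rho>'" "\<And>b. b < r \<Longrightarrow> \<rho>' (NG b) = int (l ! b)" "a \<le> r"
  shows "ev xs Z (digits_exp a) \<rho>' = int (\<Sum>b<a. l ! b * Z ^ b)"
  using assms(3) assms(1,2) by (induction a) (auto simp: ev_pow env_ok_def)

lemma set_out_LA: "set (outs xs Z (out_LA r d) \<rho>) = label_val r k Z w B ` LA ` Good"
proof -
  let ?ns = "map NG [0..<r]"
  have NG: "inj NG" by (auto simp: inj_def)
  have o: "ok (assign \<rho> ?ns l)" for l using \<rho> by (subst env_ok_assign) auto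
  have dg: "ev xs Z (digits_exp r) (assign \<rho> ?ns l) = int (\<Sum>b<r. l ! b * Z ^ b)" if "l \<in> tuples r Z" for l
    using assign_map[OF NG that] by (intro ev_digits o) auto
  have g: "holds xs Z (Bind (NV d) (digits_exp r) (Bind (NU d) root_exp (good_exp d))) (assign \<rho> ?ns l) \<longleftrightarrow>
      good C (int Z) d (length C - 1) (int (\<Sum>b<r. l ! b * Z ^ b))" if l: "l \<in> tuples r Z" for l
  proof -
    let ?\<rho> = "(assign \<rho> ?ns l)(NV d := int (\<Sum>b<r. l ! b * Z ^ b))"
    have "ok ?\<rho>" using o by (simp del: fun_upd_apply)
    then have "ev xs Z root_exp ?\<rho> = int (length C - 1)" by (rule ev_root)
    moreover have "ok (?\<rho>(NU d := int (length C - 1)))" using o by (simp del: fun_upd_apply)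
    ultimately show ?thesis
      using holds_good[of "?\<rho>(NU d := int (length C - 1))" d "length C - 1"] root_less dg[OF l] by simp
  qed
  have T: "ev xs Z (slots_exp r) (assign \<rho> ?ns l) =
      (\<Sum>U\<in>small_sets r k. B ^ coord_pos r Z (CS U)) + (\<Sum>i=1..k. B ^ coord_pos r Z (CV i))" for l
    by (rule ev_slots[OF o k_less B_def])
  have "set (outs xs Z (out_LA r d) \<rho>) =
    (\<Union>l\<in>tuples r Z. if good C (int Z) d (length C - 1) (int (\<Sum>b<r. l ! b * Z ^ b))
       then {label_val r k Z w B (LA (int (\<Sum>b<r. l ! b * Z ^ b)))} else {})"
    unfolding out_LA_def set_outs_for_over length_map length_upt diff_zero
  proof (intro SUP_cong refl)
    fix l assume l: "l \<in> tuples r Z"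
    show "set (outs xs Z (Guard (Bind (NV d) (digits_exp r) (Bind (NU d) root_exp (good_exp d)))
        (Emit (Sub (Sub (Cst 1) (digits_exp r)) (slots_exp r)))) (assign \<rho> ?ns l)) =
      (if good C (int Z) d (length C - 1) (int (\<Sum>b<r. l ! b * Z ^ b))
       then {label_val r k Z w B (LA (int (\<Sum>b<r. l ! b * Z ^ b)))} else {})"
      using g[OF l] dg[OF l] T[of l] by (simp only: outs.simps holds_def[symmetric] ev.simps label_val_LA) simp
  qed
  also have "\<dots> = label_val r k Z w B ` LA ` Good"
  proof (intro equalityI subsetI)
    fix y assume "y \<in> (\<Union>l\<in>tuples r Z. if good C (int Z) d (length C - 1) (int (\<Sum>b<r. l ! b * Z ^ b))
       then {label_val r k Z w B (LA (int (\<Sum>b<r. l ! b * Z ^ b)))} else {})"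
    then obtain l where l: "l \<in> tuples r Z" "good C (int Z) d (length C - 1) (int (\<Sum>b<r. l ! b * Z ^ b))"
      "y = label_val r k Z w B (LA (int (\<Sum>b<r. l ! b * Z ^ b)))" by (auto split: if_splits)
    have "(\<Sum>b<r. l ! b * Z ^ b) < Z ^ r" using nth_tuples[OF l(1)] by (rule digit_sum_less)
    then have "int (\<Sum>b<r. l ! b * Z ^ b) < int Z ^ r" by (metis of_nat_less_iff of_nat_power)
    moreover have "0 \<le> int (\<Sum>b<r. l ! b * Z ^ b)" by (rule of_nat_0_le_iff)
    ultimately have "int (\<Sum>b<r. l ! b * Z ^ b) \<in> Good" using l(2) unfolding Good_def by blast
    then show "y \<in> label_val r k Z w B ` LA ` Good" using l(3) by blast
  next
    fix y assume "y \<in> label_val r k Z w B ` LA ` Good"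
    then obtain v where v: "v \<in> Good" "y = label_val r k Z w B (LA v)" by blast
    then have "nat v < Z ^ r" by (simp add: Good_def nat_less_iff)
    from ex_digits[OF this] obtain l where l: "l \<in> tuples r Z" "nat v = (\<Sum>a<r. l ! a * Z ^ a)" by blast
    have "v = int (\<Sum>a<r. l ! a * Z ^ a)" using l(2) v(1) by (simp add: Good_def flip: l(2))
    then show "y \<in> (\<Union>l\<in>tuples r Z. if good C (int Z) d (length C - 1) (int (\<Sum>b<r. l ! b * Z ^ b))
       then {label_val r k Z w B (LA (int (\<Sum>b<r. l ! b * Z ^ b)))} else {})"
      using v l(1) by (intro UN_I[of l]) (auto simp: Good_def simp del: of_nat_sum)
  qed
  finally show ?thesis .
qed

lemma set_out_LB: "set (outs xs Z (out_LB r) \<rho>) = label_val r k Z w B ` {LB i x | i x. i \<in> {1..k} \<and> x < Z}"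
proof -
  have *: "set (outs xs Z (Guard range_exp (Emit (Sub (CV_exp r) (Mul (Vr NY) (links_exp r))))) (\<rho>(NI := int i, NY := int x))) =
    (if 1 \<le> i \<and> i \<le> k then {label_val r k Z w B (LB i x)} else {})" for i x
  proof -
    let ?\<rho> = "\<rho>(NI := int i, NY := int x)"
    have o: "ok ?\<rho>" using \<rho> by (simp del: fun_upd_apply)
    have VK: "?\<rho> VK = int k" using o by (simp only: env_ok_def)
    have NI: "?\<rho> NI = int i" "?\<rho> NY = int x" by simp_all
    have rng: "holds xs Z range_exp ?\<rho> \<longleftrightarrow> 1 \<le> i \<and> i \<le> k"
      unfolding range_exp_def using VK NI by (simp del: fun_upd_apply)
    have cv: "ev xs Z (CV_exp r) ?\<rho> = B ^ coord_pos r Z (CV i)" if "i \<le> k"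
      by (rule ev_CV[OF o k_less B_def o NI(1) that])
    note lk = ev_links[OF o k_less B_def NI(1)]
    show ?thesis using rng cv lk NI(2) label_val_LB[of i k r Z w B x]
      by (simp add: holds_def del: fun_upd_apply coord_pos.simps)
  qed
  have "set (outs xs Z (out_LB r) \<rho>) = (\<Union>i<Z. \<Union>x<Z. if 1 \<le> i \<and> i \<le> k then {label_val r k Z w B (LB i x)} else {})"
    unfolding out_LB_def outs.simps(3) set_concat set_map set_upt atLeast0LessThan image_image * by simp
  also have "\<dots> = label_val r k Z w B ` {LB i x | i x. i \<in> {1..k} \<and> x < Z}"
    (is "?L = ?R")
  proof (intro equalityI subsetI)
    fix y assume "y \<in> ?L"
    then obtain i x where "x < Z" "1 \<le> i" "i \<le> k" "y = label_val r k Z w B (LB i x)"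
      by (auto split: if_splits)
    then show "y \<in> ?R" by (intro rev_image_eqI[of "LB i x"]) auto
  next
    fix y assume "y \<in> ?R"
    then obtain i x where "i \<in> {1..k}" "x < Z" "y = label_val r k Z w B (LB i x)" by blast
    then show "y \<in> ?L" using k_less by (intro UN_I[of i] UN_I[of x]) auto
  qed
  finally show ?thesis .
qed

lemma set_out_LC: "set (outs xs Z (out_LC r d) \<rho>) =
  label_val r k Z (mob prof) B ` {LC U X | U X. U \<in> small_sets r k \<and> X \<subseteq> I \<and> card X = card U}"
proof -
  let ?jn = "map NJ [0..<r]" and ?xn = "map NX [0..<r]"
  let ?\<rho> = "\<lambda>j x. assign (assign \<rho> ?jn j) ?xn x"
  have inj: "inj NJ" "inj NX" by (auto simp: inj_def)
  have IZ: "I \<subseteq> {..<Z}" using inputs_I by (rule order_trans) auto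
  have o: "ok (?\<rho> j x)" for j x
  proof -
    have "ok (assign \<rho> ?jn j)" using \<rho> by (subst env_ok_assign) auto
    then show ?thesis by (subst env_ok_assign) auto
  qed
  have nx: "?\<rho> j x (NX a) = int (x ! a)" if "x \<in> tuples r Z" "a < r" for j x a
    by (rule assign_map[OF inj(2) that])
  have nj: "?\<rho> j x (NJ a) = int (j ! a)" if "j \<in> tuples r Z" "a < r" for j x a
  proof -
    have "?\<rho> j x (NJ a) = assign \<rho> ?jn j (NJ a)" by (rule assign_other) auto
    then show ?thesis using assign_map[OF inj(1) that] by simp
  qed
  have idx: "holds xs Z (index_exp r) (?\<rho> j x) \<longleftrightarrow> j \<in> pad r ` small_sets r k" if "j \<in> tuples r Z" for j x
    by (rule holds_index[OF o k_less B_def that o nj[OF that]])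
  have can: "holds xs Z (canonical_exp NX (r - 1)) (?\<rho> j x) \<longleftrightarrow> canonical x" if "x \<in> tuples r Z" for j x
  proof (rule holds_canonical_list)
    show "?\<rho> j x (NX a) = int (x ! a)" if "a < r" for a by (rule nx) fact+
    show "length x = r" using that by (simp add: tuples_def)
  qed
  have inp: "holds xs Z (inputs_exp m) (?\<rho> j x) \<longleftrightarrow>
      (\<forall>a<m. (x ! a = 0 \<longleftrightarrow> j ! a = 0) \<and> (x ! a \<noteq> 0 \<longrightarrow> x ! a \<in> I))"
    if jx: "j \<in> tuples r Z" "x \<in> tuples r Z" and "m \<le> r" for j x m
    using that(3)
  proof (induction m)
    case (Suc m)
    let ?e = "Conj (Less (start_exp (NU 0)) (Vr VN)) (Equ (tag_exp (NU 0)) (Cst 0))"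
    have mr: "m < r" using Suc.prems by simp
    have xm: "?\<rho> j x (NX m) = int (x ! m)" "?\<rho> j x (NJ m) = int (j ! m)" "x ! m < Z"
      by (rule nx[OF jx(2) mr], rule nj[OF jx(1) mr], rule nth_tuples[OF jx(2) mr])
    have key: "holds xs Z ?e ((?\<rho> j x)(NU 0 := int (x ! m) - 1)) \<longleftrightarrow> x ! m \<in> I" if nz: "x ! m \<noteq> 0"
    proof -
      let ?u = "x ! m - 1"
      let ?\<sigma> = "(?\<rho> j x)(NU 0 := int ?u)"
      have u: "int (x ! m) - 1 = int ?u" using nz by simp
      have o': "ok ?\<sigma>" using o by (simp del: fun_upd_apply)
      have vn: "?\<sigma> VN = int (length xs)" using o' by (simp only: env_ok_def)
      have u0: "?\<sigma> (NU 0) = int ?u" by simp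
      have st: "ev xs Z (start_exp (NU 0)) ?\<sigma> = gate_start xs Z ?u"
        by (rule ev_start[OF vn u0]) (use xm(3) in auto)
      have lt: "gate_start xs Z ?u < int (length xs) \<longleftrightarrow> ?u < length C"
        using gate_start_encode[of ?u C Z] gate_start_encode_ge[of C ?u Z] offset_less[of ?u C] Z
        by (cases "?u < length C") auto
      have tag: "ev xs Z (tag_exp (NU 0)) ?\<sigma> = gate_tag (C ! ?u)" if "?u < length C"
        by (rule ev_tag[OF o' u0 that]) simp
      have gt: "gate_tag g = 0 \<longleftrightarrow> g = Input" for g by (cases g) auto
      have "holds xs Z ?e ?\<sigma> \<longleftrightarrow> ?u < length C \<and> ev xs Z (tag_exp (NU 0)) ?\<sigma> = 0"
        by (simp only: holds_simps(1,3,6) ev.simps st vn lt)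
      also have "\<dots> \<longleftrightarrow> ?u \<in> inputs C"
        by (cases "?u < length C") (simp_all only: tag gt inputs_def mem_Collect_eq simp_thms)
      also have "\<dots> \<longleftrightarrow> x ! m \<in> I" using nz by (cases "x ! m") (simp_all add: inj_image_mem_iff)
      finally show ?thesis unfolding u .
    qed
    have "holds xs Z (Ite (Equ (Vr (NX m)) (Cst 0)) (Equ (Vr (NJ m)) (Cst 0))
        (Conj (Less (Cst 0) (Vr (NJ m))) (Bind (NU 0) (Sub (Vr (NX m)) (Cst 1)) ?e))) (?\<rho> j x) \<longleftrightarrow>
      (x ! m = 0 \<longleftrightarrow> j ! m = 0) \<and> (x ! m \<noteq> 0 \<longrightarrow> x ! m \<in> I)"
    proof (cases "x ! m = 0")
      case True
      then show ?thesis by (simp only: holds_simps(6,8) ev.simps xm) simp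
    next
      case False
      have "holds xs Z (Bind (NU 0) (Sub (Vr (NX m)) (Cst 1)) ?e) (?\<rho> j x) \<longleftrightarrow> x ! m \<in> I"
        using key[OF False] by (simp only: holds_simps(7) ev.simps xm)
      then show ?thesis using False by (simp only: holds_simps(1,3,6,8) ev.simps xm) simp
    qed
    moreover have "holds xs Z (inputs_exp m) (?\<rho> j x) \<longleftrightarrow>
        (\<forall>a<m. (x ! a = 0 \<longleftrightarrow> j ! a = 0) \<and> (x ! a \<noteq> 0 \<longrightarrow> x ! a \<in> I))"
      using Suc.prems by (intro Suc.IH) simp
    ultimately show ?case by (simp only: inputs_exp.simps holds_simps(3) All_less_Suc) blast
  qed simp
  \<comment> \<open>Zeros of a padded list are its first \<open>r - card\<close> places, so equal
    zero patterns mean equal cardinality.\<close>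
  have shape: "canonical x \<and> (\<forall>a<r. (x ! a = 0 \<longleftrightarrow> pad r U ! a = 0) \<and> (x ! a \<noteq> 0 \<longrightarrow> x ! a \<in> I)) \<longleftrightarrow>
      (\<exists>X\<subseteq>I. card X = card U \<and> x = pad r X)" if x: "x \<in> tuples r Z" and U: "U \<in> small_sets r k" for x U
  proof
    assume L: "canonical x \<and> (\<forall>a<r. (x ! a = 0 \<longleftrightarrow> pad r U ! a = 0) \<and> (x ! a \<noteq> 0 \<longrightarrow> x ! a \<in> I))"
    have len: "length x = r" using x by (simp add: tuples_def)
    from canonical_imp_pad[OF conjunct1[OF L]] obtain X where
      X: "finite X" "0 \<notin> X" "card X \<le> r" "X \<subseteq> set x" "x = pad r X" unfolding len by blast
    note fU = small_setsD[OF U]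
    have z: "a < r - card X \<longleftrightarrow> a < r - card U" if "a < r" for a
      using L that pad_nth_eq_0[OF X(1,2) that X(3)] pad_nth_eq_0[of U a r] fU X(5) by simp
    have "\<not> r - card X < r - card U"
    proof
      assume lt: "r - card X < r - card U"
      then show False using z[of "r - card X"] by simp
    qed
    moreover have "\<not> r - card U < r - card X"
    proof
      assume lt: "r - card U < r - card X"
      then show False using z[of "r - card U"] by simp
    qed
    ultimately have "r - card X = r - card U" by simp
    moreover have "card U \<le> r" using fU by blast
    ultimately have "card X = card U" using X(3) by arith
    moreover have "X \<subseteq> I"
    proof
      fix y assume y: "y \<in> X"
      then have "y \<in> set x" using X(4) by blast
      then obtain a where "a < r" "y = x ! a" unfolding in_set_conv_nth len by blast
      moreover have "y \<noteq> 0" using y X(2) by metis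
      ultimately show "y \<in> I" using L by blast
    qed
    ultimately show "\<exists>X\<subseteq>I. card X = card U \<and> x = pad r X" using X(5) by blast
  next
    assume "\<exists>X\<subseteq>I. card X = card U \<and> x = pad r X"
    then obtain X where X: "X \<subseteq> I" "card X = card U" "x = pad r X" by blast
    note fU = small_setsD[OF U]
    have fX: "finite X" "0 \<notin> X" "card X \<le> r" using X finite_subset[OF X(1) finite_I'] fU by auto
    have ins: "x ! a \<in> insert 0 X" if "a < r" for a
    proof -
      have "x ! a \<in> set x" using that x by (intro nth_mem) (simp add: tuples_def)
      then show ?thesis using set_pad(1)[OF fX(1), of r] unfolding X(3) by blast
    qed
    have "x ! a \<noteq> 0 \<longrightarrow> x ! a \<in> I" if "a < r" for a
      using ins[OF that] subsetD[OF X(1), of "x ! a"] by (metis insert_iff)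
    moreover have "x ! a = 0 \<longleftrightarrow> pad r U ! a = 0" if "a < r" for a
      using pad_nth_eq_0[OF fX(1,2) that fX(3)] pad_nth_eq_0[of U a r] fU that X(2,3) by simp
    moreover have "canonical x" unfolding X(3) by (rule canonical_pad[OF fX(1,2)])
    ultimately show "canonical x \<and> (\<forall>a<r. (x ! a = 0 \<longleftrightarrow> pad r U ! a = 0) \<and> (x ! a \<noteq> 0 \<longrightarrow> x ! a \<in> I))" by blast
  qed
  have val: "ev xs Z (Add (Add (mob_exp r d r) (CS_exp r)) (agree_exp r r)) (?\<rho> (pad r U) (pad r X)) =
      label_val r k Z (mob prof) B (LC U X)"
    if U: "U \<in> small_sets r k" and X: "X \<subseteq> I" "card X = card U" for U X
  proof -
    note fU = small_setsD[OF U]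
    have fX: "finite X" "0 \<notin> X" "card X \<le> r" using X finite_subset[OF X(1) finite_I'] fU by auto
    have tU: "pad r U \<in> tuples r Z" by (rule pad_in_tuples[OF \<rho> k_less B_def U])
    have tX: "pad r X \<in> tuples r Z" using fX order_trans[OF X(1) IZ] k_less by (intro pad_tuples) auto
    let ?\<sigma> = "?\<rho> (pad r U) (pad r X)"
    note nX = nx[OF tX] and nJ = nj[OF tU]
    have lenX: "length (pad r X) = r" using fX by (simp add: length_pad)
    have "var_set 0 r ?\<sigma> = X"
    proof (intro equalityI subsetI)
      fix y assume "y \<in> var_set 0 r ?\<sigma>"
      then obtain a where a: "0 < y" "a < r" "?\<sigma> (NX a) = int y" by (auto simp: var_set_def)
      then have "y = pad r X ! a" using nX[of a "pad r U"] by simp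
      then have "y \<in> set (pad r X)" using a(2) lenX by simp
      then show "y \<in> X" using set_pad(1)[OF fX(1), of r] a(1) by auto
    next
      fix y assume y: "y \<in> X"
      then have "y \<in> set (pad r X)" using set_pad(2)[OF fX(1), of r] by blast
      then obtain a where "a < r" "pad r X ! a = y" unfolding in_set_conv_nth lenX by blast
      moreover have "0 < y" using y fX(2) by (cases y) auto
      ultimately show "y \<in> var_set 0 r ?\<sigma>" using nX[of a "pad r U"] by (auto simp: var_set_def intro!: bexI[of _ a])
    qed
    moreover have "var_set r r ?\<sigma> = {}" by (simp add: var_set_def)
    moreover have "ev xs Z (mob_exp r d r) ?\<sigma> =
      mob (\<lambda>Y. profile C (int Z) {u. Suc u \<in> Y \<union> var_set r r ?\<sigma>} d (length C - 1)) (var_set 0 r ?\<sigma>)"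
    proof (rule ev_mob[OF shallow_root o order_refl])
      show "0 \<le> ?\<sigma> (NX b)" if "b < r" for b using nX[OF that] by simp
      show "?\<sigma> (NX c) \<noteq> ?\<sigma> (NX b)" if "b < r" "c < r" "c \<noteq> b" "0 < ?\<sigma> (NX b)" for b c
        using that pad_nth_inj[OF fX that(1,2)] unfolding nX[OF that(1)] nX[OF that(2)] by auto
    qed
    ultimately have m: "ev xs Z (mob_exp r d r) ?\<sigma> = mob prof X" by (simp add: prof_def[abs_def])
    note cs = ev_CS[OF o k_less B_def tU o nJ refl]
    have "ev xs Z (agree_exp r n) ?\<sigma> = (\<Sum>a<n. int (pad r X ! a) * B ^ coord_pos r Z (CE U a))" if "n \<le> r" for n
      using that by (induction n) (simp_all add: nX cs del: coord_pos.simps)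
    then show ?thesis using m cs(1) unfolding label_val_LC[OF U] by (simp del: coord_pos.simps)
  qed
  have "set (outs xs Z (out_LC r d) \<rho>) = (\<Union>j\<in>tuples r Z. \<Union>x\<in>tuples r Z.
      if holds xs Z (Conj (index_exp r) (Conj (canonical_exp NX (r - 1)) (inputs_exp r))) (?\<rho> j x)
      then {ev xs Z (Add (Add (mob_exp r d r) (CS_exp r)) (agree_exp r r)) (?\<rho> j x)} else {})"
    unfolding out_LC_def set_outs_for_over length_map length_upt diff_zero outs.simps holds_def[symmetric]
    by (intro SUP_cong refl) simp
  also have "\<dots> = label_val r k Z (mob prof) B ` {LC U X | U X. U \<in> small_sets r k \<and> X \<subseteq> I \<and> card X = card U}"
    (is "?L = ?R")
  proof (intro equalityI subsetI)
    fix y assume "y \<in> ?L"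
    then obtain j x where jx: "j \<in> tuples r Z" "x \<in> tuples r Z"
      "holds xs Z (Conj (index_exp r) (Conj (canonical_exp NX (r - 1)) (inputs_exp r))) (?\<rho> j x)"
      "y = ev xs Z (Add (Add (mob_exp r d r) (CS_exp r)) (agree_exp r r)) (?\<rho> j x)"
      by (auto split: if_splits)
    then obtain U where U: "U \<in> small_sets r k" "j = pad r U" using idx[OF jx(1)] by auto
    have "canonical x \<and> (\<forall>a<r. (x ! a = 0 \<longleftrightarrow> pad r U ! a = 0) \<and> (x ! a \<noteq> 0 \<longrightarrow> x ! a \<in> I))"
      using jx(3) can[OF jx(2)] inp[OF jx(1,2) order_refl] unfolding U(2) holds_simps by blast
    then obtain X where X: "X \<subseteq> I" "card X = card U" "x = pad r X" unfolding shape[OF jx(2) U(1)] by blast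
    then have "y = label_val r k Z (mob prof) B (LC U X)" using val[OF U(1) X(1,2)] jx(4) U(2) by simp
    then show "y \<in> ?R" using U(1) X by blast
  next
    fix y assume "y \<in> ?R"
    then obtain U X where U: "U \<in> small_sets r k" and X: "X \<subseteq> I" "card X = card U"
      and y: "y = label_val r k Z (mob prof) B (LC U X)" by blast
    note fU = small_setsD[OF U]
    have tU: "pad r U \<in> tuples r Z" by (rule pad_in_tuples[OF \<rho> k_less B_def U])
    have tX: "pad r X \<in> tuples r Z"
      using X(2) finite_subset[OF X(1) finite_I'] fU order_trans[OF X(1) IZ] k_less by (intro pad_tuples) auto
    have "canonical (pad r X) \<and> (\<forall>a<r. (pad r X ! a = 0 \<longleftrightarrow> pad r U ! a = 0) \<and> (pad r X ! a \<noteq> 0 \<longrightarrow> pad r X ! a \<in> I))"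
      unfolding shape[OF tX U] using X by blast
    then have "holds xs Z (Conj (index_exp r) (Conj (canonical_exp NX (r - 1)) (inputs_exp r))) (?\<rho> (pad r U) (pad r X))"
      using idx[OF tU] can[OF tX] inp[OF tU tX order_refl] U unfolding holds_simps by blast
    then show "y \<in> ?L" using tU tX y val[OF U X] by (intro UN_I[of "pad r U"] UN_I[of "pad r X"]) auto
  qed
  finally show ?thesis .
qed

lemma set_reduction_out: "set (outs xs Z (reduction_out d) \<rho>) = label_val r k Z (mob prof) B ` labels r k Z I Good"
proof -
  have "holds xs Z parse_exp \<rho>"
    using \<rho> Z parse_ok_encode[OF wf] by (subst holds_parse) (auto simp: env_ok_def)
  moreover have "holds xs Z (shallow_exp d 1) (\<rho>(NU d := int (length C - 1)))"
    using holds_shallow[of "\<rho>(NU d := int (length C - 1))" d "length C - 1" 1] \<rho> root_less shallow_root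
    by (simp del: fun_upd_apply add: fun_upd_same)
  ultimately have "0 < ev xs Z (Conj parse_exp (Bind (NU d) root_exp (shallow_exp d 1))) \<rho>"
    using ev_root[OF \<rho>] unfolding holds_def[symmetric] by simp
  then have "set (outs xs Z (reduction_out d) \<rho>) =
      set (outs xs Z (out_LA r d) \<rho>) \<union> set (outs xs Z (out_LB r) \<rho>) \<union> set (outs xs Z (out_LC r d) \<rho>)"
    unfolding reduction_out_def outs.simps(2,4) r_def[symmetric] by (simp only: if_True set_append Un_assoc)
  then show ?thesis
    unfolding set_out_LA[of "mob prof"] set_out_LB[of "mob prof"] set_out_LC labels_def image_Un .
qed

end

end

text \<open>The case distinction is on the guard of \<open>reduction_out\<close>, so every list is
  covered: if the guard holds, the input encodes a circuit within the bounds and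
  \<open>solvable_iff_satisfiable\<close> applies; otherwise the input is outside
  \<open>WCS 1 d\<close> and the output is empty. The new parameter is the number of slots in both
  cases.\<close>

theorem WCS_poly_reducible:
  assumes "1 \<le> d"
  shows "poly_reducible (WCS 1 d) At_Most_k_Sum_Rep_Target_1"
proof -
  let ?r = "2 ^ d :: nat"
  let ?w = "reduction_out d" and ?e = "count_slots_exp ?r"
  obtain C q where prog: "\<And>xs k. 0 \<le> ev xs (length xs + k + 2) ?e (start_env VN VK VZ (length xs) k) \<Longrightarrow>
    \<exists>t. computes (out_prog VN VK VZ ?w ?e) (xs, k) t
      (outs xs (length xs + k + 2) ?w (start_env VN VK VZ (length xs) k),
       nat (ev xs (length xs + k + 2) ?e (start_env VN VK VZ (length xs) k))) \<and>
     t \<le> C * (k + 1) ^ q * (input_size xs + 1) ^ q"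
    using out_prog_computes[of ?e VN VK VZ ?w] by blast
  have main: "\<exists>xs' k' t. computes (out_prog VN VK VZ ?w ?e) (xs, k) t (xs', k') \<and>
      t \<le> (C + 2) * (k + 1) ^ (q + ?r + 1) * (input_size xs + 1) ^ (q + ?r + 1) \<and>
      k' \<le> (C + 2) * (k + 1) ^ (q + ?r + 1) \<and>
      ((xs, k) \<in> WCS 1 d \<longleftrightarrow> (xs', k') \<in> At_Most_k_Sum_Rep_Target_1)" for xs k
  proof -
    define Z where "Z = length xs + k + 2"
    define \<rho> where "\<rho> = start_env VN VK VZ (length xs) k"
    have ok: "env_ok xs k Z \<rho>" by (simp add: env_ok_def \<rho>_def start_env_def Z_def)
    have kZ: "k < Z" by (simp add: Z_def)
    have cnt: "ev xs Z ?e \<rho> = int (card (slots ?r k))"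
      by (rule ev_count_slots[OF ok kZ refl])
    then have "0 \<le> ev xs (length xs + k + 2) ?e (start_env VN VK VZ (length xs) k)"
      by (simp add: Z_def \<rho>_def)
    from prog[OF this] obtain t where t: "computes (out_prog VN VK VZ ?w ?e) (xs, k) t (outs xs Z ?w \<rho>, nat (ev xs Z ?e \<rho>))"
      "t \<le> C * (k + 1) ^ q * (input_size xs + 1) ^ q" unfolding Z_def \<rho>_def by blast
    have "t \<le> (C + 2) * (k + 1) ^ (q + ?r + 1) * (input_size xs + 1) ^ (q + ?r + 1)"
      by (rule order_trans[OF t(2)], intro mult_le_mono power_increasing) auto
    moreover have "card (slots ?r k) \<le> (C + 2) * (k + 1) ^ (q + ?r + 1)"
    proof -
      have "card (slots ?r k) = 1 + card (small_sets ?r k) + k"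
        using sum_slots[of "\<lambda>_. 1 :: nat" ?r k] by simp
      also have "\<dots> \<le> (k + 1) ^ ?r + (k + 1) ^ 1" using card_small_sets[of ?r k] by simp
      also have "\<dots> \<le> (k + 1) ^ (q + ?r + 1) + (k + 1) ^ (q + ?r + 1)"
        by (intro add_mono power_increasing) auto
      also have "\<dots> \<le> (C + 2) * (k + 1) ^ (q + ?r + 1)" by (simp add: distrib_right)
      finally show ?thesis .
    qed
    moreover have "(xs, k) \<in> WCS 1 d \<longleftrightarrow> (outs xs Z ?w \<rho>, card (slots ?r k)) \<in> At_Most_k_Sum_Rep_Target_1"
    proof (cases "holds xs Z (Conj parse_exp (Bind (NU d) root_exp (shallow_exp d 1))) \<rho>")
      case True
      then have "parse_ok xs Z" using holds_parse[of \<rho> xs Z] ok by (simp add: env_ok_def Z_def)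
      then obtain D where D: "wf_circuit D" "xs = encode D" using parse_ok_imp_encode[of xs Z] by (auto simp: Z_def)
      interpret parsed D k Z using D by unfold_locales (auto simp: Z_def)
      have ok': "env_ok (encode D) k Z \<rho>" using ok D(2) by simp
      have rl: "length D - 1 < length D" using D(1) by (auto simp: wf_circuit_def)
      have "holds (encode D) Z (shallow_exp d 1) (\<rho>(NU d := int (length D - 1)))"
        using True ev_root[OF ok'] D(2) by simp
      then have "shallow D d 1 (length D - 1)"
        using holds_shallow[of "\<rho>(NU d := int (length D - 1))" d "length D - 1" 1] ok' rl
        by (simp del: fun_upd_apply add: fun_upd_same)
      then interpret reduction D k Z d using assms by unfold_locales
      show ?thesis
        using solvable_iff_satisfiable[OF set_reduction_out[OF ok']] unfolding D(2) r_def by simp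
    next
      case False
      then have "outs xs Z ?w \<rho> = []" by (simp add: reduction_out_def holds_def)
      then have "(outs xs Z ?w \<rho>, card (slots ?r k)) \<notin> At_Most_k_Sum_Rep_Target_1"
        by (simp add: At_Most_k_Sum_Rep_Target_1_def)
      moreover have "(xs, k) \<notin> WCS 1 d"
      proof
        assume "(xs, k) \<in> WCS 1 d"
        then obtain D where D: "xs = encode D" "wf_circuit D" "weft_le D 1" "depth_le D d" by (auto simp: WCS_def)
        interpret parsed D k Z using D by unfold_locales (auto simp: Z_def)
        have ok': "env_ok (encode D) k Z \<rho>" using ok D(1) by simp
        have sh: "shallow D d 1 (length D - 1)" using weft_depth_iff_shallow[OF D(2)] D(3,4) by blast
        have rl: "length D - 1 < length D" using D(2) by (auto simp: wf_circuit_def)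
        have "holds (encode D) Z parse_exp \<rho>"
          using ok' parse_ok_encode[OF D(2)] D(1) by (subst holds_parse) (auto simp: env_ok_def Z_def)
        moreover have "holds (encode D) Z (shallow_exp d 1) (\<rho>(NU d := int (length D - 1)))"
          using holds_shallow[of "\<rho>(NU d := int (length D - 1))" d "length D - 1" 1] ok' rl sh
          by (simp del: fun_upd_apply add: fun_upd_same)
        ultimately show False using False ev_root[OF ok'] D(1) by simp
      qed
      ultimately show ?thesis by blast
    qed
    ultimately show ?thesis using t(1) unfolding cnt nat_int by blast
  qed
  then show ?thesis unfolding poly_reducible_def by blast
qed

theorem theorem15: "hard_for (W 1) At_Most_k_Sum_Rep_Target_1"
  unfolding hard_for_def W_def using fpt_reducible_poly_trans WCS_poly_reducible by blast

end
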